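(* For any $w\in W$, $M_{w_0w}$ can be expressed as a linear combination of terms of the form $\mathrm{ch}(V_\lambda)$ where $\lambda=(q-1)\varpi_{\overline{I(w)}}+\mu$, where $\mu$ is in the $W$-orbit of some dominant weight between $0$ and $2(h(w)+1)\rho$.
   Context: Setting. $p$ is a prime, $q$ a power of $p$; $G$ is an almost simple simply connected algebraic group over $\overline{\mathbb{F}}_p$, split over $\mathbb{F}_q$ ($p$ sufficiently large, i.e. good for $G$), with split maximal torus $T$, character group $X^*(T)$, Weyl group $W$, simple roots $\Pi$, length $\ell$, longest element $w_0$, fundamental weights $\varpi_i$, $\rho=\sum_i\varpi_i$. $\mathbb{Z}[T]$ is the group ring of $X^*(T)$, with basis $\exp(\lambda)$. For a dominant weight $\lambda$, $V_\lambda$ is the Weyl module corresponding to $\lambda$ and $\mathrm{ch}(V_\lambda)$ its character, given by the Weyl character formula. Basis. For $I\subseteq\Pi$, $\overline{I}=\Pi\setminus I$, $\varpi_I=\sum_{i\in I}\varpi_i$, $W_I=\langle s_i:i\in I\rangle$; $I(w)=\{i:\ell(ws_i)<\ell(w)\}$; $C'_w=\sum_{y\le w}P_{y,w}(1)y\in\mathbb{Z}[W]$ ($P_{y,w}$ the Kazhdan-Lusztig polynomials); $f_w=\frac1{|W_{I(w)}|}C_w'(\exp(\varpi_{\overline{I(w)}}))$, which form a basis of $\mathbb{Z}[T]$ over $\mathbb{Z}[T]^W$. $\langle f,g\rangle=\frac1\delta\sum_{y\in W}\mathrm{sgn}(y)\,y(fg)$ with $\delta=\sum_{y\in W}\mathrm{sgn}(y)\exp(y\rho)$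 the Weyl denominator; $\{f^*_w\}$ is the dual basis, $\langle f_w,f_v^*\rangle=\delta_{w,v}$. $[q]^*\exp(\lambda)=\exp(q\lambda)$. Left cells are the Kazhdan-Lusztig left cells of $W$, i.e. the equivalence classes of the preorder generated by: $x\le_Ly$ if $C_x'$ occurs in $C_s'C_y'$ for some simple reflection $s$; the Duflo involution of a left cell is its unique element minimizing $\ell(w)-2\deg P_{1,w}$. For $w\in W$, $M_w=\langle[q]^*f_{w_0d},f_{w_0w}^*\rangle$, with $d$ the unique Duflo involution in the left cell of $w$. $(\ ,\ )$ is the standard $W$-invariant pairing on weights, and $h(w)=(\rho,\varpi_{I(w)})$. "Between" refers to the usual partial order on weights, in which $\gamma\le\gamma'$ when $\gamma'-\gamma$ is a nonnegative combination of positive roots. *)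

theory Defs
  imports
    "HOL-Analysis.Analysis"
    "HOL-Computational_Algebra.Computational_Algebra"
    "HOL-Library.Poly_Mapping"
begin

section \<open>Root systems\<close>

text \<open>
  An almost simple, simply connected split group is represented by its root datum: an irreducible
  reduced crystallographic root system \<open>\<Phi>\<close> spanning a Euclidean space, with a base \<open>\<Delta>\<close>. As the
  group is simply connected, the character group of the maximal torus is the full weight lattice.
  Sets \<open>I \<subseteq> \<Delta>\<close> of indices are sets of simple roots.
\<close>

definition reflection :: "'a::euclidean_space \<Rightarrow> 'a \<Rightarrow> 'a" where
  "reflection \<alpha> x = x - (2 * (x \<bullet> \<alpha>) / (\<alpha> \<bullet> \<alpha>)) *\<^sub>R \<alpha>"

definition root_system :: "'a::euclidean_space set \<Rightarrow> bool" where
  "root_system \<Phi> \<longleftrightarrow>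
     finite \<Phi> \<and> 0 \<notin> \<Phi> \<and> span \<Phi> = UNIV \<and>
     (\<forall>\<alpha>\<in>\<Phi>. reflection \<alpha> ` \<Phi> = \<Phi>) \<and>
     (\<forall>\<alpha>\<in>\<Phi>. \<forall>\<beta>\<in>\<Phi>. 2 * (\<beta> \<bullet> \<alpha>) / (\<alpha> \<bullet> \<alpha>) \<in> \<int>) \<and>
     (\<forall>\<alpha>\<in>\<Phi>. \<forall>c. c *\<^sub>R \<alpha> \<in> \<Phi> \<longrightarrow> c = 1 \<or> c = -1)"

definition irreducible_roots :: "'a::euclidean_space set \<Rightarrow> bool" where
  "irreducible_roots \<Phi> \<longleftrightarrow>
     \<Phi> \<noteq> {} \<and>
     \<not> (\<exists>\<Phi>1 \<Phi>2. \<Phi>1 \<noteq> {} \<and> \<Phi>2 \<noteq> {} \<and> \<Phi> = \<Phi>1 \<union> \<Phi>2 \<and> (\<forall>\<alpha>\<in>\<Phi>1. \<forall>\<beta>\<in>\<Phi>2. \<alpha> \<bullet> \<beta> = 0))"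

definition root_base :: "'a::euclidean_space set \<Rightarrow> 'a set \<Rightarrow> bool" where
  "root_base \<Phi> \<Delta> \<longleftrightarrow>
     \<Delta> \<subseteq> \<Phi> \<and> independent \<Delta> \<and>
     (\<forall>\<beta>\<in>\<Phi>. \<exists>c :: 'a \<Rightarrow> int. \<beta> = (\<Sum>\<alpha>\<in>\<Delta>. of_int (c \<alpha>) *\<^sub>R \<alpha>) \<and>
        ((\<forall>\<alpha>\<in>\<Delta>. 0 \<le> c \<alpha>) \<or> (\<forall>\<alpha>\<in>\<Delta>. c \<alpha> \<le> 0)))"

definition positive_roots :: "'a::euclidean_space set \<Rightarrow> 'a set \<Rightarrow> 'a set" where
  "positive_roots \<Phi> \<Delta> =
     {\<beta>\<in>\<Phi>. \<exists>c :: 'a \<Rightarrow> int. \<beta> = (\<Sum>\<alpha>\<in>\<Delta>. of_int (c \<alpha>) *\<^sub>R \<alpha>) \<and> (\<forall>\<alpha>\<in>\<Delta>. 0 \<le> c \<alpha>)}"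

text \<open>
  A prime is good if it divides no coefficient of the highest root; since every integer between 1
  and such a coefficient is itself the coefficient of some root, all roots may be used instead.
\<close>

definition good_prime :: "'a::euclidean_space set \<Rightarrow> 'a set \<Rightarrow> nat \<Rightarrow> bool" where
  "good_prime \<Phi> \<Delta> p \<longleftrightarrow> prime p \<and>
     (\<forall>\<beta>\<in>\<Phi>. \<forall>c :: 'a \<Rightarrow> int. \<beta> = (\<Sum>\<alpha>\<in>\<Delta>. of_int (c \<alpha>) *\<^sub>R \<alpha>) \<longrightarrow>
        (\<forall>\<alpha>\<in>\<Delta>. c \<alpha> \<noteq> 0 \<longrightarrow> \<not> int p dvd c \<alpha>))"

definition weights :: "'a::euclidean_space set \<Rightarrow> 'a set" where
  "weights \<Phi> = {\<nu>. \<forall>\<alpha>\<in>\<Phi>. 2 * (\<nu> \<bullet> \<alpha>) / (\<alpha> \<bullet> \<alpha>) \<in> \<int>}"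

definition dominant_weights :: "'a::euclidean_space set \<Rightarrow> 'a set \<Rightarrow> 'a set" where
  "dominant_weights \<Phi> \<Delta> = {\<nu>\<in>weights \<Phi>. \<forall>\<alpha>\<in>\<Delta>. 0 \<le> \<nu> \<bullet> \<alpha>}"

definition fundamental_weight :: "'a::euclidean_space set \<Rightarrow> 'a \<Rightarrow> 'a" where
  "fundamental_weight \<Delta> \<alpha> =
     (THE v. \<forall>\<beta>\<in>\<Delta>. 2 * (v \<bullet> \<beta>) / (\<beta> \<bullet> \<beta>) = (if \<beta> = \<alpha> then 1 else 0))"

definition varpi :: "'a::euclidean_space set \<Rightarrow> 'a set \<Rightarrow> 'a" where
  "varpi \<Delta> I = (\<Sum>\<alpha>\<in>I. fundamental_weight \<Delta> \<alpha>)"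

abbreviation rho :: "'a::euclidean_space set \<Rightarrow> 'a" where
  "rho \<Delta> \<equiv> varpi \<Delta> \<Delta>"

text \<open>
  The coefficients are real: \<open>0\<close> and \<open>2 (h(w) + 1) \<rho>\<close>, the latter not a weight in general, are to
  be compared with weights lying in any coset of the root lattice.
\<close>

definition weight_le :: "'a::euclidean_space set \<Rightarrow> 'a set \<Rightarrow> 'a \<Rightarrow> 'a \<Rightarrow> bool" where
  "weight_le \<Phi> \<Delta> \<gamma> \<gamma>' \<longleftrightarrow>
     (\<exists>c :: 'a \<Rightarrow> real. (\<forall>\<alpha>\<in>positive_roots \<Phi> \<Delta>. 0 \<le> c \<alpha>) \<and>
        \<gamma>' - \<gamma> = (\<Sum>\<alpha>\<in>positive_roots \<Phi> \<Delta>. c \<alpha> *\<^sub>R \<alpha>))"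

text \<open>
  The invariant pairing is normalised by \<open>(\<alpha>, \<alpha>) = 2\<close> for short roots \<open>\<alpha>\<close> (for all roots in the
  simply laced case); by irreducibility the invariant form is unique up to scaling.
\<close>

definition std_pairing :: "'a::euclidean_space set \<Rightarrow> 'a \<Rightarrow> 'a \<Rightarrow> real" where
  "std_pairing \<Phi> x y = 2 * (x \<bullet> y) / Min ((\<lambda>\<alpha>. \<alpha> \<bullet> \<alpha>) ` \<Phi>)"


section \<open>The Weyl group\<close>

text \<open>
  Products of reflections form a group since reflections are involutions. \<open>weyl_group \<Delta>\<close> is \<open>W\<close>,
  and \<open>weyl_group I\<close> is the parabolic subgroup \<open>W\<^sub>I\<close>.
\<close>

definition word_prod :: "('a \<Rightarrow> 'a) list \<Rightarrow> 'a \<Rightarrow> 'a" where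
  "word_prod ss = foldr (\<circ>) ss id"

definition weyl_group :: "'a::euclidean_space set \<Rightarrow> ('a \<Rightarrow> 'a) set" where
  "weyl_group I = {word_prod ss | ss. set ss \<subseteq> reflection ` I}"

definition len :: "'a::euclidean_space set \<Rightarrow> ('a \<Rightarrow> 'a) \<Rightarrow> nat" where
  "len \<Delta> w = (LEAST n. \<exists>ss. set ss \<subseteq> reflection ` \<Delta> \<and> length ss = n \<and> word_prod ss = w)"

definition longest :: "'a::euclidean_space set \<Rightarrow> 'a \<Rightarrow> 'a" where
  "longest \<Delta> = (THE w. w \<in> weyl_group \<Delta> \<and> (\<forall>x\<in>weyl_group \<Delta>. len \<Delta> x \<le> len \<Delta> w))"

definition weyl_sgn :: "'a::euclidean_space set \<Rightarrow> ('a \<Rightarrow> 'a) \<Rightarrow> int" where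
  "weyl_sgn \<Delta> w = (-1) ^ len \<Delta> w"

definition right_descents :: "'a::euclidean_space set \<Rightarrow> ('a \<Rightarrow> 'a) \<Rightarrow> 'a set" where
  "right_descents \<Delta> w = {\<alpha>\<in>\<Delta>. len \<Delta> (w \<circ> reflection \<alpha>) < len \<Delta> w}"

definition bruhat_less :: "'a::euclidean_space set \<Rightarrow> (('a \<Rightarrow> 'a) \<times> ('a \<Rightarrow> 'a)) set" where
  "bruhat_less \<Delta> =
     {(x, x \<circ> t) | x t. x \<in> weyl_group \<Delta> \<and>
        (\<exists>u\<in>weyl_group \<Delta>. \<exists>\<alpha>\<in>\<Delta>. t = u \<circ> reflection \<alpha> \<circ> inv u) \<and> len \<Delta> x < len \<Delta> (x \<circ> t)}\<^sup>+"

definition bruhat_le :: "'a::euclidean_space set \<Rightarrow> ('a \<Rightarrow> 'a) \<Rightarrow> ('a \<Rightarrow> 'a) \<Rightarrow> bool" where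
  "bruhat_le \<Delta> y w \<longleftrightarrow> y \<in> weyl_group \<Delta> \<and> (y = w \<or> (y, w) \<in> bruhat_less \<Delta>)"


section \<open>Kazhdan-Lusztig polynomials\<close>

text \<open>
  Both \<open>\<int>[v, 1/v]\<close>, where \<open>v\<^sup>2\<close> is the Hecke parameter, and the group ring of the weights are
  rings of finitely supported functions under convolution. \<open>push g\<close> is the additive map sending
  the basis element of \<open>k\<close> to that of \<open>g k\<close>; it gives the bar involution of \<open>\<int>[v, 1/v]\<close>, and the
  action of \<open>W\<close> and \<open>[q]\<^sup>*\<close> on \<open>\<int>[T]\<close>.
\<close>

type_synonym laurent = "int \<Rightarrow>\<^sub>0 int"

definition push :: "('k \<Rightarrow> 'l) \<Rightarrow> ('k \<Rightarrow>\<^sub>0 int) \<Rightarrow> 'l \<Rightarrow>\<^sub>0 int" where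
  "push g f = (\<Sum>k\<in>Poly_Mapping.keys f. Poly_Mapping.single (g k) (Poly_Mapping.lookup f k))"

definition v_pow :: "int \<Rightarrow> laurent" where
  "v_pow k = Poly_Mapping.single k 1"

definition poly_at_v2 :: "int poly \<Rightarrow> laurent" where
  "poly_at_v2 P = (\<Sum>i\<le>degree P. of_int (coeff P i) * v_pow (2 * int i))"

text \<open>
  An element of the Hecke algebra is given by its coefficients in the standard basis \<open>T\<^sub>w\<close>, where
  \<open>(T\<^sub>s - v\<^sup>2) (T\<^sub>s + 1) = 0\<close>. The next two maps are left multiplication by \<open>T\<^sub>s\<close> and by its inverse
  \<open>v\<^sup>-\<^sup>2 T\<^sub>s + (v\<^sup>-\<^sup>2 - 1)\<close>.
\<close>

type_synonym 'a hecke = "('a \<Rightarrow> 'a) \<Rightarrow> laurent"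

definition hecke_T :: "'a::euclidean_space set \<Rightarrow> ('a \<Rightarrow> 'a) \<Rightarrow> 'a hecke \<Rightarrow> 'a hecke" where
  "hecke_T \<Delta> s h = (\<lambda>x. if len \<Delta> (s \<circ> x) < len \<Delta> x
      then h (s \<circ> x) + (v_pow 2 - 1) * h x else v_pow 2 * h (s \<circ> x))"

definition hecke_T_inv :: "'a::euclidean_space set \<Rightarrow> ('a \<Rightarrow> 'a) \<Rightarrow> 'a hecke \<Rightarrow> 'a hecke" where
  "hecke_T_inv \<Delta> s h = (\<lambda>x. v_pow (-2) * hecke_T \<Delta> s h x + (v_pow (-2) - 1) * h x)"

text \<open>
  The bar involution sends \<open>T\<^sub>w\<close> to the inverse of \<open>T\<close> at \<open>inv w\<close>, that is, to the product of the
  inverses of \<open>T\<^sub>s\<close> along a reduced word of \<open>w\<close>. By Matsumoto's theorem the choice of the word is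
  immaterial.
\<close>

definition reduced_word :: "'a::euclidean_space set \<Rightarrow> ('a \<Rightarrow> 'a) \<Rightarrow> ('a \<Rightarrow> 'a) list" where
  "reduced_word \<Delta> w =
     (SOME ss. set ss \<subseteq> reflection ` \<Delta> \<and> length ss = len \<Delta> w \<and> word_prod ss = w)"

definition bar_T :: "'a::euclidean_space set \<Rightarrow> ('a \<Rightarrow> 'a) \<Rightarrow> 'a hecke" where
  "bar_T \<Delta> w = foldr (hecke_T_inv \<Delta>) (reduced_word \<Delta> w) (\<lambda>x. if x = id then 1 else 0)"

definition hecke_bar :: "'a::euclidean_space set \<Rightarrow> 'a hecke \<Rightarrow> 'a hecke" where
  "hecke_bar \<Delta> h = (\<lambda>x. \<Sum>w\<in>weyl_group \<Delta>. push uminus (h w) * bar_T \<Delta> w x)"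

text \<open>
  \<open>kl_family \<Delta> w P\<close>: the \<open>P y\<close> are the polynomials \<open>P\<^sub>y\<^sub>,\<^sub>w\<close> for this \<open>w\<close>, characterised by degree
  bounds and by bar invariance of \<open>v\<^bsup>-\<ell>(w)\<^esup> \<Sum>\<^sub>y P\<^sub>y\<^sub>,\<^sub>w(v\<^sup>2) T\<^sub>y\<close>.
\<close>

definition kl_family ::
    "'a::euclidean_space set \<Rightarrow> ('a \<Rightarrow> 'a) \<Rightarrow> (('a \<Rightarrow> 'a) \<Rightarrow> int poly) \<Rightarrow> bool" where
  "kl_family \<Delta> w P \<longleftrightarrow>
     P w = 1 \<and>
     (\<forall>y. \<not> bruhat_le \<Delta> y w \<longrightarrow> P y = 0) \<and>
     (\<forall>y. bruhat_le \<Delta> y w \<and> y \<noteq> w \<longrightarrow>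
        2 * int (degree (P y)) \<le> int (len \<Delta> w) - int (len \<Delta> y) - 1) \<and>
     (let C = (\<lambda>y. v_pow (- int (len \<Delta> w)) * poly_at_v2 (P y)) in hecke_bar \<Delta> C = C)"

definition kl_poly ::
    "'a::euclidean_space set \<Rightarrow> ('a \<Rightarrow> 'a) \<Rightarrow> ('a \<Rightarrow> 'a) \<Rightarrow> int poly" where
  "kl_poly \<Delta> y w = (THE P. kl_family \<Delta> w P) y"


section \<open>Left cells\<close>

text \<open>Elements of \<open>\<int>[W]\<close> are given by their coefficients, which vanish outside \<open>W\<close>.\<close>

type_synonym 'a weyl_ring = "('a \<Rightarrow> 'a) \<Rightarrow> int"

definition weyl_ring_mult ::
    "'a::euclidean_space set \<Rightarrow> 'a weyl_ring \<Rightarrow> 'a weyl_ring \<Rightarrow> 'a weyl_ring" where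
  "weyl_ring_mult \<Delta> a b =
     (\<lambda>x. \<Sum>y\<in>weyl_group \<Delta>. \<Sum>z\<in>weyl_group \<Delta>. if y \<circ> z = x then a y * b z else 0)"

definition kl_C' :: "'a::euclidean_space set \<Rightarrow> ('a \<Rightarrow> 'a) \<Rightarrow> 'a weyl_ring" where
  "kl_C' \<Delta> w = (\<lambda>y. if bruhat_le \<Delta> y w then poly (kl_poly \<Delta> y w) 1 else 0)"

definition occurs_in :: "'a::euclidean_space set \<Rightarrow> ('a \<Rightarrow> 'a) \<Rightarrow> 'a weyl_ring \<Rightarrow> bool" where
  "occurs_in \<Delta> x a \<longleftrightarrow>
     (\<exists>c :: ('a \<Rightarrow> 'a) \<Rightarrow> int. a = (\<lambda>u. \<Sum>z\<in>weyl_group \<Delta>. c z * kl_C' \<Delta> z u) \<and> c x \<noteq> 0)"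

definition left_preorder :: "'a::euclidean_space set \<Rightarrow> (('a \<Rightarrow> 'a) \<times> ('a \<Rightarrow> 'a)) set" where
  "left_preorder \<Delta> =
     {(x, y). x \<in> weyl_group \<Delta> \<and> y \<in> weyl_group \<Delta> \<and>
        (\<exists>\<alpha>\<in>\<Delta>. occurs_in \<Delta> x (weyl_ring_mult \<Delta> (kl_C' \<Delta> (reflection \<alpha>)) (kl_C' \<Delta> y)))}\<^sup>*"

definition left_cell :: "'a::euclidean_space set \<Rightarrow> ('a \<Rightarrow> 'a) \<Rightarrow> ('a \<Rightarrow> 'a) set" where
  "left_cell \<Delta> w = {x. (x, w) \<in> left_preorder \<Delta> \<and> (w, x) \<in> left_preorder \<Delta>}"

text \<open>The minimiser is unique by a theorem of Lusztig.\<close>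

definition duflo :: "'a::euclidean_space set \<Rightarrow> ('a \<Rightarrow> 'a) \<Rightarrow> 'a \<Rightarrow> 'a" where
  "duflo \<Delta> w =
     arg_min_on (\<lambda>x. int (len \<Delta> x) - 2 * int (degree (kl_poly \<Delta> id x))) (left_cell \<Delta> w)"


section \<open>The group ring of the weight lattice\<close>

text \<open>
  \<open>'a \<Rightarrow>\<^sub>0 int\<close> is the group ring of the whole ambient space; \<open>\<int>[T]\<close> is its subring of elements
  supported on weights. Both are integral domains, so that quotients, where they exist, are unique.
\<close>

type_synonym 'a grp_ring = "'a \<Rightarrow>\<^sub>0 int"

definition ZT :: "'a::euclidean_space set \<Rightarrow> 'a grp_ring set" where
  "ZT \<Phi> = {f. Poly_Mapping.keys f \<subseteq> weights \<Phi>}"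

definition gexp :: "'a \<Rightarrow> 'a grp_ring" where
  "gexp \<nu> = Poly_Mapping.single \<nu> 1"

definition weyl_ring_act :: "'a::euclidean_space set \<Rightarrow> 'a weyl_ring \<Rightarrow> 'a grp_ring \<Rightarrow> 'a grp_ring"
  where "weyl_ring_act \<Delta> a f = (\<Sum>y\<in>weyl_group \<Delta>. of_int (a y) * push y f)"

definition frob :: "nat \<Rightarrow> 'a::euclidean_space grp_ring \<Rightarrow> 'a grp_ring" where
  "frob q = push (\<lambda>\<nu>. real q *\<^sub>R \<nu>)"

definition antisymm :: "'a::euclidean_space set \<Rightarrow> 'a grp_ring \<Rightarrow> 'a grp_ring" where
  "antisymm \<Delta> f = (\<Sum>y\<in>weyl_group \<Delta>. of_int (weyl_sgn \<Delta> y) * push y f)"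

definition weyl_denominator :: "'a::euclidean_space set \<Rightarrow> 'a grp_ring" where
  "weyl_denominator \<Delta> = antisymm \<Delta> (gexp (rho \<Delta>))"

text \<open>The character of the Weyl module of dominant highest weight, by Weyl's formula.\<close>

definition weyl_char :: "'a::euclidean_space set \<Rightarrow> 'a \<Rightarrow> 'a grp_ring" where
  "weyl_char \<Delta> \<nu> = (THE h. weyl_denominator \<Delta> * h = antisymm \<Delta> (gexp (\<nu> + rho \<Delta>)))"

definition ZT_pairing ::
    "'a::euclidean_space set \<Rightarrow> 'a grp_ring \<Rightarrow> 'a grp_ring \<Rightarrow> 'a grp_ring" where
  "ZT_pairing \<Delta> f g = (THE h. weyl_denominator \<Delta> * h = antisymm \<Delta> (f * g))"

definition kl_steinberg :: "'a::euclidean_space set \<Rightarrow> ('a \<Rightarrow> 'a) \<Rightarrow> 'a grp_ring" where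
  "kl_steinberg \<Delta> w =
     (THE f. of_nat (card (weyl_group (right_descents \<Delta> w))) * f =
        weyl_ring_act \<Delta> (kl_C' \<Delta> w) (gexp (varpi \<Delta> (\<Delta> - right_descents \<Delta> w))))"

definition kl_steinberg_dual ::
    "'a::euclidean_space set \<Rightarrow> 'a set \<Rightarrow> ('a \<Rightarrow> 'a) \<Rightarrow> 'a grp_ring" where
  "kl_steinberg_dual \<Phi> \<Delta> v =
     (THE g. g \<in> ZT \<Phi> \<and>
        (\<forall>w\<in>weyl_group \<Delta>. ZT_pairing \<Delta> (kl_steinberg \<Delta> w) g = (if w = v then 1 else 0)))"

definition M_elem ::
    "'a::euclidean_space set \<Rightarrow> 'a set \<Rightarrow> nat \<Rightarrow> ('a \<Rightarrow> 'a) \<Rightarrow> 'a grp_ring" where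
  "M_elem \<Phi> \<Delta> q w =
     ZT_pairing \<Delta> (frob q (kl_steinberg \<Delta> (longest \<Delta> \<circ> duflo \<Delta> w)))
       (kl_steinberg_dual \<Phi> \<Delta> (longest \<Delta> \<circ> w))"

definition h_val :: "'a::euclidean_space set \<Rightarrow> 'a set \<Rightarrow> ('a \<Rightarrow> 'a) \<Rightarrow> real" where
  "h_val \<Phi> \<Delta> w = std_pairing \<Phi> (rho \<Delta>) (varpi \<Delta> (right_descents \<Delta> w))"

end

theory Submission
  imports Defs
begin

text \<open>
  For \<open>g\<^sub>v = exp (v \<varpi>\<^bsub>I(v)\<^esub>)\<close> the weights of \<open>f\<^sub>w g\<^sub>v\<close> lie in the convex hull of the orbit of
  \<open>\<rho> + (\<varpi>\<^bsub>I(v)\<^esub> - \<varpi>\<^bsub>I(w)\<^esub>)\<close>. Hence \<open>\<langle>f\<^sub>w, g\<^sub>v\<rangle>\<close> vanishes unless \<open>\<varpi>\<^bsub>I(w)\<^esub> \<le> \<varpi>\<^bsub>I(v)\<^esub>\<close>, and its weights lie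
  in the hull of \<open>\<varpi>\<^bsub>I(v)\<^esub> - \<varpi>\<^bsub>I(w)\<^esub>\<close>. If \<open>I(w) = I(v) = I\<close>, the pairing is the signed sum of the
  coefficients of \<open>C'\<^sub>w\<close> over the coset of \<open>v\<close> modulo the parabolic subgroup of the complement of
  \<open>I\<close>, where \<open>v\<close> is minimal, so it vanishes unless \<open>v \<le> w\<close> and is \<open>sgn w\<close> for \<open>v = w\<close>. The Gram
  matrix is therefore triangular, and in its inversion the bounds telescope: all weights of
  \<open>f\<^sup>*\<^sub>w\<close> lie in the hull of \<open>\<varpi>\<^bsub>I(w)\<^esub>\<close>. Left cells have constant right descent sets, so the weights of
  \<open>[q]\<^sup>* f\<close> in the definition of \<open>M\<close> are conjugate to \<open>q \<varpi>\<close>, with \<open>\<varpi>\<close> the sum of the fundamental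
  weights outside \<open>I(w)\<close>. Finally, if \<open>x\<close> lies in the hull of \<open>b\<close>, so does the difference between
  the dominant conjugate of \<open>q \<varpi> + x\<close> and \<open>q \<varpi>\<close>. This bounds \<open>\<mu>\<close> by \<open>2 \<rho>\<close>, which is stronger than
  the bound \<open>2 (h(w) + 1) \<rho>\<close>.
\<close>

text \<open>The Kazhdan-Lusztig polynomials, the characters, the pairing, the \<open>f_w\<close> and
  the dual basis are all definite descriptions, so each needs existence and uniqueness before
  anything can be computed; most of the development supplies this. Uniqueness of the dual elements
  is the least direct: back substitution gives elements dual to the \<open>f_w\<close>, but that
  there are no others follows from the fact that they generate Z[T] over the invariants, which is
  Steinberg's argument.

  Estimates use \<open>whull b\<close>, cut out by linear inequalities: it is convex, stable under
  W, and a sum of points of two hulls lies in the hull of the sum of the bounds. Division by the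
  Weyl denominator lowers a bound by \<rho>. These rules compose along the whole computation.

  Origin of 2\<rho>: with J the complement of I = I(w) and \<lambda> a highest weight that occurs,
  \<mu> is (\<lambda> + \<rho> - q \<varpi>_J) - \<varpi>_I. The bracket lies in the hull of
  \<varpi>_I, and -\<varpi>_I = w_0 \<rho> + \<varpi>_J in that of \<rho> + \<varpi>_J; the bounds
  add up to 2\<rho>.\<close>

section \<open>Reflections and the Weyl group\<close>

text \<open>Weyl group elements are functions; unfolding \<open>(f \<circ> g) x\<close> under binders would destroy
  the products in the group.\<close>

declare comp_apply [simp del] id_apply [simp del]

lemma linear_reflection: "linear (reflection \<alpha>)"
  unfolding reflection_def
  by (rule linearI) (auto simp: inner_add_left algebra_simps add_divide_distrib)

lemma reflection_reflection [simp]: "reflection \<alpha> (reflection \<alpha> x) = x"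
  by (cases "\<alpha> = 0") (auto simp: reflection_def inner_diff_left)

lemma reflection_comp_self [simp]: "reflection \<alpha> \<circ> reflection \<alpha> = id"
  by (simp add: fun_eq_iff comp_apply id_apply)

lemma reflection_comp_cancel [simp]: "(f \<circ> reflection \<alpha>) \<circ> reflection \<alpha> = f"
  by (simp add: fun_eq_iff comp_apply id_apply)

lemma reflection_self: "\<alpha> \<noteq> 0 \<Longrightarrow> reflection \<alpha> \<alpha> = - \<alpha>"
  by (simp add: reflection_def scaleR_2)

lemma reflection_uminus: "reflection (- \<alpha>) = reflection \<alpha>"
  by (simp add: reflection_def fun_eq_iff)

lemma inner_reflection: "reflection \<alpha> x \<bullet> reflection \<alpha> y = x \<bullet> y"
  by (cases "\<alpha> = 0") (auto simp: reflection_def inner_diff_left inner_diff_right inner_commute field_simps)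

lemma reflection_eq_self_iff: "\<alpha> \<noteq> 0 \<Longrightarrow> reflection \<alpha> x = x \<longleftrightarrow> x \<bullet> \<alpha> = 0"
  by (auto simp: reflection_def)

lemma word_prod_Nil [simp]: "word_prod [] = id"
  and word_prod_Cons [simp]: "word_prod (s # ss) = s \<circ> word_prod ss"
  by (simp_all add: word_prod_def comp_apply id_apply)

lemma word_prod_append [simp]: "word_prod (ss @ ts) = word_prod ss \<circ> word_prod ts"
  by (induction ss) (simp_all add: comp_assoc)

lemma word_prod_rev_comp:
  "set ss \<subseteq> range reflection \<Longrightarrow> word_prod (rev ss) \<circ> word_prod ss = id"
proof (induction ss)
  case (Cons s ss)
  then obtain \<alpha> where s: "s = reflection \<alpha>" by auto
  have "word_prod (rev (s # ss)) \<circ> word_prod (s # ss)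
      = word_prod (rev ss) \<circ> (s \<circ> s) \<circ> word_prod ss"
    by (simp add: comp_assoc)
  with Cons s show ?case by simp
qed simp

lemma weyl_group_id [simp]: "id \<in> weyl_group I"
  unfolding weyl_group_def by (auto intro!: exI[of _ "[]"])

lemma weyl_group_comp: "x \<in> weyl_group I \<Longrightarrow> y \<in> weyl_group I \<Longrightarrow> x \<circ> y \<in> weyl_group I"
  unfolding weyl_group_def
  by (smt (verit, best) Un_least mem_Collect_eq set_append word_prod_append)

lemma reflection_in_weyl_group: "\<alpha> \<in> I \<Longrightarrow> reflection \<alpha> \<in> weyl_group I"
  unfolding weyl_group_def by (auto intro!: exI[of _ "[reflection \<alpha>]"])

lemma weyl_group_mono: "I \<subseteq> J \<Longrightarrow> weyl_group I \<subseteq> weyl_group J"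
  unfolding weyl_group_def by blast

lemma weyl_group_induct [consumes 1, case_names id step]:
  assumes "w \<in> weyl_group I" "P id"
    and "\<And>w \<alpha>. w \<in> weyl_group I \<Longrightarrow> \<alpha> \<in> I \<Longrightarrow> P w \<Longrightarrow> P (w \<circ> reflection \<alpha>)"
  shows "P w"
proof -
  have "word_prod ss \<in> weyl_group I \<and> P (word_prod ss)" if "set ss \<subseteq> reflection ` I" for ss
    using that
  proof (induction ss rule: rev_induct)
    case (snoc s ss)
    then obtain \<alpha> where a: "\<alpha> \<in> I" "s = reflection \<alpha>" by auto
    from snoc have "word_prod ss \<in> weyl_group I" "P (word_prod ss)" by auto
    from assms(3)[OF this(1) a(1) this(2)] weyl_group_comp[OF this(1) reflection_in_weyl_group[OF a(1)]]
    show ?case by (simp add: a(2))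
  qed (simp add: assms(2))
  with assms(1) show ?thesis unfolding weyl_group_def by blast
qed

lemma weyl_group_linear: "w \<in> weyl_group I \<Longrightarrow> linear w"
  by (induction rule: weyl_group_induct)
    (blast intro: linear_compose linear_reflection linear_id)+

lemma weyl_group_inner: "w \<in> weyl_group I \<Longrightarrow> w x \<bullet> w y = x \<bullet> y"
  by (induction arbitrary: x y rule: weyl_group_induct) (auto simp: inner_reflection comp_apply id_apply)

lemma weyl_group_inverse_ex: "w \<in> weyl_group I \<Longrightarrow> \<exists>v\<in>weyl_group I. v \<circ> w = id \<and> w \<circ> v = id"
proof -
  assume "w \<in> weyl_group I"
  then obtain ss where ss: "set ss \<subseteq> reflection ` I" "w = word_prod ss"
    unfolding weyl_group_def by blast
  have "set ss \<subseteq> range reflection" "set (rev ss) \<subseteq> range reflection" using ss by auto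
  from word_prod_rev_comp[OF this(1)] word_prod_rev_comp[OF this(2)]
  have "word_prod (rev ss) \<circ> w = id" "w \<circ> word_prod (rev ss) = id" using ss(2) by auto
  moreover have "word_prod (rev ss) \<in> weyl_group I"
    using ss(1) unfolding weyl_group_def by (intro CollectI exI[of _ "rev ss"]) simp
  ultimately show ?thesis by blast
qed

lemma weyl_group_bij: "w \<in> weyl_group I \<Longrightarrow> bij w"
  using weyl_group_inverse_ex o_bij by blast

lemma weyl_group_inv: "w \<in> weyl_group I \<Longrightarrow> inv w \<in> weyl_group I"
  using weyl_group_inverse_ex inv_unique_comp by metis

lemma weyl_group_inv_comp [simp]:
  "w \<in> weyl_group I \<Longrightarrow> inv w \<circ> w = id" "w \<in> weyl_group I \<Longrightarrow> w \<circ> inv w = id"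
  using weyl_group_bij by (metis bij_is_inj inv_o_cancel, metis bij_is_surj surj_iff)

lemma weyl_group_inv_apply [simp]:
  "w \<in> weyl_group I \<Longrightarrow> inv w (w x) = x" "w \<in> weyl_group I \<Longrightarrow> w (inv w x) = x"
  using weyl_group_inv_comp by (metis comp_apply id_apply)+

lemma weyl_group_inner_inv: "w \<in> weyl_group I \<Longrightarrow> w x \<bullet> y = x \<bullet> inv w y"
  by (metis weyl_group_inner weyl_group_inv_apply(2))

lemma weyl_group_comp_reflection_iff:
  "\<alpha> \<in> I \<Longrightarrow> w \<circ> reflection \<alpha> \<in> weyl_group I \<longleftrightarrow> w \<in> weyl_group I"
  by (metis reflection_comp_cancel reflection_in_weyl_group weyl_group_comp)

lemma reflection_comp_weyl_group_iff:
  "\<alpha> \<in> I \<Longrightarrow> reflection \<alpha> \<circ> w \<in> weyl_group I \<longleftrightarrow> w \<in> weyl_group I"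
  by (metis comp_assoc comp_id fun.map_id reflection_comp_self id_comp
      reflection_in_weyl_group weyl_group_comp)

lemma conj_reflection:
  "w \<in> weyl_group I \<Longrightarrow> w \<circ> reflection \<alpha> \<circ> inv w = reflection (w \<alpha>)"
proof
  fix x assume w: "w \<in> weyl_group I"
  have "w (reflection \<alpha> (inv w x)) = x - (2 * (inv w x \<bullet> \<alpha>) / (\<alpha> \<bullet> \<alpha>)) *\<^sub>R w \<alpha>"
    using w by (simp add: reflection_def linear_diff[OF weyl_group_linear] linear_cmul[OF weyl_group_linear])
  moreover have "inv w x \<bullet> \<alpha> = x \<bullet> w \<alpha>" "\<alpha> \<bullet> \<alpha> = w \<alpha> \<bullet> w \<alpha>"
    using w by (metis weyl_group_inner weyl_group_inv_apply(2))+
  ultimately show "(w \<circ> reflection \<alpha> \<circ> inv w) x = reflection (w \<alpha>) x"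
    by (simp add: reflection_def comp_apply)
qed

lemma comp_reflection_eq: "w \<in> weyl_group I \<Longrightarrow> w \<circ> reflection \<alpha> = reflection (w \<alpha>) \<circ> w"
  by (subst conj_reflection[symmetric]) (auto simp: comp_assoc)

lemma bij_betw_comp_reflection:
  "\<alpha> \<in> I \<Longrightarrow> bij_betw (\<lambda>y. y \<circ> reflection \<alpha>) (weyl_group I) (weyl_group I)"
  by (rule bij_betw_byWitness[where f' = "\<lambda>y. y \<circ> reflection \<alpha>"])
    (auto simp: weyl_group_comp_reflection_iff)

lemma bij_betw_comp_left:
  "x \<in> weyl_group I \<Longrightarrow> bij_betw (\<lambda>y. x \<circ> y) (weyl_group I) (weyl_group I)"
  by (rule bij_betw_byWitness[where f' = "\<lambda>y. inv x \<circ> y"])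
    (auto simp: weyl_group_comp weyl_group_inv comp_assoc[symmetric])

lemma bij_betw_comp_right:
  "x \<in> weyl_group I \<Longrightarrow> bij_betw (\<lambda>y. y \<circ> x) (weyl_group I) (weyl_group I)"
  by (rule bij_betw_byWitness[where f' = "\<lambda>y. y \<circ> inv x"])
    (auto simp: weyl_group_comp weyl_group_inv comp_assoc)

section \<open>Based root systems\<close>

lemma finite_max_ex:
  fixes f :: "'b \<Rightarrow> 'c::linorder"
  assumes "finite S" "S \<noteq> {}" obtains y where "y \<in> S" "\<And>z. z \<in> S \<Longrightarrow> f z \<le> f y"
proof -
  have "Max (f ` S) \<in> f ` S" using assms by (intro Max_in) auto
  then obtain y where y: "y \<in> S" "Max (f ` S) = f y" by auto
  have "f z \<le> f y" if "z \<in> S" for z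
    unfolding y(2)[symmetric] using that assms(1) by (intro Max_ge) auto
  with y(1) show thesis using that by blast
qed

locale based_root_system =
  fixes \<Phi> \<Delta> :: "'a::euclidean_space set"
  assumes root_system: "root_system \<Phi>" and root_base: "root_base \<Phi> \<Delta>"
begin

abbreviation W where "W \<equiv> weyl_group \<Delta>"
abbreviation fw where "fw \<equiv> fundamental_weight \<Delta>"
abbreviation pos where "pos \<equiv> positive_roots \<Phi> \<Delta>"
abbreviation lng where "lng \<equiv> len \<Delta>"
abbreviation sg where "sg \<equiv> weyl_sgn \<Delta>"
abbreviation D where "D \<equiv> right_descents \<Delta>"

lemma finite_roots [simp]: "finite \<Phi>" and zero_not_root: "0 \<notin> \<Phi>" and span_roots: "span \<Phi> = UNIV"
  and reflection_image_roots: "\<alpha> \<in> \<Phi> \<Longrightarrow> reflection \<alpha> ` \<Phi> = \<Phi>"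
  and cartan_integer: "\<alpha> \<in> \<Phi> \<Longrightarrow> \<beta> \<in> \<Phi> \<Longrightarrow> 2 * (\<beta> \<bullet> \<alpha>) / (\<alpha> \<bullet> \<alpha>) \<in> \<int>"
  and root_multiple: "\<alpha> \<in> \<Phi> \<Longrightarrow> c *\<^sub>R \<alpha> \<in> \<Phi> \<Longrightarrow> c = 1 \<or> c = -1"
  using root_system unfolding root_system_def by auto

lemma simple_root: "\<alpha> \<in> \<Delta> \<Longrightarrow> \<alpha> \<in> \<Phi>" and independent_base: "independent \<Delta>"
  using root_base unfolding root_base_def by auto

lemma finite_base [simp]: "finite \<Delta>"
  using finite_subset[OF _ finite_roots] simple_root by auto

lemma root_expansion:
  assumes "\<beta> \<in> \<Phi>"
  obtains c :: "'a \<Rightarrow> int" where "\<beta> = (\<Sum>\<alpha>\<in>\<Delta>. of_int (c \<alpha>) *\<^sub>R \<alpha>)"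
    "(\<forall>\<alpha>\<in>\<Delta>. 0 \<le> c \<alpha>) \<or> (\<forall>\<alpha>\<in>\<Delta>. c \<alpha> \<le> 0)"
  using assms root_base unfolding root_base_def by blast

lemma root_nonzero: "\<alpha> \<in> \<Phi> \<Longrightarrow> \<alpha> \<noteq> 0" using zero_not_root by auto
lemma simple_nonzero: "\<alpha> \<in> \<Delta> \<Longrightarrow> \<alpha> \<noteq> 0" using simple_root zero_not_root by auto

lemma simple_inner_pos: "\<alpha> \<in> \<Delta> \<Longrightarrow> \<alpha> \<bullet> \<alpha> > 0"
  using simple_nonzero by simp

lemma span_base: "span \<Delta> = UNIV"
proof -
  have "\<Phi> \<subseteq> span \<Delta>"
    by (metis (no_types, lifting) root_expansion span_base span_scale span_sum subsetI)
  with span_roots show ?thesis by (metis span_minimal subspace_span top.extremum_uniqueI)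
qed

lemma eqI_simple:
  assumes "\<And>\<beta>. \<beta> \<in> \<Delta> \<Longrightarrow> x \<bullet> \<beta> = y \<bullet> \<beta>" shows "x = y"
proof -
  have "(x - y) \<bullet> z = 0" if "z \<in> span \<Delta>" for z
    using that
    by (induction rule: span_induct_alt) (auto simp: inner_add_right inner_diff_left assms)
  with span_base have "(x - y) \<bullet> (x - y) = 0" by blast
  then show ?thesis by simp
qed

lemma fundamental_weight_ex:
  assumes "\<alpha> \<in> \<Delta>"
  shows "\<exists>v. \<forall>\<beta>\<in>\<Delta>. 2 * (v \<bullet> \<beta>) / (\<beta> \<bullet> \<beta>) = (if \<beta> = \<alpha> then 1 else 0)"
proof -
  obtain g :: "'a \<Rightarrow> real" where g: "linear g" "\<And>\<beta>. \<beta> \<in> \<Delta> \<Longrightarrow> g \<beta> = (if \<beta> = \<alpha> then \<alpha> \<bullet> \<alpha> / 2 else 0)"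
    using linear_independent_extend[OF independent_base, of "\<lambda>\<beta>. if \<beta> = \<alpha> then \<alpha> \<bullet> \<alpha> / 2 else 0"] by blast
  define v where "v = (\<Sum>b\<in>Basis. g b *\<^sub>R b)"
  have "v \<bullet> x = g x" for x
  proof -
    have "v \<bullet> x = (\<Sum>b\<in>Basis. (x \<bullet> b) * g b)"
      by (simp add: v_def inner_sum_left inner_commute[of x] mult.commute)
    also have "\<dots> = g (\<Sum>b\<in>Basis. (x \<bullet> b) *\<^sub>R b)"
      using g(1) by (simp add: linear_sum linear_cmul)
    finally show ?thesis by (simp add: euclidean_representation)
  qed
  then show ?thesis using g(2) simple_inner_pos assms by (intro exI[of _ v]) auto
qed

lemma fundamental_weight_coroot:
  assumes "\<alpha> \<in> \<Delta>" "\<beta> \<in> \<Delta>"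
  shows "2 * (fw \<alpha> \<bullet> \<beta>) / (\<beta> \<bullet> \<beta>) = (if \<beta> = \<alpha> then 1 else 0)"
proof -
  have "\<exists>!v. \<forall>\<beta>\<in>\<Delta>. 2 * (v \<bullet> \<beta>) / (\<beta> \<bullet> \<beta>) = (if \<beta> = \<alpha> then 1 else 0)"
  proof (rule ex_ex1I[OF fundamental_weight_ex[OF assms(1)]], rule eqI_simple)
    fix x y \<beta> assume "\<forall>\<beta>\<in>\<Delta>. 2 * (x \<bullet> \<beta>) / (\<beta> \<bullet> \<beta>) = (if \<beta> = \<alpha> then 1 else 0)"
      "\<forall>\<beta>\<in>\<Delta>. 2 * (y \<bullet> \<beta>) / (\<beta> \<bullet> \<beta>) = (if \<beta> = \<alpha> then 1 else 0)" "\<beta> \<in> \<Delta>"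
    then have "2 * (x \<bullet> \<beta>) / (\<beta> \<bullet> \<beta>) = 2 * (y \<bullet> \<beta>) / (\<beta> \<bullet> \<beta>)" by metis
    then show "x \<bullet> \<beta> = y \<bullet> \<beta>" using simple_inner_pos[OF \<open>\<beta> \<in> \<Delta>\<close>] by simp
  qed
  from theI'[OF this] assms(2) show ?thesis unfolding fundamental_weight_def by blast
qed

lemma fw_inner_simple:
  "\<alpha> \<in> \<Delta> \<Longrightarrow> \<beta> \<in> \<Delta> \<Longrightarrow> fw \<alpha> \<bullet> \<beta> = (if \<beta> = \<alpha> then \<alpha> \<bullet> \<alpha> / 2 else 0)"
  using fundamental_weight_coroot[of \<alpha> \<beta>] simple_inner_pos[of \<beta>] by (auto split: if_splits)

lemma simple_inner_fw:
  "\<alpha> \<in> \<Delta> \<Longrightarrow> \<beta> \<in> \<Delta> \<Longrightarrow> \<beta> \<bullet> fw \<alpha> = (if \<beta> = \<alpha> then \<alpha> \<bullet> \<alpha> / 2 else 0)"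
  using fw_inner_simple by (simp add: inner_commute)

lemma sum_simple_inner_fw:
  "\<beta> \<in> \<Delta> \<Longrightarrow> (\<Sum>\<alpha>\<in>\<Delta>. c \<alpha> *\<^sub>R \<alpha>) \<bullet> fw \<beta> = c \<beta> * (\<beta> \<bullet> \<beta>) / 2"
  by (simp add: inner_sum_left simple_inner_fw if_distrib cong: if_cong)

text \<open>\<open>fw \<alpha>\<close> is orthogonal to every simple root but \<alpha>, so pairing
  with it isolates one coefficient. Coefficients in the base are read off this way from here
  on.\<close>

lemma simple_expansion: "x = (\<Sum>\<alpha>\<in>\<Delta>. (2 * (x \<bullet> fw \<alpha>) / (\<alpha> \<bullet> \<alpha>)) *\<^sub>R \<alpha>)"
proof -
  obtain c where c: "x = (\<Sum>\<alpha>\<in>\<Delta>. c \<alpha> *\<^sub>R \<alpha>)"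
    using span_base span_finite[OF finite_base] by (metis (no_types, lifting) UNIV_I imageE)
  then have "2 * (x \<bullet> fw \<alpha>) / (\<alpha> \<bullet> \<alpha>) = c \<alpha>" if "\<alpha> \<in> \<Delta>" for \<alpha>
    using that simple_inner_pos[OF that] by (simp add: sum_simple_inner_fw)
  then show ?thesis using c by auto
qed

lemma linear_simple_expansion:
  "linear f \<Longrightarrow> f x = (\<Sum>\<alpha>\<in>\<Delta>. (2 * (x \<bullet> fw \<alpha>) / (\<alpha> \<bullet> \<alpha>)) *\<^sub>R f \<alpha>)"
  using arg_cong[OF simple_expansion[of x], of f] by (simp only: linear_sum linear_cmul)

lemma inner_simple_expansion: "x \<bullet> y = (\<Sum>\<alpha>\<in>\<Delta>. 2 * (y \<bullet> fw \<alpha>) / (\<alpha> \<bullet> \<alpha>) * (x \<bullet> \<alpha>))"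
  using arg_cong[OF simple_expansion[of y], of "\<lambda>z. x \<bullet> z"]
  by (simp only: inner_sum_right inner_scaleR_right)

lemma eqI_fw: assumes "\<And>\<alpha>. \<alpha> \<in> \<Delta> \<Longrightarrow> x \<bullet> fw \<alpha> = y \<bullet> fw \<alpha>" shows "x = y"
  using simple_expansion[of x] simple_expansion[of y] assms by (metis (no_types, lifting) sum.cong)

lemma pos_root: "\<beta> \<in> pos \<Longrightarrow> \<beta> \<in> \<Phi>"
  by (simp add: positive_roots_def)

text \<open>The pairing with \<open>fw \<alpha>\<close> is a positive multiple of the coefficient at
  \<alpha>, and integrality is part of the expansion of any root; so positivity becomes a system of
  linear inequalities.\<close>

lemma pos_iff: "\<beta> \<in> pos \<longleftrightarrow> \<beta> \<in> \<Phi> \<and> (\<forall>\<alpha>\<in>\<Delta>. \<beta> \<bullet> fw \<alpha> \<ge> 0)"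
proof
  assume "\<beta> \<in> pos"
  then obtain c :: "'a \<Rightarrow> int" where "\<beta> \<in> \<Phi>" "\<beta> = (\<Sum>\<alpha>\<in>\<Delta>. of_int (c \<alpha>) *\<^sub>R \<alpha>)" "\<forall>\<alpha>\<in>\<Delta>. 0 \<le> c \<alpha>"
    unfolding positive_roots_def by blast
  then show "\<beta> \<in> \<Phi> \<and> (\<forall>\<alpha>\<in>\<Delta>. \<beta> \<bullet> fw \<alpha> \<ge> 0)" by (simp add: sum_simple_inner_fw)
next
  assume *: "\<beta> \<in> \<Phi> \<and> (\<forall>\<alpha>\<in>\<Delta>. \<beta> \<bullet> fw \<alpha> \<ge> 0)"
  then obtain c :: "'a \<Rightarrow> int" where c: "\<beta> = (\<Sum>\<alpha>\<in>\<Delta>. of_int (c \<alpha>) *\<^sub>R \<alpha>)"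
    using root_expansion by blast
  have "0 \<le> c \<alpha>" if "\<alpha> \<in> \<Delta>" for \<alpha>
  proof -
    have "0 \<le> of_int (c \<alpha>) * (\<alpha> \<bullet> \<alpha>)" using * that c sum_simple_inner_fw[of \<alpha> "\<lambda>\<alpha>. of_int (c \<alpha>)"] by auto
    then show ?thesis using simple_inner_pos[OF that] by (simp add: zero_le_mult_iff)
  qed
  with c * show "\<beta> \<in> pos" unfolding positive_roots_def by blast
qed

lemma root_uminus: "\<beta> \<in> \<Phi> \<Longrightarrow> - \<beta> \<in> \<Phi>"
  using reflection_image_roots[of \<beta>] reflection_self[of \<beta>] zero_not_root by (metis imageI)

lemma pos_or_neg: "\<beta> \<in> \<Phi> \<Longrightarrow> \<beta> \<in> pos \<or> - \<beta> \<in> pos"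
proof -
  assume b: "\<beta> \<in> \<Phi>"
  obtain c :: "'a \<Rightarrow> int" where "\<beta> = (\<Sum>\<alpha>\<in>\<Delta>. of_int (c \<alpha>) *\<^sub>R \<alpha>)"
    "(\<forall>\<alpha>\<in>\<Delta>. 0 \<le> c \<alpha>) \<or> (\<forall>\<alpha>\<in>\<Delta>. c \<alpha> \<le> 0)"
    using root_expansion[OF b] by blast
  then show ?thesis using b root_uminus[OF b] unfolding pos_iff
    by (auto simp: sum_simple_inner_fw mult_nonpos_nonneg)
qed

lemma not_pos_and_neg: "\<beta> \<in> pos \<Longrightarrow> - \<beta> \<notin> pos"
proof
  assume "\<beta> \<in> pos" "- \<beta> \<in> pos"
  then have "\<beta> = 0" by (intro eqI_fw) (force simp: pos_iff)
  with \<open>\<beta> \<in> pos\<close> show False using zero_not_root pos_iff by blast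
qed

lemma simple_pos: "\<alpha> \<in> \<Delta> \<Longrightarrow> \<alpha> \<in> pos"
  using simple_root simple_inner_fw simple_inner_pos by (auto simp: pos_iff less_imp_le)

lemma finite_pos [simp]: "finite pos" by (simp add: positive_roots_def)

lemma reflection_inner_fw:
  "\<alpha> \<in> \<Delta> \<Longrightarrow> \<gamma> \<in> \<Delta> \<Longrightarrow> \<gamma> \<noteq> \<alpha> \<Longrightarrow> reflection \<alpha> x \<bullet> fw \<gamma> = x \<bullet> fw \<gamma>"
  by (simp add: reflection_def inner_diff_left simple_inner_fw)

text \<open>As \<beta> is not a multiple of \<alpha>, it has a positive coefficient at another
  simple root. The reflection leaves that coefficient alone, which excludes a negative
  image.\<close>

lemma simple_reflection_pos:
  assumes "\<alpha> \<in> \<Delta>" "\<beta> \<in> pos" "\<beta> \<noteq> \<alpha>"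
  shows "reflection \<alpha> \<beta> \<in> pos"
proof -
  have b: "\<beta> \<in> \<Phi>" using assms pos_root by blast
  have "\<exists>\<gamma>\<in>\<Delta>. \<gamma> \<noteq> \<alpha> \<and> \<beta> \<bullet> fw \<gamma> > 0"
  proof (rule ccontr)
    assume "\<not> ?thesis"
    then have *: "\<beta> \<bullet> fw \<gamma> = 0" if "\<gamma> \<in> \<Delta>" "\<gamma> \<noteq> \<alpha>" for \<gamma>
      using assms(2) that unfolding pos_iff by (metis linorder_not_less order_antisym_conv)
    define c where "c = 2 * (\<beta> \<bullet> fw \<alpha>) / (\<alpha> \<bullet> \<alpha>)"
    have "\<beta> = (\<Sum>\<gamma>\<in>\<Delta>. if \<gamma> = \<alpha> then c *\<^sub>R \<alpha> else 0)"
      by (subst simple_expansion[of \<beta>]) (rule sum.cong, auto simp: * c_def)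
    then have bc: "\<beta> = c *\<^sub>R \<alpha>" using assms(1) by simp
    then have "c = 1 \<or> c = -1" using root_multiple[of \<alpha> c] b simple_root assms(1) by blast
    then show False using bc assms(2,3) simple_pos[OF assms(1)] not_pos_and_neg by auto
  qed
  then obtain \<gamma> where g: "\<gamma> \<in> \<Delta>" "\<gamma> \<noteq> \<alpha>" "\<beta> \<bullet> fw \<gamma> > 0" by blast
  have "reflection \<alpha> \<beta> \<in> \<Phi>" using b reflection_image_roots simple_root assms(1) by blast
  moreover have "- reflection \<alpha> \<beta> \<notin> pos"
    using g reflection_inner_fw[OF assms(1) g(1,2), of \<beta>] unfolding pos_iff by force
  ultimately show ?thesis using pos_or_neg by blast
qed

lemma weyl_group_root: "w \<in> W \<Longrightarrow> \<beta> \<in> \<Phi> \<Longrightarrow> w \<beta> \<in> \<Phi>"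
  by (induction arbitrary: \<beta> rule: weyl_group_induct) (use reflection_image_roots simple_root in \<open>auto simp: comp_apply id_apply\<close>)

lemma weyl_group_uminus: "w \<in> weyl_group I \<Longrightarrow> w (- x) = - w x"
  by (simp add: linear_neg weyl_group_linear)

lemma weyl_group_eqI:
  assumes "x \<in> W" "y \<in> W" "\<And>\<alpha>. \<alpha> \<in> \<Delta> \<Longrightarrow> x \<alpha> = y \<alpha>" shows "x = y"
  using linear_eq_on_span[OF weyl_group_linear weyl_group_linear, OF assms(1,2), of \<Delta>]
    assms(3) span_base by blast

text \<open>An element is determined by the images of the simple roots, and these lie in the finite
  set of roots.\<close>

lemma finite_weyl_group [simp]: "finite W"
proof -
  have "inj_on (\<lambda>w. restrict w \<Delta>) W"
    by (rule inj_onI, rule weyl_group_eqI) (auto, metis restrict_apply')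
  moreover have "(\<lambda>w. restrict w \<Delta>) ` W \<subseteq> PiE \<Delta> (\<lambda>_. \<Phi>)"
    using weyl_group_root simple_root by auto
  moreover have "finite (PiE \<Delta> (\<lambda>_. \<Phi>))" by (intro finite_PiE) auto
  ultimately show ?thesis using finite_subset inj_on_finite by blast
qed

lemma finite_parabolic [simp]: "I \<subseteq> \<Delta> \<Longrightarrow> finite (weyl_group I)"
  using weyl_group_mono finite_subset finite_weyl_group by metis

subsection \<open>Length\<close>

lemma reduced_word_ex:
  assumes "w \<in> W"
  shows "\<exists>ss. set ss \<subseteq> reflection ` \<Delta> \<and> length ss = lng w \<and> word_prod ss = w"
  unfolding len_def
  by (rule LeastI_ex) (use assms in \<open>auto simp: weyl_group_def\<close>)

lemma len_word_le: "set ss \<subseteq> reflection ` \<Delta> \<Longrightarrow> lng (word_prod ss) \<le> length ss"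
  unfolding len_def by (rule Least_le) blast

lemma len_id [simp]: "lng id = 0"
  using len_word_le[of "[]"] by simp

lemma len_comp_le: "w \<in> W \<Longrightarrow> \<alpha> \<in> \<Delta> \<Longrightarrow> lng (w \<circ> reflection \<alpha>) \<le> lng w + 1"
  using reduced_word_ex[of w] len_word_le[of "_ @ [reflection \<alpha>]"] by fastforce

text \<open>If the word turns a positive root into a negative one, it does so at some letter, which is
  then the reflection in the image of that root and can be cancelled.\<close>

lemma deletion:
  assumes "set ss \<subseteq> reflection ` I" "I \<subseteq> \<Delta>" "\<beta> \<in> pos" "- word_prod ss \<beta> \<in> pos"
  shows "\<exists>ts. set ts \<subseteq> reflection ` I \<and> length ts < length ss \<and> word_prod ts = word_prod ss \<circ> reflection \<beta>"
  using assms(1,4)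
proof (induction ss)
  case Nil
  then show ?case using not_pos_and_neg assms(3) by (simp add: id_apply)
next
  case (Cons s ss)
  let ?v = "word_prod ss"
  have v: "?v \<in> weyl_group I" using Cons.prems unfolding weyl_group_def by (metis (mono_tags, lifting) list.set_intros(2) mem_Collect_eq subset_iff)
  then have vW: "?v \<in> W" using weyl_group_mono assms(2) by blast
  obtain \<alpha> where a: "\<alpha> \<in> I" "s = reflection \<alpha>" using Cons.prems by auto
  have aD: "\<alpha> \<in> \<Delta>" using a assms(2) by blast
  show ?case
  proof (cases "- ?v \<beta> \<in> pos")
    case True
    then obtain ts where "set ts \<subseteq> reflection ` I" "length ts < length ss"
      "word_prod ts = word_prod ss \<circ> reflection \<beta>" using Cons by auto
    then show ?thesis using Cons.prems by (intro exI[of _ "s # ts"]) (auto simp: comp_assoc)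
  next
    case False
    then have "?v \<beta> \<in> pos" using pos_or_neg weyl_group_root[OF vW] pos_root[OF assms(3)] by blast
    moreover have "reflection \<alpha> (?v \<beta>) \<notin> pos"
      using Cons.prems a not_pos_and_neg by (fastforce simp: comp_apply)
    ultimately have "?v \<beta> = \<alpha>" using simple_reflection_pos[OF aD] by blast
    then have "?v \<circ> reflection \<beta> = reflection \<alpha> \<circ> ?v" using comp_reflection_eq[OF v] by metis
    then have "word_prod (s # ss) \<circ> reflection \<beta> = reflection \<alpha> \<circ> (reflection \<alpha> \<circ> ?v)"
      by (simp add: a comp_assoc)
    also have "\<dots> = ?v" by (simp add: fun_eq_iff comp_apply id_apply)
    finally show ?thesis using Cons.prems by (intro exI[of _ ss]) auto
  qed
qed

lemma weyl_group_root_cases: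
  assumes "w \<in> W" "\<beta> \<in> \<Phi>" obtains "w \<beta> \<in> pos" | "- w \<beta> \<in> pos"
  using assms weyl_group_root pos_or_neg by blast

lemma reflection_root_in_weyl_group_aux:
  assumes "w \<in> W" "\<beta> \<in> pos" "- w \<beta> \<in> pos"
  shows "w \<circ> reflection \<beta> \<in> W \<and> lng (w \<circ> reflection \<beta>) < lng w"
proof -
  obtain ss where ss: "set ss \<subseteq> reflection ` \<Delta>" "length ss = lng w" "word_prod ss = w"
    using reduced_word_ex assms(1) by blast
  then obtain ts where ts: "set ts \<subseteq> reflection ` \<Delta>" "length ts < length ss"
    "word_prod ts = w \<circ> reflection \<beta>" using deletion[of ss \<Delta> \<beta>] assms by auto
  then have "word_prod ts \<in> W" unfolding weyl_group_def by blast
  then show ?thesis using ts ss len_word_le[of ts] by auto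
qed

text \<open>Only the descending half rests on \<open>deletion\<close>. The ascending half is the
  descending one for \<open>w \<circ> reflection \<beta>\<close>, which sends \<beta> to the
  negative of \<open>w \<beta>\<close>.\<close>

lemma len_reflection_less_iff:
  assumes "w \<in> W" "\<beta> \<in> pos" "w \<circ> reflection \<beta> \<in> W"
  shows "lng (w \<circ> reflection \<beta>) < lng w \<longleftrightarrow> - w \<beta> \<in> pos"
    and "lng w < lng (w \<circ> reflection \<beta>) \<longleftrightarrow> w \<beta> \<in> pos"
proof -
  have b: "\<beta> \<in> \<Phi>" using assms pos_root by blast
  have less: "lng w < lng (w \<circ> reflection \<beta>)" if "w \<beta> \<in> pos"
  proof -
    have "- (w \<circ> reflection \<beta>) \<beta> \<in> pos"
      using that reflection_self[OF root_nonzero[OF b]] weyl_group_uminus[OF assms(1)] by (simp add: comp_apply)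
    from reflection_root_in_weyl_group_aux[OF assms(3,2) this] show ?thesis by simp
  qed
  have gr: "lng (w \<circ> reflection \<beta>) < lng w" if "- w \<beta> \<in> pos"
    using reflection_root_in_weyl_group_aux[OF assms(1,2) that] by simp
  show "lng (w \<circ> reflection \<beta>) < lng w \<longleftrightarrow> - w \<beta> \<in> pos"
    "lng w < lng (w \<circ> reflection \<beta>) \<longleftrightarrow> w \<beta> \<in> pos"
    using less gr pos_or_neg weyl_group_root[OF assms(1) b] by (meson order_less_asym)+
qed

lemma len_simple_iff:
  assumes "w \<in> W" "\<alpha> \<in> \<Delta>"
  shows "lng (w \<circ> reflection \<alpha>) < lng w \<longleftrightarrow> - w \<alpha> \<in> pos"
    and "lng w < lng (w \<circ> reflection \<alpha>) \<longleftrightarrow> w \<alpha> \<in> pos"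
  using len_reflection_less_iff[OF assms(1) simple_pos[OF assms(2)]] assms(1)
    weyl_group_comp_reflection_iff[OF assms(2)] by blast+

lemma len_simple_cases:
  assumes "w \<in> W" "\<alpha> \<in> \<Delta>"
  obtains "lng (w \<circ> reflection \<alpha>) = lng w + 1" | "lng w = lng (w \<circ> reflection \<alpha>) + 1"
proof -
  have "w \<circ> reflection \<alpha> \<in> W" using assms weyl_group_comp_reflection_iff by blast
  then have "lng w \<le> lng (w \<circ> reflection \<alpha>) + 1"
    using len_comp_le[OF _ assms(2), of "w \<circ> reflection \<alpha>"] by simp
  moreover have "lng (w \<circ> reflection \<alpha>) \<noteq> lng w"
    using len_simple_iff[OF assms] weyl_group_root_cases[OF assms(1) simple_root[OF assms(2)]]
    by (metis less_irrefl)
  ultimately show ?thesis using that len_comp_le[OF assms] by linarith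
qed

lemma descents_iff: "w \<in> W \<Longrightarrow> \<alpha> \<in> D w \<longleftrightarrow> \<alpha> \<in> \<Delta> \<and> - w \<alpha> \<in> pos"
  using len_simple_iff by (auto simp: right_descents_def)

lemma descents_subset: "D w \<subseteq> \<Delta>" by (auto simp: right_descents_def)

lemma not_descent_iff: "w \<in> W \<Longrightarrow> \<alpha> \<in> \<Delta> \<Longrightarrow> \<alpha> \<notin> D w \<longleftrightarrow> w \<alpha> \<in> pos"
  using descents_iff not_pos_and_neg weyl_group_root_cases simple_root by metis

lemma descent_ex:
  assumes "w \<in> W" "w \<noteq> id" shows "\<exists>\<alpha>. \<alpha> \<in> D w"
proof -
  obtain ss where ss: "set ss \<subseteq> reflection ` \<Delta>" "length ss = lng w" "word_prod ss = w"
    using reduced_word_ex assms(1) by blast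
  then have "ss \<noteq> []" using assms by auto
  then obtain ts s where [simp]: "ss = ts @ [s]" by (metis rev_exhaust)
  obtain \<alpha> where a: "\<alpha> \<in> \<Delta>" "s = reflection \<alpha>" using ss by auto
  have "w \<circ> reflection \<alpha> = word_prod ts" using ss a by auto
  then have "lng (w \<circ> reflection \<alpha>) < lng w" using len_word_le[of ts] ss by auto
  with a show ?thesis unfolding right_descents_def by blast
qed

lemma id_if_base_pos: "w \<in> W \<Longrightarrow> (\<And>\<alpha>. \<alpha> \<in> \<Delta> \<Longrightarrow> w \<alpha> \<in> pos) \<Longrightarrow> w = id"
  using descent_ex not_descent_iff descents_subset by blast

text \<open>The last hypothesis says that \<beta> is a combination of \<open>I\<close>, so
  \<open>w \<beta>\<close> is a nonnegative combination of the positive roots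
  \<open>w \<alpha>\<close>.\<close>

lemma pos_if_base_pos:
  assumes "w \<in> W" "I \<subseteq> \<Delta>" "\<And>\<alpha>. \<alpha> \<in> I \<Longrightarrow> w \<alpha> \<in> pos" "\<beta> \<in> pos"
    and "\<And>\<alpha>. \<alpha> \<in> \<Delta> - I \<Longrightarrow> \<beta> \<bullet> fw \<alpha> = 0"
  shows "w \<beta> \<in> pos"
proof -
  have lin: "linear w" using weyl_group_linear assms(1) by blast
  note linear_simple_expansion[OF lin, of \<beta>]
  then have "w \<beta> \<bullet> fw \<gamma> = (\<Sum>\<alpha>\<in>\<Delta>. 2 * (\<beta> \<bullet> fw \<alpha>) / (\<alpha> \<bullet> \<alpha>) * (w \<alpha> \<bullet> fw \<gamma>))" for \<gamma>
    by (simp only: inner_sum_left inner_scaleR_left)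
  moreover have "\<dots> \<gamma> \<ge> 0" if "\<gamma> \<in> \<Delta>" for \<gamma>
  proof (rule sum_nonneg)
    fix \<alpha> assume a: "\<alpha> \<in> \<Delta>"
    show "0 \<le> 2 * (\<beta> \<bullet> fw \<alpha>) / (\<alpha> \<bullet> \<alpha>) * (w \<alpha> \<bullet> fw \<gamma>)"
    proof (cases "\<alpha> \<in> I")
      case True
      then have "0 \<le> \<beta> \<bullet> fw \<alpha>" "0 \<le> w \<alpha> \<bullet> fw \<gamma>" using assms(3,4) a that pos_iff by blast+
      then show ?thesis by simp
    qed (use a assms(5) in simp)
  qed
  ultimately show ?thesis using weyl_group_root[OF assms(1)] assms(4) pos_iff by auto
qed

lemma sgn_id [simp]: "sg id = 1" by (simp add: weyl_sgn_def)

lemma sgn_comp_simple: "w \<in> W \<Longrightarrow> \<alpha> \<in> \<Delta> \<Longrightarrow> sg (w \<circ> reflection \<alpha>) = - sg w"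
  by (rule len_simple_cases[of w \<alpha>]) (auto simp: weyl_sgn_def)

lemma sgn_comp: assumes "x \<in> W" "y \<in> W" shows "sg (x \<circ> y) = sg x * sg y"
  using assms(2)
proof (induction rule: weyl_group_induct)
  case (step w \<alpha>)
  then have "sg (x \<circ> w \<circ> reflection \<alpha>) = - sg (x \<circ> w)"
    by (intro sgn_comp_simple weyl_group_comp assms)
  with step show ?case by (simp add: sgn_comp_simple comp_assoc)
qed simp

lemma sgn_square [simp]: "sg w * sg w = 1"
  by (simp add: weyl_sgn_def flip: power_add)

lemma len_inv: assumes "w \<in> W" shows "lng (inv w) = lng w"
proof -
  have le: "lng (inv w) \<le> lng w" if "w \<in> W" for w
  proof -
    obtain ss where ss: "set ss \<subseteq> reflection ` \<Delta>" "length ss = lng w" "word_prod ss = w"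
      using reduced_word_ex[OF \<open>w \<in> W\<close>] by blast
    have "word_prod (rev ss) \<circ> w = id" using word_prod_rev_comp[of ss] ss by auto
    then have "word_prod (rev ss) \<circ> (w \<circ> inv w) = inv w" by (simp flip: comp_assoc)
    then have "inv w = word_prod (rev ss)" using that by simp
    then show ?thesis using len_word_le[of "rev ss"] ss by auto
  qed
  have "inv (inv w) = w" using weyl_group_bij[OF assms] by (simp add: inv_inv_eq)
  then show ?thesis using le[OF assms] le[OF weyl_group_inv[OF assms]] by simp
qed

lemma inv_reflection_comp:
  "w \<in> W \<Longrightarrow> inv (reflection \<alpha> \<circ> w) = inv w \<circ> reflection \<alpha>"
  by (rule inv_unique_comp) (auto simp: fun_eq_iff comp_apply id_apply)

lemma len_left_iff:
  assumes "w \<in> W" "\<alpha> \<in> \<Delta>"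
  shows "lng (reflection \<alpha> \<circ> w) < lng w \<longleftrightarrow> - inv w \<alpha> \<in> pos"
    and "lng w < lng (reflection \<alpha> \<circ> w) \<longleftrightarrow> inv w \<alpha> \<in> pos"
proof -
  have "reflection \<alpha> \<circ> w \<in> W" using assms reflection_comp_weyl_group_iff by blast
  from len_inv[OF this] have "lng (inv w \<circ> reflection \<alpha>) = lng (reflection \<alpha> \<circ> w)"
    by (simp only: inv_reflection_comp[OF assms(1)])
  with len_simple_iff[OF weyl_group_inv[OF assms(1)] assms(2)] len_inv[OF assms(1)]
  show "lng (reflection \<alpha> \<circ> w) < lng w \<longleftrightarrow> - inv w \<alpha> \<in> pos"
    "lng w < lng (reflection \<alpha> \<circ> w) \<longleftrightarrow> inv w \<alpha> \<in> pos" by simp_all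
qed

end

context based_root_system
begin

subsection \<open>The longest element\<close>

lemma neg_if_base_neg:
  assumes "w \<in> W" "\<And>\<alpha>. \<alpha> \<in> \<Delta> \<Longrightarrow> - w \<alpha> \<in> pos" "\<beta> \<in> pos" shows "- w \<beta> \<in> pos"
proof -
  have lin: "linear w" using assms(1) weyl_group_linear by blast
  note linear_simple_expansion[OF linear_compose_neg[OF lin], of \<beta>]
  then have e: "- w \<beta> \<bullet> fw \<gamma> = (\<Sum>\<alpha>\<in>\<Delta>. 2 * (\<beta> \<bullet> fw \<alpha>) / (\<alpha> \<bullet> \<alpha>) * (- w \<alpha> \<bullet> fw \<gamma>))" for \<gamma>
    by (simp only: inner_sum_left inner_scaleR_left)
  have "0 \<le> - w \<beta> \<bullet> fw \<gamma>" if "\<gamma> \<in> \<Delta>" for \<gamma>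
    unfolding e using that assms(2,3) pos_iff
    by (intro sum_nonneg mult_nonneg_nonneg divide_nonneg_nonneg) auto
  then show ?thesis
    using assms(3) weyl_group_root[OF assms(1)] root_uminus pos_iff by blast
qed

text \<open>An element of maximal length turns all positive roots negative. For two such elements
  the quotient \<open>inv y \<circ> x\<close> therefore keeps simple roots positive, and so it is
  the identity.\<close>

lemma longest_ex1: "\<exists>!w. w \<in> W \<and> (\<forall>x\<in>W. lng x \<le> lng w)"
proof (rule ex_ex1I)
  have "W \<noteq> {}" using weyl_group_id by blast
  then obtain w where "w \<in> W" "\<And>x. x \<in> W \<Longrightarrow> lng x \<le> lng w"
    using finite_max_ex[OF finite_weyl_group] by metis
  then show "\<exists>w. w \<in> W \<and> (\<forall>x\<in>W. lng x \<le> lng w)" by blast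
next
  have neg: "- w \<alpha> \<in> pos" if "w \<in> W" "\<forall>x\<in>W. lng x \<le> lng w" "\<alpha> \<in> \<Delta>" for w \<alpha>
  proof -
    have "\<not> lng w < lng (w \<circ> reflection \<alpha>)"
      using that weyl_group_comp_reflection_iff[OF that(3)] not_less by blast
    then show ?thesis
      using len_simple_iff[OF that(1,3)] weyl_group_root_cases[OF that(1) simple_root[OF that(3)]] by blast
  qed
  fix x y assume x: "x \<in> W \<and> (\<forall>z\<in>W. lng z \<le> lng x)" and y: "y \<in> W \<and> (\<forall>z\<in>W. lng z \<le> lng y)"
  have yx: "inv y \<circ> x \<in> W" using x y weyl_group_comp weyl_group_inv by blast
  have "inv y \<circ> x = id"
  proof (rule id_if_base_pos[OF yx])
    fix \<alpha> assume a: "\<alpha> \<in> \<Delta>"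
    let ?\<beta> = "- x \<alpha>"
    have b: "?\<beta> \<in> pos" using neg a x by blast
    have iy: "inv y \<in> W" using y weyl_group_inv by blast
    show "(inv y \<circ> x) \<alpha> \<in> pos"
    proof (rule ccontr)
      assume "(inv y \<circ> x) \<alpha> \<notin> pos"
      then have "inv y ?\<beta> \<in> pos"
        using weyl_group_root_cases[OF yx simple_root[OF a]] weyl_group_uminus[OF iy]
        by (metis comp_apply)
      moreover have "- y \<beta> \<in> pos" if "\<beta> \<in> pos" for \<beta>
        using neg_if_base_neg[of y] neg[of y] y that by blast
      ultimately have "- y (inv y ?\<beta>) \<in> pos" by blast
      then show False using not_pos_and_neg[OF b] y by (metis weyl_group_inv_apply(2))
    qed
  qed
  then have "(y \<circ> inv y) \<circ> x = y" by (simp add: comp_assoc)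
  moreover have "y \<circ> inv y = id" using y weyl_group_inv_comp(2) by blast
  ultimately show "x = y" by simp
qed

abbreviation w0 where "w0 \<equiv> longest \<Delta>"

lemma longest_in: "w0 \<in> W" and len_le_longest: "x \<in> W \<Longrightarrow> lng x \<le> lng w0"
  using theI'[OF longest_ex1] unfolding longest_def by blast+

lemma longest_simple_neg: "\<alpha> \<in> \<Delta> \<Longrightarrow> - w0 \<alpha> \<in> pos"
  using len_le_longest[of "w0 \<circ> reflection \<alpha>"] longest_in len_simple_iff(2)[OF longest_in]
    weyl_group_root_cases[OF longest_in simple_root] weyl_group_comp_reflection_iff
  by (meson not_less)

lemma longest_pos: "\<beta> \<in> pos \<Longrightarrow> - w0 \<beta> \<in> pos"
  using neg_if_base_neg longest_in longest_simple_neg by blast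

lemma longest_comp_self: "w0 \<circ> w0 = id"
proof (rule id_if_base_pos)
  fix \<alpha> assume "\<alpha> \<in> \<Delta>"
  from longest_pos[OF longest_simple_neg[OF this]] show "(w0 \<circ> w0) \<alpha> \<in> pos"
    using weyl_group_uminus[OF longest_in] by (simp add: comp_apply)
qed (simp add: weyl_group_comp longest_in)

lemma descents_longest_comp:
  assumes "w \<in> W" shows "D (w0 \<circ> w) = \<Delta> - D w"
proof -
  have "\<alpha> \<in> D (w0 \<circ> w) \<longleftrightarrow> \<alpha> \<notin> D w" if a: "\<alpha> \<in> \<Delta>" for \<alpha>
  proof -
    have "- w0 (w \<alpha>) \<in> pos \<longleftrightarrow> w \<alpha> \<in> pos"
      using longest_pos weyl_group_root_cases[OF assms simple_root[OF a]] not_pos_and_neg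
        weyl_group_uminus[OF longest_in] by (metis add.inverse_inverse)
    then show ?thesis
      using descents_iff[of "w0 \<circ> w"] weyl_group_comp[OF longest_in assms] not_descent_iff[OF assms a] a
      by (simp add: comp_apply)
  qed
  then show ?thesis using descents_subset by blast
qed

subsection \<open>Dominance\<close>

definition dominant :: "'a \<Rightarrow> bool" where
  "dominant x \<longleftrightarrow> (\<forall>\<alpha>\<in>\<Delta>. 0 \<le> x \<bullet> \<alpha>)"

text \<open>Up to positive factors this compares coefficients in the base;
  \<open>weight_le_iff\<close> identifies it with the order of the statement, whose coefficients sit
  on all positive roots.\<close>

definition dom_le :: "'a \<Rightarrow> 'a \<Rightarrow> bool" where
  "dom_le x y \<longleftrightarrow> (\<forall>\<alpha>\<in>\<Delta>. x \<bullet> fw \<alpha> \<le> y \<bullet> fw \<alpha>)"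

text \<open>The convex hull of the orbit of \<open>b\<close>, when \<open>b\<close> is dominant.\<close>

definition whull :: "'a \<Rightarrow> 'a set" where
  "whull b = {x. \<forall>y\<in>W. dom_le (y x) b}"

lemma dom_le_refl [simp]: "dom_le x x" by (simp add: dom_le_def)
lemma dom_le_trans: "dom_le x y \<Longrightarrow> dom_le y z \<Longrightarrow> dom_le x z"
  by (force simp: dom_le_def)
lemma dom_le_antisym: "dom_le x y \<Longrightarrow> dom_le y x \<Longrightarrow> x = y"
  by (rule eqI_fw) (force simp: dom_le_def)
lemma dom_le_add: "dom_le x y \<Longrightarrow> dom_le x' y' \<Longrightarrow> dom_le (x + x') (y + y')"
  by (force simp: dom_le_def inner_add_left)
lemma dom_le_diff_cancel: "dom_le (x + z) (y + z) \<longleftrightarrow> dom_le x y"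
  by (simp add: dom_le_def inner_add_left)

lemma dominant_add: "dominant x \<Longrightarrow> dominant y \<Longrightarrow> dominant (x + y)"
  by (simp add: dominant_def inner_add_left)

lemma dominant_scaleR: "dominant x \<Longrightarrow> 0 \<le> c \<Longrightarrow> dominant (c *\<^sub>R x)"
  by (simp add: dominant_def)

lemma dominant_inner_pos: assumes "dominant x" "\<beta> \<in> pos" shows "0 \<le> x \<bullet> \<beta>"
  unfolding inner_simple_expansion[of x \<beta>] using assms
  by (auto simp: dominant_def pos_iff intro!: sum_nonneg mult_nonneg_nonneg divide_nonneg_nonneg)

text \<open>For a descent \<alpha> of \<open>y\<close>, the vector \<open>y d\<close> is
  \<open>(y \<circ> reflection \<alpha>) d\<close> plus a nonnegative multiple of the negative root
  \<open>y \<alpha>\<close>; removing descents only moves it up.\<close>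

lemma weyl_le_dominant: assumes "y \<in> W" "dominant d" shows "dom_le (y d) d"
  using assms(1)
proof (induction "lng y" arbitrary: y rule: less_induct)
  case less
  show ?case
  proof (cases "y = id")
    case False
    then obtain \<alpha> where a: "\<alpha> \<in> D y" using descent_ex less.prems by blast
    then have aD: "\<alpha> \<in> \<Delta>" using descents_subset by blast
    let ?y = "y \<circ> reflection \<alpha>"
    have y: "?y \<in> W" using weyl_group_comp_reflection_iff aD less.prems by blast
    have lt: "lng ?y < lng y" using a by (simp add: right_descents_def)
    have lin: "linear y" using weyl_group_linear less.prems by blast
    have ya: "- y \<alpha> \<in> pos" using a descents_iff less.prems by blast
    have "y d = ?y d + (2 * (d \<bullet> \<alpha>) / (\<alpha> \<bullet> \<alpha>)) *\<^sub>R y \<alpha>"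
      by (simp add: comp_apply reflection_def linear_diff[OF lin] linear_cmul[OF lin])
    moreover have "0 \<le> 2 * (d \<bullet> \<alpha>) / (\<alpha> \<bullet> \<alpha>)" using assms(2) aD by (simp add: dominant_def)
    ultimately have "dom_le (y d) (?y d)"
      using ya unfolding dom_le_def pos_iff
      by (auto simp: inner_add_left simp del: times_divide_eq_left intro!: mult_nonneg_nonpos)
    then show ?thesis using less.hyps[OF lt y] dom_le_trans by blast
  qed (simp add: id_apply)
qed

lemma dominant_in_whull: "dominant d \<Longrightarrow> d \<in> whull d"
  by (simp add: whull_def weyl_le_dominant)

lemma whull_weyl: "x \<in> whull b \<Longrightarrow> y \<in> W \<Longrightarrow> y x \<in> whull b"
  proof -
  assume x: "x \<in> whull b" and y: "y \<in> W"
  have "dom_le (z (y x)) b" if "z \<in> W" for z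
    using x weyl_group_comp[OF that y] unfolding whull_def by (force simp: comp_apply)
  then show ?thesis by (simp add: whull_def)
qed

lemma whull_add: "x \<in> whull b \<Longrightarrow> y \<in> whull c \<Longrightarrow> x + y \<in> whull (b + c)"
  unfolding whull_def by (auto simp: linear_add[OF weyl_group_linear] intro: dom_le_add)

lemma whull_mono: "x \<in> whull b \<Longrightarrow> dom_le b c \<Longrightarrow> x \<in> whull c"
  unfolding whull_def using dom_le_trans by blast

lemma whull_segment:
  assumes "x \<in> whull b" "y \<in> whull b" "0 \<le> t" "t \<le> 1"
  shows "(1 - t) *\<^sub>R x + t *\<^sub>R y \<in> whull b"
  unfolding whull_def
proof (clarsimp simp: dom_le_def)
  fix z \<alpha> assume z: "z \<in> W" "\<alpha> \<in> \<Delta>"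
  have "z x \<bullet> fw \<alpha> \<le> b \<bullet> fw \<alpha>" "z y \<bullet> fw \<alpha> \<le> b \<bullet> fw \<alpha>"
    using assms z by (auto simp: whull_def dom_le_def)
  then have "(1 - t) * (z x \<bullet> fw \<alpha>) + t * (z y \<bullet> fw \<alpha>) \<le> (1 - t) * (b \<bullet> fw \<alpha>) + t * (b \<bullet> fw \<alpha>)"
    using assms by (intro add_mono mult_left_mono) auto
  also have "\<dots> = b \<bullet> fw \<alpha>" by (simp add: algebra_simps)
  also have "(1 - t) * (z x \<bullet> fw \<alpha>) + t * (z y \<bullet> fw \<alpha>) = z ((1 - t) *\<^sub>R x + t *\<^sub>R y) \<bullet> fw \<alpha>"
    by (simp only: linear_add[OF weyl_group_linear[OF z(1)]] linear_cmul[OF weyl_group_linear[OF z(1)]]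
        inner_add_left inner_scaleR_left)
  finally show "z ((1 - t) *\<^sub>R x + t *\<^sub>R y) \<bullet> fw \<alpha> \<le> b \<bullet> fw \<alpha>" .
qed

lemma dominant_orbit_unique:
  "dominant x \<Longrightarrow> dominant (y x) \<Longrightarrow> y \<in> W \<Longrightarrow> y x = x"
  using weyl_le_dominant[of y x] weyl_le_dominant[of "inv y" "y x"] weyl_group_inv[of y]
  by (auto intro: dom_le_antisym)

abbreviation \<rho> where "\<rho> \<equiv> rho \<Delta>"

lemma varpi_inner_simple:
  "I \<subseteq> \<Delta> \<Longrightarrow> \<alpha> \<in> \<Delta> \<Longrightarrow> varpi \<Delta> I \<bullet> \<alpha> = (if \<alpha> \<in> I then \<alpha> \<bullet> \<alpha> / 2 else 0)"
proof -
  assume "I \<subseteq> \<Delta>" "\<alpha> \<in> \<Delta>"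
  then have "varpi \<Delta> I \<bullet> \<alpha> = (\<Sum>\<beta>\<in>I. if \<beta> = \<alpha> then \<alpha> \<bullet> \<alpha> / 2 else 0)"
    unfolding varpi_def inner_sum_left by (intro sum.cong) (auto simp: fw_inner_simple)
  then show ?thesis using finite_subset[OF \<open>I \<subseteq> \<Delta>\<close>] by simp
qed

lemma varpi_coroot:
  "I \<subseteq> \<Delta> \<Longrightarrow> \<alpha> \<in> \<Delta> \<Longrightarrow> 2 * (varpi \<Delta> I \<bullet> \<alpha>) / (\<alpha> \<bullet> \<alpha>) = (if \<alpha> \<in> I then 1 else 0)"
  using simple_inner_pos by (simp add: varpi_inner_simple)

lemma dominant_varpi: "I \<subseteq> \<Delta> \<Longrightarrow> dominant (varpi \<Delta> I)"
  by (simp add: dominant_def varpi_inner_simple)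

lemma rho_inner_simple: "\<alpha> \<in> \<Delta> \<Longrightarrow> \<rho> \<bullet> \<alpha> = \<alpha> \<bullet> \<alpha> / 2"
  by (simp add: varpi_inner_simple)

lemma varpi_add_compl: "I \<subseteq> \<Delta> \<Longrightarrow> varpi \<Delta> I + varpi \<Delta> (\<Delta> - I) = \<rho>"
  unfolding varpi_def by (metis finite_base sum.subset_diff add.commute)

lemma varpi_inj: "I \<subseteq> \<Delta> \<Longrightarrow> J \<subseteq> \<Delta> \<Longrightarrow> varpi \<Delta> I = varpi \<Delta> J \<Longrightarrow> I = J"
  using varpi_coroot by (metis (no_types, lifting) subsetI subset_antisym subsetD zero_neq_one)

text \<open>The factors \<open>\<rho> \<bullet> \<alpha> = \<alpha> \<bullet> \<alpha> / 2\<close>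
  cancel the normalisation of the coefficients. Thus \<rho> is a linear functional that is strictly
  increasing for \<open>dom_le\<close>; it serves to detect equality when several inequalities are
  added.\<close>

lemma rho_inner_expansion: "\<rho> \<bullet> x = (\<Sum>\<alpha>\<in>\<Delta>. x \<bullet> fw \<alpha>)"
  unfolding inner_simple_expansion[of \<rho> x]
  using simple_inner_pos by (intro sum.cong) (auto simp: rho_inner_simple)

lemma rho_inner_pos: assumes "\<beta> \<in> pos" shows "0 < \<rho> \<bullet> \<beta>"
proof -
  have "\<exists>\<alpha>\<in>\<Delta>. \<beta> \<bullet> fw \<alpha> \<noteq> 0"
    using eqI_fw[of \<beta> 0] assms pos_root root_nonzero by fastforce
  then have "\<rho> \<bullet> \<beta> \<noteq> 0" using assms by (simp add: rho_inner_expansion sum_nonneg_eq_0_iff pos_iff)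
  moreover have "0 \<le> \<rho> \<bullet> \<beta>" unfolding rho_inner_expansion using assms by (simp add: sum_nonneg pos_iff)
  ultimately show ?thesis by simp
qed

lemma dom_le_rho_inner: "dom_le x y \<Longrightarrow> \<rho> \<bullet> x \<le> \<rho> \<bullet> y"
  unfolding rho_inner_expansion by (rule sum_mono) (simp add: dom_le_def)

lemma dom_le_rho_inner_eq: assumes "dom_le x y" "\<rho> \<bullet> x = \<rho> \<bullet> y" shows "x = y"
proof (rule eqI_fw)
  have "(\<Sum>\<alpha>\<in>\<Delta>. y \<bullet> fw \<alpha> - x \<bullet> fw \<alpha>) = 0"
    using assms(2) by (simp add: rho_inner_expansion sum_subtractf)
  then show "x \<bullet> fw \<alpha> = y \<bullet> fw \<alpha>" if "\<alpha> \<in> \<Delta>" for \<alpha>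
    using that assms(1) by (simp add: sum_nonneg_eq_0_iff dom_le_def)
qed

text \<open>Maximise the pairing with \<rho> over the orbit: a simple reflection at a negative
  pairing would increase it.\<close>

lemma dominant_rep: obtains y where "y \<in> W" "dominant (y x)"
proof -
  have "W \<noteq> {}" using weyl_group_id by blast
  then obtain y where y: "y \<in> W" "\<And>z. z \<in> W \<Longrightarrow> \<rho> \<bullet> z x \<le> \<rho> \<bullet> y x"
    using finite_max_ex[OF finite_weyl_group, of "\<lambda>y. \<rho> \<bullet> y x"] by metis
  have "dominant (y x)" unfolding dominant_def
  proof (rule ballI, rule ccontr)
    fix \<alpha> assume a: "\<alpha> \<in> \<Delta>" "\<not> 0 \<le> y x \<bullet> \<alpha>"
    have "reflection \<alpha> \<circ> y \<in> W" using a y(1) reflection_comp_weyl_group_iff by blast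
    from y(2)[OF this] have "(y x \<bullet> \<alpha>) / (\<alpha> \<bullet> \<alpha>) * (\<rho> \<bullet> \<alpha>) \<ge> 0"
      by (simp add: comp_apply reflection_def inner_diff_right)
    then show False using a simple_inner_pos[OF a(1)] by (simp add: rho_inner_simple)
  qed
  with y(1) show ?thesis using that by blast
qed

text \<open>The sum of an orbit is invariant, hence orthogonal to all roots, hence zero.\<close>

lemma dominant_nonneg: assumes "dominant d" shows "dom_le 0 d"
proof -
  define s where "s = (\<Sum>y\<in>W. y d)"
  have "reflection \<alpha> s = s" if "\<alpha> \<in> \<Delta>" for \<alpha>
  proof -
    have "reflection \<alpha> s = (\<Sum>y\<in>W. (reflection \<alpha> \<circ> y) d)"
      unfolding s_def by (simp add: linear_sum[OF linear_reflection] comp_apply)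
    also have "\<dots> = s" unfolding s_def
      by (rule sum.reindex_bij_betw[OF bij_betw_comp_left[OF reflection_in_weyl_group[OF that]]])
    finally show ?thesis .
  qed
  then have "s = 0" by (intro eqI_simple) (simp add: reflection_eq_self_iff simple_nonzero)
  moreover have "s \<bullet> fw \<alpha> \<le> real (card W) * (d \<bullet> fw \<alpha>)" if "\<alpha> \<in> \<Delta>" for \<alpha>
    unfolding s_def inner_sum_left
    by (rule sum_bounded_above) (use weyl_le_dominant[OF _ assms] that in \<open>simp add: dom_le_def\<close>)
  moreover have "card W > 0" using finite_weyl_group weyl_group_id by (metis card_gt_0_iff empty_iff)
  ultimately show ?thesis by (force simp: dom_le_def zero_le_mult_iff)
qed

lemma rho_varpi_nonneg: "I \<subseteq> \<Delta> \<Longrightarrow> 0 \<le> \<rho> \<bullet> varpi \<Delta> I"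
  using dom_le_rho_inner[OF dominant_nonneg[OF dominant_varpi]] by simp

lemma weight_le_iff: "weight_le \<Phi> \<Delta> x y \<longleftrightarrow> dom_le x y"
proof
  assume "weight_le \<Phi> \<Delta> x y"
  then obtain c where c: "\<forall>\<alpha>\<in>pos. 0 \<le> c \<alpha>" "y - x = (\<Sum>\<alpha>\<in>pos. c \<alpha> *\<^sub>R \<alpha>)"
    unfolding weight_le_def by blast
  show "dom_le x y" unfolding dom_le_def
  proof
    fix \<alpha> assume a: "\<alpha> \<in> \<Delta>"
    have "(y - x) \<bullet> fw \<alpha> = (\<Sum>\<beta>\<in>pos. c \<beta> * (\<beta> \<bullet> fw \<alpha>))"
      unfolding c(2) by (simp add: inner_sum_left)
    also have "\<dots> \<ge> 0" using c(1) a pos_iff by (intro sum_nonneg mult_nonneg_nonneg) auto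
    finally show "x \<bullet> fw \<alpha> \<le> y \<bullet> fw \<alpha>" by (simp add: inner_diff_left)
  qed
next
  assume le: "dom_le x y"
  \<comment> \<open>All coefficients are put on the simple roots; the other positive roots get
    0.\<close>
  define c where "c \<alpha> = (if \<alpha> \<in> \<Delta> then 2 * ((y - x) \<bullet> fw \<alpha>) / (\<alpha> \<bullet> \<alpha>) else 0)" for \<alpha>
  have "(\<Sum>\<alpha>\<in>pos. c \<alpha> *\<^sub>R \<alpha>) = (\<Sum>\<alpha>\<in>\<Delta>. c \<alpha> *\<^sub>R \<alpha>)"
    by (rule sum.mono_neutral_right) (auto simp: c_def simple_pos)
  also have "\<dots> = y - x"
    by (subst simple_expansion[of "y - x"]) (rule sum.cong, auto simp: c_def)
  finally show "weight_le \<Phi> \<Delta> x y"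
    using le unfolding weight_le_def
    by (intro exI[of _ c]) (auto simp: c_def dom_le_def inner_diff_left)
qed

text \<open>At a descent \<alpha> of \<open>y\<close>, invariance of \<rho> gives
  \<open>\<rho> \<bullet> y \<alpha> = \<rho> \<bullet> \<alpha> > 0\<close>, although
  \<open>y \<alpha>\<close> is negative.\<close>

lemma weyl_rho_eq: "y \<in> W \<Longrightarrow> y \<rho> = \<rho> \<Longrightarrow> y = id"
proof (rule ccontr)
  assume y: "y \<in> W" "y \<rho> = \<rho>" "y \<noteq> id"
  then obtain \<alpha> where a: "\<alpha> \<in> D y" using descent_ex by blast
  then have "- y \<alpha> \<in> pos" "\<alpha> \<in> \<Delta>" using descents_iff y by auto
  then have "\<rho> \<bullet> y \<alpha> < 0" using rho_inner_pos[of "- y \<alpha>"] by simp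
  moreover have "\<rho> \<bullet> y \<alpha> = \<rho> \<bullet> \<alpha>" using weyl_group_inner[OF y(1)] y(2) by metis
  ultimately show False using rho_inner_pos[OF simple_pos[OF \<open>\<alpha> \<in> \<Delta>\<close>]] by simp
qed

lemma bij_betw_reflection_pos:
  assumes "\<alpha> \<in> \<Delta>" shows "bij_betw (reflection \<alpha>) (pos - {\<alpha>}) (pos - {\<alpha>})"
proof (rule bij_betw_byWitness[where f' = "reflection \<alpha>"])
  have "reflection \<alpha> \<beta> \<noteq> \<alpha>" if "\<beta> \<in> pos" for \<beta>
    using that assms not_pos_and_neg[of \<alpha>] simple_pos reflection_reflection[of \<alpha> \<beta>]
    by (metis reflection_self simple_nonzero)
  then show "reflection \<alpha> ` (pos - {\<alpha>}) \<subseteq> pos - {\<alpha>}"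
    using simple_reflection_pos[OF assms] by auto
  then show "reflection \<alpha> ` (pos - {\<alpha>}) \<subseteq> pos - {\<alpha>}" .
qed auto

text \<open>\<open>\<rho>\<close> is half the sum of the positive roots: both have the same inner products with simple roots.\<close>

lemma longest_rho: "w0 \<rho> = - \<rho>"
proof -
  define r where "r = (1 / 2) *\<^sub>R (\<Sum>\<beta>\<in>pos. \<beta>)"
  have "r \<bullet> \<alpha> = \<rho> \<bullet> \<alpha>" if a: "\<alpha> \<in> \<Delta>" for \<alpha>
  proof -
    let ?s = "\<Sum>\<beta>\<in>pos - {\<alpha>}. \<beta>"
    note bij_betw_reflection_pos[OF a]
    then have "reflection \<alpha> ?s = ?s"
      unfolding linear_sum[OF linear_reflection] by (rule sum.reindex_bij_betw)
    then have "?s \<bullet> \<alpha> = 0" using reflection_eq_self_iff simple_nonzero a by blast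
    moreover have "(\<Sum>\<beta>\<in>pos. \<beta>) = \<alpha> + ?s" by (rule sum.remove) (use a simple_pos in auto)
    ultimately show ?thesis using a by (simp add: r_def inner_add_left rho_inner_simple)
  qed
  then have r: "\<rho> = r" using eqI_simple by metis
  have "bij_betw (\<lambda>\<beta>. - w0 \<beta>) pos pos"
    by (rule bij_betw_byWitness[where f' = "\<lambda>\<beta>. - w0 \<beta>"])
      (use longest_pos longest_comp_self in \<open>auto simp: weyl_group_uminus[OF longest_in] fun_eq_iff comp_apply id_apply\<close>)
  then have "(\<Sum>\<beta>\<in>pos. - w0 \<beta>) = (\<Sum>\<beta>\<in>pos. \<beta>)" by (rule sum.reindex_bij_betw)
  then have "w0 (\<Sum>\<beta>\<in>pos. \<beta>) = - (\<Sum>\<beta>\<in>pos. \<beta>)"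
    by (simp add: linear_sum[OF weyl_group_linear[OF longest_in]] sum_negf minus_equation_iff)
  then show ?thesis unfolding r r_def linear_cmul[OF weyl_group_linear[OF longest_in]] by simp
qed

lemma minus_varpi_in_whull: "I \<subseteq> \<Delta> \<Longrightarrow> - varpi \<Delta> I \<in> whull (\<rho> + varpi \<Delta> (\<Delta> - I))"
proof -
  assume I: "I \<subseteq> \<Delta>"
  have "w0 \<rho> + varpi \<Delta> (\<Delta> - I) \<in> whull (\<rho> + varpi \<Delta> (\<Delta> - I))"
    using whull_add[OF whull_weyl[OF dominant_in_whull[OF dominant_varpi] longest_in]
        dominant_in_whull[OF dominant_varpi]] by blast
  moreover have "w0 \<rho> + varpi \<Delta> (\<Delta> - I) = - varpi \<Delta> I"
    unfolding longest_rho using varpi_add_compl[OF I] by (simp add: algebra_simps)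
  ultimately show ?thesis by simp
qed

subsection \<open>Weights\<close>

lemma weights_uminus: "x \<in> weights \<Phi> \<Longrightarrow> - x \<in> weights \<Phi>"
  by (simp add: weights_def)

lemma weights_add: "x \<in> weights \<Phi> \<Longrightarrow> y \<in> weights \<Phi> \<Longrightarrow> x + y \<in> weights \<Phi>"
  by (simp add: weights_def inner_add_left distrib_left add_divide_distrib)

lemma weights_diff: "x \<in> weights \<Phi> \<Longrightarrow> y \<in> weights \<Phi> \<Longrightarrow> x - y \<in> weights \<Phi>"
  using weights_add weights_uminus by (metis diff_conv_add_uminus)

lemma weights_scale: "x \<in> weights \<Phi> \<Longrightarrow> real n *\<^sub>R x \<in> weights \<Phi>"
proof -
  assume "x \<in> weights \<Phi>"
  then have "real n * (2 * (x \<bullet> \<alpha>) / (\<alpha> \<bullet> \<alpha>)) \<in> \<int>" if "\<alpha> \<in> \<Phi>" for \<alpha>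
    using that by (intro Ints_mult) (auto simp: weights_def)
  then show ?thesis by (simp add: weights_def mult.left_commute)
qed

lemma weights_weyl: assumes "y \<in> W" "x \<in> weights \<Phi>" shows "y x \<in> weights \<Phi>"
  unfolding weights_def
proof (clarify)
  fix \<alpha> assume a: "\<alpha> \<in> \<Phi>"
  have i: "inv y \<in> W" using assms weyl_group_inv by blast
  have "2 * (x \<bullet> inv y \<alpha>) / (inv y \<alpha> \<bullet> inv y \<alpha>) \<in> \<int>"
    using assms(2) weyl_group_root[OF i a] by (auto simp: weights_def)
  then show "2 * (y x \<bullet> \<alpha>) / (\<alpha> \<bullet> \<alpha>) \<in> \<int>"
    using weyl_group_inner_inv[OF assms(1)] weyl_group_inner[OF i] by simp
qed

text \<open>A positive root pairs positively with some simple root, since otherwise its negative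
  would be dominant and hence nonnegative. Reflecting there lowers the pairing with \<rho>; as its
  values are real, the induction counts the positive roots lying lower.\<close>

lemma root_conj_simple: assumes "\<beta> \<in> pos" shows "\<exists>y\<in>W. \<exists>\<alpha>\<in>\<Delta>. \<beta> = y \<alpha>"
  using assms
proof (induction "card {\<gamma>\<in>pos. \<rho> \<bullet> \<gamma> < \<rho> \<bullet> \<beta>}" arbitrary: \<beta> rule: less_induct)
  case (less \<beta>)
  show ?case
  proof (cases "\<beta> \<in> \<Delta>")
    case True
    then show ?thesis using weyl_group_id by (metis id_apply)
  next
    case False
    have "\<exists>\<alpha>\<in>\<Delta>. \<beta> \<bullet> \<alpha> > 0"
    proof (rule ccontr)
      assume "\<not> ?thesis"
      then have "dominant (- \<beta>)" by (auto simp: dominant_def not_less)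
      then have "dom_le 0 (- \<beta>)" by (rule dominant_nonneg)
      then have "\<rho> \<bullet> \<beta> \<le> 0" using dom_le_rho_inner by fastforce
      then show False using rho_inner_pos less.prems by fastforce
    qed
    then obtain \<alpha> where a: "\<alpha> \<in> \<Delta>" "\<beta> \<bullet> \<alpha> > 0" by blast
    have p: "reflection \<alpha> \<beta> \<in> pos" using simple_reflection_pos a less.prems False by blast
    have lt: "\<rho> \<bullet> reflection \<alpha> \<beta> < \<rho> \<bullet> \<beta>"
      using a rho_inner_pos[OF simple_pos[OF a(1)]] simple_inner_pos[OF a(1)]
      by (simp add: reflection_def inner_diff_right)
    have "card {\<gamma>\<in>pos. \<rho> \<bullet> \<gamma> < \<rho> \<bullet> reflection \<alpha> \<beta>} < card {\<gamma>\<in>pos. \<rho> \<bullet> \<gamma> < \<rho> \<bullet> \<beta>}"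
      using p lt by (intro psubset_card_mono) auto
    from less.hyps[OF this p] obtain y \<gamma> where "y \<in> W" "\<gamma> \<in> \<Delta>" "reflection \<alpha> \<beta> = y \<gamma>" by blast
    then have "\<beta> = (reflection \<alpha> \<circ> y) \<gamma>" "reflection \<alpha> \<circ> y \<in> W"
      using a reflection_comp_weyl_group_iff by (metis comp_apply reflection_reflection, blast)
    with \<open>\<gamma> \<in> \<Delta>\<close> show ?thesis by blast
  qed
qed

text \<open>Integrality on simple coroots suffices: a reflection preserves the set of vectors with integral
  simple coroot pairings, and every root is conjugate to a simple one.\<close>

lemma weightsI_simple:
  assumes "\<And>\<alpha>. \<alpha> \<in> \<Delta> \<Longrightarrow> 2 * (x \<bullet> \<alpha>) / (\<alpha> \<bullet> \<alpha>) \<in> \<int>" shows "x \<in> weights \<Phi>"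
proof -
  have int: "2 * (y x \<bullet> \<alpha>) / (\<alpha> \<bullet> \<alpha>) \<in> \<int>" if "y \<in> W" "\<alpha> \<in> \<Delta>" for y \<alpha>
  proof -
    have "\<forall>\<alpha>\<in>\<Delta>. 2 * (x \<bullet> y \<alpha>) / (\<alpha> \<bullet> \<alpha>) \<in> \<int>" if "y \<in> W" for y using that
    proof (induction rule: weyl_group_induct)
      case (step w \<beta>)
      have "2 * (x \<bullet> w (reflection \<beta> \<alpha>)) / (\<alpha> \<bullet> \<alpha>) \<in> \<int>" if a: "\<alpha> \<in> \<Delta>" for \<alpha>
      proof -
        have lin: "linear w" using step weyl_group_linear by blast
        have "2 * (x \<bullet> w (reflection \<beta> \<alpha>)) / (\<alpha> \<bullet> \<alpha>) =
          2 * (x \<bullet> w \<alpha>) / (\<alpha> \<bullet> \<alpha>) - (2 * (\<beta> \<bullet> \<alpha>) / (\<alpha> \<bullet> \<alpha>)) * (2 * (x \<bullet> w \<beta>) / (\<beta> \<bullet> \<beta>))"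
          using simple_inner_pos[OF a] simple_inner_pos[OF step(2)]
          by (simp add: reflection_def linear_diff[OF lin] linear_cmul[OF lin] inner_diff_right
              inner_commute[of \<alpha> \<beta>] field_simps)
        moreover have "2 * (\<beta> \<bullet> \<alpha>) / (\<alpha> \<bullet> \<alpha>) \<in> \<int>" using cartan_integer simple_root a step(2) by blast
        ultimately show ?thesis using step a by (metis Ints_diff Ints_mult)
      qed
      then show ?case by (simp add: comp_apply)
    qed (use assms in \<open>simp add: id_apply\<close>)
    from this[OF weyl_group_inv[OF that(1)]] that show ?thesis
      by (simp only: weyl_group_inner_inv[OF that(1)])
  qed
  have "2 * (x \<bullet> \<beta>) / (\<beta> \<bullet> \<beta>) \<in> \<int>" if "\<beta> \<in> pos" for \<beta>
  proof -
    obtain y \<alpha> where y: "y \<in> W" "\<alpha> \<in> \<Delta>" "\<beta> = y \<alpha>" using root_conj_simple[OF \<open>\<beta> \<in> pos\<close>] by blast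
    then have "x \<bullet> \<beta> = inv y x \<bullet> \<alpha>" "\<beta> \<bullet> \<beta> = \<alpha> \<bullet> \<alpha>"
      using weyl_group_inner by (metis weyl_group_inv_apply(2), metis)
    then show ?thesis using int[OF weyl_group_inv[OF y(1)] y(2)] y(3) by simp
  qed
  moreover have "2 * (x \<bullet> \<beta>) / (\<beta> \<bullet> \<beta>) \<in> \<int>" if "- \<beta> \<in> pos" for \<beta>
    using calculation[OF that] by simp
  ultimately show ?thesis unfolding weights_def using pos_or_neg by blast
qed

lemma varpi_weight: "I \<subseteq> \<Delta> \<Longrightarrow> varpi \<Delta> I \<in> weights \<Phi>"
  by (rule weightsI_simple) (simp only: varpi_coroot, simp)

lemma rho_weight: "\<rho> \<in> weights \<Phi>" by (simp add: varpi_weight)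

lemma dominant_weights_iff: "x \<in> dominant_weights \<Phi> \<Delta> \<longleftrightarrow> x \<in> weights \<Phi> \<and> dominant x"
  by (simp add: dominant_weights_def dominant_def)

text \<open>Integrality is the point: a dominant weight not orthogonal to \<alpha> has coroot
  pairing at least 1 there, which leaves room to subtract \<open>fw \<alpha>\<close>.\<close>

lemma sub_varpi_dominant:
  assumes "x \<in> weights \<Phi>" "dominant x" "I \<subseteq> \<Delta>" "\<And>\<alpha>. \<alpha> \<in> I \<Longrightarrow> x \<bullet> \<alpha> \<noteq> 0"
  shows "dominant (x - varpi \<Delta> I)"
  unfolding dominant_def
proof
  fix \<alpha> assume a: "\<alpha> \<in> \<Delta>"
  show "0 \<le> (x - varpi \<Delta> I) \<bullet> \<alpha>"
  proof (cases "\<alpha> \<in> I")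
    case True
    have p: "0 < x \<bullet> \<alpha>" using assms(2,4) a True by (force simp: dominant_def)
    have "2 * (x \<bullet> \<alpha>) / (\<alpha> \<bullet> \<alpha>) \<in> \<int>" using assms(1) simple_root a by (auto simp: weights_def)
    then obtain n :: int where n: "2 * (x \<bullet> \<alpha>) / (\<alpha> \<bullet> \<alpha>) = of_int n" by (elim Ints_cases)
    then have "of_int n > (0 :: real)" using p simple_inner_pos[OF a] by (metis divide_pos_pos mult_pos_pos zero_less_numeral)
    then have "1 \<le> 2 * (x \<bullet> \<alpha>) / (\<alpha> \<bullet> \<alpha>)" using n by simp
    then show ?thesis using simple_inner_pos[OF a] True a assms(3)
      by (simp add: inner_diff_left varpi_inner_simple field_simps)
  next
    case False
    then show ?thesis using assms a by (simp add: inner_diff_left varpi_inner_simple dominant_def)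
  qed
qed

subsection \<open>Stabilisers and cosets of parabolic subgroups\<close>

text \<open>For a descent \<alpha> of \<open>y\<close>, invariance gives
  \<open>d \<bullet> \<alpha> = d \<bullet> y \<alpha>\<close>, which is at most 0 because
  \<open>y \<alpha>\<close> is negative. So \<alpha> is orthogonal to \<open>d\<close> and its
  reflection can be split off.\<close>

lemma stabilizer_dominant:
  assumes "dominant d" "y \<in> W" "y d = d" shows "y \<in> weyl_group {\<alpha>\<in>\<Delta>. d \<bullet> \<alpha> = 0}"
  using assms(2,3)
proof (induction "lng y" arbitrary: y rule: less_induct)
  case less
  show ?case
  proof (cases "y = id")
    case False
    then obtain \<alpha> where a: "\<alpha> \<in> D y" using descent_ex less.prems by blast
    then have aD: "\<alpha> \<in> \<Delta>" and ya: "- y \<alpha> \<in> pos" using descents_iff less.prems by auto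
    have "d \<bullet> \<alpha> = d \<bullet> y \<alpha>" using weyl_group_inner less.prems by metis
    also have "\<dots> \<le> 0" using dominant_inner_pos[OF assms(1) ya] by simp
    finally have 0: "d \<bullet> \<alpha> = 0" using assms(1) aD by (force simp: dominant_def)
    let ?y = "y \<circ> reflection \<alpha>"
    have "lng ?y < lng y" using a by (simp add: right_descents_def)
    moreover have "?y \<in> W" using weyl_group_comp_reflection_iff aD less.prems by blast
    moreover have "reflection \<alpha> d = d" using 0 by (simp add: reflection_eq_self_iff[OF simple_nonzero[OF aD]])
    then have "?y d = d" using less.prems by (simp add: comp_apply)
    ultimately have "?y \<in> weyl_group {\<alpha>\<in>\<Delta>. d \<bullet> \<alpha> = 0}" by (rule less.hyps)
    then show ?thesis using weyl_group_comp_reflection_iff[of \<alpha> "{\<alpha>\<in>\<Delta>. d \<bullet> \<alpha> = 0}"] 0 aD by blast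
  qed simp
qed

lemma parabolic_fixes: "y \<in> weyl_group I \<Longrightarrow> (\<And>\<alpha>. \<alpha> \<in> I \<Longrightarrow> x \<bullet> \<alpha> = 0) \<Longrightarrow> y x = x"
  by (induction rule: weyl_group_induct) (auto simp: comp_apply id_apply reflection_def)

lemma varpi_stabilizer:
  assumes "I \<subseteq> \<Delta>" "y \<in> W" shows "y (varpi \<Delta> (\<Delta> - I)) = varpi \<Delta> (\<Delta> - I) \<longleftrightarrow> y \<in> weyl_group I"
proof -
  have "{\<alpha>\<in>\<Delta>. varpi \<Delta> (\<Delta> - I) \<bullet> \<alpha> = 0} = I"
    using assms(1) simple_nonzero by (auto simp: varpi_inner_simple split: if_splits)
  then show ?thesis
    using stabilizer_dominant[OF dominant_varpi assms(2), of "\<Delta> - I"]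
      parabolic_fixes[of y I "varpi \<Delta> (\<Delta> - I)"] by auto
qed

text \<open>The word is minimal among words in \<open>I\<close>. If \<open>x\<close> kept the root
  of its last letter positive, \<open>deletion\<close>, which stays inside \<open>I\<close>, would
  produce a shorter one.\<close>

lemma parabolic_neg_ex:
  assumes "I \<subseteq> \<Delta>" "x \<in> weyl_group I" "x \<noteq> id" shows "\<exists>\<alpha>\<in>I. - x \<alpha> \<in> pos"
proof -
  define n where "n = (LEAST n. \<exists>ss. set ss \<subseteq> reflection ` I \<and> length ss = n \<and> word_prod ss = x)"
  have "\<exists>ss. set ss \<subseteq> reflection ` I \<and> length ss = n \<and> word_prod ss = x"
    unfolding n_def by (rule LeastI_ex) (use assms in \<open>auto simp: weyl_group_def\<close>)
  then obtain ss where ss: "set ss \<subseteq> reflection ` I" "length ss = n" "word_prod ss = x" by blast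
  then have "ss \<noteq> []" using assms by auto
  then obtain ts s where [simp]: "ss = ts @ [s]" by (metis rev_exhaust)
  obtain \<alpha> where a: "\<alpha> \<in> I" "s = reflection \<alpha>" using ss by auto
  then have aD: "\<alpha> \<in> \<Delta>" using assms by blast
  have xt: "x \<circ> reflection \<alpha> = word_prod ts" using ss a by auto
  have xW: "x \<in> W" using assms weyl_group_mono by blast
  have "- x \<alpha> \<in> pos"
  proof (rule ccontr)
    assume "- x \<alpha> \<notin> pos"
    then have "x \<alpha> \<in> pos" using weyl_group_root_cases[OF xW simple_root[OF aD]] by blast
    moreover have "x \<alpha> = - word_prod ts \<alpha>"
      using xt[symmetric] reflection_self[OF simple_nonzero[OF aD]] weyl_group_uminus[OF xW]
      by (simp add: comp_apply)
    ultimately have "- word_prod ts \<alpha> \<in> pos" by simp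
    then obtain us where us: "set us \<subseteq> reflection ` I" "length us < length ts"
      "word_prod us = word_prod ts \<circ> reflection \<alpha>"
      using deletion[of ts I \<alpha>] ss assms(1) simple_pos[OF aD] by auto
    have "word_prod us = x" using us(3) xt by (metis reflection_comp_cancel)
    then have "n \<le> length us" unfolding n_def using us(1) by (intro Least_le) blast
    then show False using us(2) ss(2) by simp
  qed
  with a show ?thesis by blast
qed

text \<open>A shortest element of the coset has no descent in \<open>I\<close>, and a coset contains
  only one element without descents in \<open>I\<close>; so \<open>v\<close> is the unique shortest
  element.\<close>

lemma minimal_coset_less:
  assumes "I \<subseteq> \<Delta>" "v \<in> W" "D v \<inter> I = {}" "x \<in> weyl_group I" "x \<noteq> id"
  shows "lng v < lng (v \<circ> x)"
proof -
  have xW: "weyl_group I \<subseteq> W" using weyl_group_mono assms(1) by blast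
  have nodesc: "y = id" if y: "y \<in> weyl_group I" "u \<in> W" "D u \<inter> I = {}" "D (u \<circ> y) \<inter> I = {}" for u y
  proof (rule ccontr)
    assume "y \<noteq> id"
    then obtain \<alpha> where a: "\<alpha> \<in> I" "- y \<alpha> \<in> pos" using parabolic_neg_ex assms(1) y(1) by blast
    have aD: "\<alpha> \<in> \<Delta>" using a assms(1) by blast
    \<comment> \<open>The parabolic subgroup fixes the fundamental weights outside \<open>I\<close>,
      hence preserves the coefficients there; so \<open>- y \<alpha>\<close> is a positive root
      supported on \<open>I\<close>, and \<open>u\<close> keeps it positive.\<close>
    have "y x \<bullet> fw \<beta> = x \<bullet> fw \<beta>" if "\<beta> \<in> \<Delta> - I" for \<beta> x
    proof -
      have "inv y (fw \<beta>) = fw \<beta>"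
        by (rule parabolic_fixes[OF weyl_group_inv[OF y(1)]])
          (use that assms(1) in \<open>auto simp: fw_inner_simple\<close>)
      then show ?thesis using weyl_group_inner_inv[OF y(1)] by metis
    qed
    then have z: "- y \<alpha> \<bullet> fw \<beta> = 0" if "\<beta> \<in> \<Delta> - I" for \<beta>
      using that simple_inner_fw aD a(1) by auto
    have "u (- y \<alpha>) \<in> pos"
      by (rule pos_if_base_pos[OF y(2) assms(1) _ a(2) z])
        (use y(2,3) not_descent_iff assms(1) in blast)+
    then have "- (u \<circ> y) \<alpha> \<in> pos" using weyl_group_uminus[OF y(2)] by (simp add: comp_apply)
    then have "\<alpha> \<in> D (u \<circ> y)" using descents_iff weyl_group_comp xW y aD by blast
    then show False using y(4) a by blast
  qed
  define S where "S = (\<lambda>y. v \<circ> y) ` weyl_group I"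
  have "finite S" unfolding S_def using assms(1) by simp
  moreover have "S \<noteq> {}" unfolding S_def using weyl_group_id by blast
  ultimately have "arg_min_on lng S \<in> S" "lng (arg_min_on lng S) \<le> lng z" if "z \<in> S" for z
    using arg_min_if_finite(1)[of S lng] arg_min_least[of S z lng] that by auto
  with \<open>S \<noteq> {}\<close> obtain u where u: "u \<in> S" "\<And>z. z \<in> S \<Longrightarrow> lng u \<le> lng z" by blast
  then obtain y where y: "y \<in> weyl_group I" "u = v \<circ> y" unfolding S_def by blast
  have no: "D u' \<inter> I = {}" if "u' \<in> S" "lng u' = lng u" for u'
  proof (rule ccontr)
    assume "D u' \<inter> I \<noteq> {}"
    then obtain \<alpha> where a: "\<alpha> \<in> I" "lng (u' \<circ> reflection \<alpha>) < lng u'" by (auto simp: right_descents_def)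
    obtain y' where "y' \<in> weyl_group I" "u' = v \<circ> y'" using \<open>u' \<in> S\<close> unfolding S_def by blast
    then have "u' \<circ> reflection \<alpha> \<in> S" unfolding S_def using a weyl_group_comp_reflection_iff[OF a(1)]
      by (metis comp_assoc image_eqI)
    then show False using u(2) a that by fastforce
  qed
  have "y = id" using nodesc[OF y(1) assms(2,3)] no[OF u(1)] y by auto
  then have uv: "u = v" using y by simp
  have vx: "v \<circ> x \<in> S" using assms(4) by (simp add: S_def)
  have "lng (v \<circ> x) \<noteq> lng v"
    using no[OF vx] uv nodesc[OF assms(4,2,3)] assms(5) by auto
  then show ?thesis using u(2)[OF vx] uv by simp
qed

subsection \<open>Bruhat order\<close>

lemma pos_reflection_form:
  assumes "u \<in> W" "\<alpha> \<in> \<Delta>" shows "\<exists>\<beta>\<in>pos. u \<circ> reflection \<alpha> \<circ> inv u = reflection \<beta>"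
  using assms conj_reflection[OF assms(1)] weyl_group_root_cases[OF assms(1) simple_root[OF assms(2)]]
    reflection_uminus by metis

text \<open>The length inequality of \<open>bruhat_less\<close> is replaced by positivity of
  \<open>x \<beta>\<close>, with reflections indexed by positive roots;
  \<open>bruhat_less_eq\<close> shows that the closure is the same.\<close>

definition bruhat_step :: "(('a \<Rightarrow> 'a) \<times> ('a \<Rightarrow> 'a)) set" where
  "bruhat_step = {(x, x \<circ> reflection \<beta>) | x \<beta>. x \<in> W \<and> \<beta> \<in> pos \<and> x \<beta> \<in> pos}"

lemma reflection_pos_in_weyl_group: "\<beta> \<in> pos \<Longrightarrow> reflection \<beta> \<in> W"
  using root_conj_simple conj_reflection by (metis reflection_in_weyl_group weyl_group_comp weyl_group_inv)

lemma bruhat_less_eq: "bruhat_less \<Delta> = bruhat_step\<^sup>+"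
proof -
  have "{(x, x \<circ> t) | x t. x \<in> W \<and> (\<exists>u\<in>W. \<exists>\<alpha>\<in>\<Delta>. t = u \<circ> reflection \<alpha> \<circ> inv u) \<and> lng x < lng (x \<circ> t)}
    = bruhat_step" (is "?A = _")
  proof (intro subset_antisym subrelI)
    fix x y assume "(x, y) \<in> ?A"
    then obtain t u \<alpha> where t: "y = x \<circ> t" "x \<in> W" "u \<in> W" "\<alpha> \<in> \<Delta>" "t = u \<circ> reflection \<alpha> \<circ> inv u"
      "lng x < lng (x \<circ> t)" by blast
    then obtain \<beta> where b: "\<beta> \<in> pos" "t = reflection \<beta>" using pos_reflection_form by blast
    then have "x \<circ> reflection \<beta> \<in> W" using reflection_pos_in_weyl_group weyl_group_comp t(2) by blast
    from len_reflection_less_iff(2)[OF t(2) b(1) this] have "x \<beta> \<in> pos" using t(6) b(2) by simp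
    then show "(x, y) \<in> bruhat_step"
      using t(1,2) b unfolding bruhat_step_def by blast
  next
    fix x y assume "(x, y) \<in> bruhat_step"
    then obtain \<beta> where b: "y = x \<circ> reflection \<beta>" "x \<in> W" "\<beta> \<in> pos" "x \<beta> \<in> pos"
      unfolding bruhat_step_def by blast
    then have "x \<circ> reflection \<beta> \<in> W" using reflection_pos_in_weyl_group weyl_group_comp by blast
    then have "lng x < lng (x \<circ> reflection \<beta>)" using len_reflection_less_iff(2) b by blast
    moreover obtain u \<alpha> where "u \<in> W" "\<alpha> \<in> \<Delta>" "\<beta> = u \<alpha>" using root_conj_simple b by blast
    then have "reflection \<beta> = u \<circ> reflection \<alpha> \<circ> inv u" using conj_reflection by metis
    ultimately show "(x, y) \<in> ?A" using b \<open>u \<in> W\<close> \<open>\<alpha> \<in> \<Delta>\<close> by blast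
  qed
  then show ?thesis unfolding bruhat_less_def by simp
qed

lemma bruhat_le_iff: "bruhat_le \<Delta> y w \<longleftrightarrow> y \<in> W \<and> (y, w) \<in> bruhat_step\<^sup>*"
  unfolding bruhat_le_def bruhat_less_eq by (auto simp: rtrancl_eq_or_trancl)

lemma bruhat_step_props: "(x, y) \<in> bruhat_step \<Longrightarrow> x \<in> W \<and> y \<in> W \<and> lng x < lng y"
  unfolding bruhat_step_def
  using len_reflection_less_iff(2) reflection_pos_in_weyl_group weyl_group_comp by blast

lemma bruhat_le_refl [simp]: "x \<in> W \<Longrightarrow> bruhat_le \<Delta> x x" by (simp add: bruhat_le_iff)

lemma bruhat_le_in: assumes "bruhat_le \<Delta> x y" shows "x \<in> W" "y \<in> W"
proof -
  have "(x, y) \<in> bruhat_step\<^sup>*" and x: "x \<in> W" using assms by (auto simp: bruhat_le_iff)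
  then show "y \<in> W" by (induction) (use bruhat_step_props in blast)+
  from x show "x \<in> W" .
qed

lemma bruhat_le_trans: "bruhat_le \<Delta> x y \<Longrightarrow> bruhat_le \<Delta> y z \<Longrightarrow> bruhat_le \<Delta> x z"
  by (auto simp: bruhat_le_iff)

lemma bruhat_le_len: assumes "bruhat_le \<Delta> x y" shows "x = y \<or> lng x < lng y"
proof -
  have "(x, y) \<in> bruhat_step\<^sup>*" using assms by (auto simp: bruhat_le_iff)
  then show ?thesis by induction (use bruhat_step_props less_trans in blast)+
qed

lemma bruhat_le_comp_simple:
  "w \<in> W \<Longrightarrow> \<alpha> \<in> \<Delta> \<Longrightarrow> lng w < lng (w \<circ> reflection \<alpha>) \<Longrightarrow> bruhat_le \<Delta> w (w \<circ> reflection \<alpha>)"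
  using len_simple_iff(2) simple_pos unfolding bruhat_le_iff bruhat_step_def by blast

text \<open>Right multiplication by the reflection in \<alpha> turns a step by \<beta> in the chain
  from \<open>y\<close> to \<open>v\<close> into a step by
  \<open>reflection \<alpha> \<beta>\<close>. This is again upward unless \<beta> = \<alpha>, and
  then the product is already the next element of the chain.\<close>

lemma bruhat_lifting_aux:
  assumes "bruhat_le \<Delta> y v" "\<alpha> \<in> \<Delta>"
  shows "bruhat_le \<Delta> (y \<circ> reflection \<alpha>) v \<or> bruhat_le \<Delta> (y \<circ> reflection \<alpha>) (v \<circ> reflection \<alpha>)"
proof -
  have v: "v \<in> W" using bruhat_le_in(2)[OF assms(1)] .
  have "(y, v) \<in> bruhat_step\<^sup>*" using assms(1) by (simp add: bruhat_le_iff)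
  then show ?thesis
  proof (induction rule: converse_rtrancl_induct)
    case base
    then show ?case using v weyl_group_comp_reflection_iff[OF assms(2), of v] bruhat_le_refl by blast
  next
    case (step y z)
    have yW: "y \<in> W" using step bruhat_step_props by blast
    then have ysW: "y \<circ> reflection \<alpha> \<in> W" using weyl_group_comp_reflection_iff[OF assms(2)] by simp
    obtain \<beta> where b: "z = y \<circ> reflection \<beta>" "\<beta> \<in> pos" "y \<beta> \<in> pos"
      using step(1) unfolding bruhat_step_def by blast
    show ?case
    proof (cases "\<beta> = \<alpha>")
      case True
      then show ?thesis using step b ysW by (auto simp: bruhat_le_iff)
    next
      case False
      let ?\<gamma> = "reflection \<alpha> \<beta>"
      have "?\<gamma> \<in> pos" using simple_reflection_pos[OF assms(2) b(2) False] .
      moreover have "(y \<circ> reflection \<alpha>) ?\<gamma> \<in> pos" using b by (simp add: comp_apply)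
      moreover have "(y \<circ> reflection \<alpha>) \<circ> reflection ?\<gamma> = z \<circ> reflection \<alpha>"
      proof -
        have "reflection \<alpha> \<circ> reflection ?\<gamma> = reflection \<beta> \<circ> reflection \<alpha>"
          using comp_reflection_eq[OF reflection_in_weyl_group[OF assms(2)], of ?\<gamma>] by simp
        then show ?thesis by (simp add: b(1) comp_assoc)
      qed
      ultimately have "(y \<circ> reflection \<alpha>, z \<circ> reflection \<alpha>) \<in> bruhat_step"
        using ysW unfolding bruhat_step_def by (intro CollectI exI[of _ "y \<circ> reflection \<alpha>"] exI[of _ ?\<gamma>]) auto
      then have "bruhat_le \<Delta> (y \<circ> reflection \<alpha>) (z \<circ> reflection \<alpha>)" using ysW by (auto simp: bruhat_le_iff)
      then show ?thesis using step.IH v bruhat_le_trans by blast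
    qed
  qed
qed

lemma bruhat_lifting:
  assumes "bruhat_le \<Delta> y v" "\<alpha> \<in> \<Delta>" "lng v < lng (v \<circ> reflection \<alpha>)"
  shows "bruhat_le \<Delta> (y \<circ> reflection \<alpha>) (v \<circ> reflection \<alpha>)"
  using bruhat_lifting_aux[OF assms(1,2)] bruhat_le_comp_simple[OF bruhat_le_in(2)[OF assms(1)] assms(2,3)]
    bruhat_le_trans by blast

end

section \<open>Push-forward of finitely supported functions\<close>

abbreviation "keys \<equiv> Poly_Mapping.keys"
abbreviation "lookup \<equiv> Poly_Mapping.lookup"

lemma push_eq_sum:
  assumes "finite S" "keys f \<subseteq> S"
  shows "push g f = (\<Sum>k\<in>S. Poly_Mapping.single (g k) (lookup f k))"
  unfolding push_def by (rule sum.mono_neutral_left) (use assms in \<open>auto simp: in_keys_iff\<close>)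

lemma push_zero [simp]: "push g 0 = 0" by (simp add: push_def)

lemma push_add: "push g (f + h) = push g f + push g h"
proof -
  have "push g (f + h) = (\<Sum>k\<in>keys f \<union> keys h.
      Poly_Mapping.single (g k) (lookup (f + h) k))"
    by (rule push_eq_sum) (simp_all add: Poly_Mapping.keys_add)
  also have "\<dots> = push g f + push g h"
    by (simp add: push_eq_sum[of "keys f \<union> keys h"] lookup_add single_add sum.distrib)
  finally show ?thesis .
qed

lemma push_uminus: "push g (- f) = - push g f"
  by (metis add_eq_0_iff push_add push_zero add.right_inverse)

lemma push_diff: "push g (f - h) = push g f - push g h"
  by (metis diff_conv_add_uminus push_add push_uminus)

lemma push_sum: "push g (sum f A) = (\<Sum>a\<in>A. push g (f a))"
  by (induction A rule: infinite_finite_induct) (auto simp: push_add)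

lemma push_single: "push g (Poly_Mapping.single k c) = Poly_Mapping.single (g k) c"
  by (subst push_eq_sum[of "{k}"]) auto

lemma push_comp: "push g (push h f) = push (g \<circ> h) f"
  by (rule frag_induction[of f UNIV]) (auto simp: push_single push_diff comp_apply)

lemma keys_push: "keys (push g f) \<subseteq> g ` keys f"
proof
  fix x assume "x \<in> keys (push g f)"
  then obtain k where "k \<in> keys f"
    "x \<in> keys (Poly_Mapping.single (g k) (lookup f k))"
    unfolding push_def
    using keys_sum[of "\<lambda>k. Poly_Mapping.single (g k) (lookup f k)" "keys f"] by blast
  then show "x \<in> g ` keys f" by (auto split: if_splits)
qed

lemma push_of_int: "g 0 = 0 \<Longrightarrow> push g (of_int c) = of_int c"
  by (metis push_single single_of_int)

lemma push_mult:
  assumes "\<And>x y. g (x + y) = g x + g y" shows "push g (f * h) = push g f * push g h"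
proof (rule frag_induction[of f UNIV])
  fix x show "push g (frag_of x * h) = push g (frag_of x) * push g h"
    by (rule frag_induction[of h UNIV])
      (auto simp: push_single push_diff mult_single assms right_diff_distrib)
qed (auto simp: push_diff left_diff_distrib)

lemma push_of_int_mult:
  assumes "\<And>x y. g (x + y) = g x + g y" "g 0 = 0" shows "push g (of_int c * h) = of_int c * push g h"
  using assms by (simp add: push_mult push_of_int)

lemma lookup_single_mult:
  fixes k :: "'k::ab_group_add"
  shows "lookup (Poly_Mapping.single a (1 :: int) * f) k = lookup f (k - a)"
  by (rule frag_induction[of f UNIV])
    (auto simp: mult_single lookup_minus right_diff_distrib lookup_single when_def algebra_simps)

lemma lookup_of_int_mult:
  fixes f :: "'k::monoid_add \<Rightarrow>\<^sub>0 int"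
  shows "lookup (of_int c * f) k = c * lookup f k"
  by (rule frag_induction[of f UNIV])
    (auto simp: mult_single lookup_minus right_diff_distrib lookup_single when_def id_apply simp flip: single_of_int)

section \<open>The Hecke algebra\<close>

abbreviation bar :: "laurent \<Rightarrow> laurent" where "bar \<equiv> push uminus"

lemma bar_mult: "bar (x * y) = bar x * bar y" by (rule push_mult) simp
lemma bar_v_pow: "bar (v_pow k) = v_pow (- k)" by (simp add: v_pow_def push_single)
lemma v_pow_mult: "v_pow a * v_pow b = v_pow (a + b)" by (simp add: v_pow_def mult_single)
lemma v_pow_0 [simp]: "v_pow 0 = 1" by (simp add: v_pow_def)
lemma v_pow_mult_left: "v_pow a * (v_pow b * x) = v_pow (a + b) * x"
  by (simp add: v_pow_mult flip: mult.assoc)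

lemma lookup_v_pow_mult: "lookup (v_pow a * f) k = lookup f (k - a)"
  unfolding v_pow_def by (rule lookup_single_mult)

lemma lookup_bar: "lookup (bar f) k = lookup f (- k)"
  by (rule frag_induction[of f UNIV])
    (auto simp: push_single push_diff lookup_minus lookup_single when_def)

lemma lookup_poly_at_v2:
  "lookup (poly_at_v2 P) k = (if even k \<and> 0 \<le> k then coeff P (nat (k div 2)) else 0)"
proof -
  have "lookup (poly_at_v2 P) k = (\<Sum>i\<le>degree P. if k = 2 * int i then coeff P i else 0)"
    unfolding poly_at_v2_def lookup_sum
    by (intro sum.cong) (auto simp: lookup_of_int_mult v_pow_def lookup_single when_def)
  also have "\<dots> = (\<Sum>i\<in>{i. i \<le> degree P \<and> k = 2 * int i}. coeff P i)"
    by (subst sum.inter_filter[symmetric]) (auto simp: atMost_def)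
  also have "\<dots> = (if even k \<and> 0 \<le> k then coeff P (nat (k div 2)) else 0)" (is "sum _ ?S = _")
  proof (cases "even k \<and> 0 \<le> k")
    case True
    then obtain n where n: "k = 2 * int n" by (metis evenE nonneg_int_cases zero_le_mult_iff not_numeral_le_zero zero_le_numeral)
    then have "{i. i \<le> degree P \<and> k = 2 * int i} = (if n \<le> degree P then {n} else {})" by auto
    then show ?thesis using n coeff_eq_0[of P n] by auto
  next
    case False
    then have e: "?S = {}" by auto
    show ?thesis unfolding e using False by auto
  qed
  finally show ?thesis .
qed

lemma poly_at_v2_1 [simp]: "poly_at_v2 1 = 1"
  by (simp add: poly_at_v2_def)

lemma poly_at_v2_0 [simp]: "poly_at_v2 0 = 0"
  by (simp add: poly_at_v2_def)

lemma poly_at_v2_add: "poly_at_v2 (P + Q) = poly_at_v2 P + poly_at_v2 Q"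
  by (rule poly_mapping_eqI) (simp add: lookup_poly_at_v2 lookup_add)

lemma poly_at_v2_diff: "poly_at_v2 (P - Q) = poly_at_v2 P - poly_at_v2 Q"
  by (rule poly_mapping_eqI) (simp add: lookup_poly_at_v2 lookup_minus)

lemma poly_at_v2_sum: "poly_at_v2 (sum f A) = (\<Sum>a\<in>A. poly_at_v2 (f a))"
  by (induction A rule: infinite_finite_induct) (auto simp: poly_at_v2_add)

lemma poly_at_v2_monom_mult: "poly_at_v2 (monom c n * P) = of_int c * v_pow (2 * int n) * poly_at_v2 P"
proof (rule poly_mapping_eqI)
  fix k
  have "nat (k div 2) - n = nat ((k - 2 * int n) div 2)" if "n \<le> nat (k div 2)" "even k" "0 \<le> k"
    using that by auto
  moreover have "even k \<and> 0 \<le> k \<and> n \<le> nat (k div 2) \<longleftrightarrow> even (k - 2 * int n) \<and> 0 \<le> k - 2 * int n"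
    by (auto elim!: evenE)
  ultimately show "lookup (poly_at_v2 (monom c n * P)) k
      = lookup (of_int c * v_pow (2 * int n) * poly_at_v2 P) k"
    by (auto simp: lookup_poly_at_v2 lookup_v_pow_mult lookup_of_int_mult mult.assoc coeff_monom_mult)
qed

lemma poly_at_v2_pCons: "poly_at_v2 (pCons 0 P) = v_pow 2 * poly_at_v2 P"
  using poly_at_v2_monom_mult[of 1 1 P] by (simp add: monom_altdef)

section \<open>Left and right multiplications in the Hecke algebra\<close>

context based_root_system
begin

text \<open>Hecke elements are functions on all self-maps of the space, while \<open>len\<close> has
  a meaning only on the Weyl group; identities between multiplication operators are stated for
  functions supported there.\<close>

definition onW :: "'a hecke \<Rightarrow> bool" where "onW h \<longleftrightarrow> (\<forall>x. x \<notin> W \<longrightarrow> h x = 0)"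

definition hb :: "('a \<Rightarrow> 'a) \<Rightarrow> 'a hecke" where "hb x = (\<lambda>u. if u = x then 1 else 0)"

abbreviation hL :: "('a \<Rightarrow> 'a) \<Rightarrow> 'a hecke \<Rightarrow> 'a hecke" where "hL \<equiv> hecke_T \<Delta>"
abbreviation hLi :: "('a \<Rightarrow> 'a) \<Rightarrow> 'a hecke \<Rightarrow> 'a hecke" where "hLi \<equiv> hecke_T_inv \<Delta>"

text \<open>Right multiplication by \<open>T\<^sub>s\<close>, by its inverse, and by \<open>v\<^sup>-\<^sup>1 (T\<^sub>s + 1)\<close>, where \<open>s\<close> is the
  reflection in \<open>\<alpha>\<close>.\<close>

definition hR :: "'a \<Rightarrow> 'a hecke \<Rightarrow> 'a hecke" where
  "hR \<alpha> h = (\<lambda>x. if lng (x \<circ> reflection \<alpha>) < lng x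
      then h (x \<circ> reflection \<alpha>) + (v_pow 2 - 1) * h x else v_pow 2 * h (x \<circ> reflection \<alpha>))"

definition hRi :: "'a \<Rightarrow> 'a hecke \<Rightarrow> 'a hecke" where
  "hRi \<alpha> h = (\<lambda>x. v_pow (-2) * hR \<alpha> h x + (v_pow (-2) - 1) * h x)"

definition hC :: "'a \<Rightarrow> 'a hecke \<Rightarrow> 'a hecke" where
  "hC \<alpha> h = (\<lambda>x. v_pow (-1) * (hR \<alpha> h x + h x))"

lemma onW_hb: "x \<in> W \<Longrightarrow> onW (hb x)" by (auto simp: onW_def hb_def)

lemma onW_hL: "\<alpha> \<in> \<Delta> \<Longrightarrow> onW h \<Longrightarrow> onW (hL (reflection \<alpha>) h)"
  by (auto simp: onW_def hecke_T_def reflection_comp_weyl_group_iff)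

lemma onW_hLi: "\<alpha> \<in> \<Delta> \<Longrightarrow> onW h \<Longrightarrow> onW (hLi (reflection \<alpha>) h)"
  using onW_hL by (auto simp: onW_def hecke_T_inv_def)

lemma onW_hR: "\<alpha> \<in> \<Delta> \<Longrightarrow> onW h \<Longrightarrow> onW (hR \<alpha> h)"
  by (auto simp: onW_def hR_def weyl_group_comp_reflection_iff)

lemma onW_hRi: "\<alpha> \<in> \<Delta> \<Longrightarrow> onW h \<Longrightarrow> onW (hRi \<alpha> h)"
  using onW_hR by (auto simp: onW_def hRi_def)

lemma refl_comp_cancel_left [simp]: "reflection \<alpha> \<circ> (reflection \<alpha> \<circ> f) = f"
  by (simp add: fun_eq_iff comp_apply)

lemma len_left_cases:
  assumes "w \<in> W" "\<alpha> \<in> \<Delta>"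
  obtains "lng (reflection \<alpha> \<circ> w) < lng w" "\<not> lng w < lng (reflection \<alpha> \<circ> w)"
    | "lng w < lng (reflection \<alpha> \<circ> w)" "\<not> lng (reflection \<alpha> \<circ> w) < lng w"
  using len_left_iff[OF assms] weyl_group_root_cases[OF weyl_group_inv[OF assms(1)] simple_root[OF assms(2)]]
  by (meson order_less_asym)

lemma len_right_cases:
  assumes "w \<in> W" "\<alpha> \<in> \<Delta>"
  obtains "lng (w \<circ> reflection \<alpha>) < lng w" "\<not> lng w < lng (w \<circ> reflection \<alpha>)"
    | "lng w < lng (w \<circ> reflection \<alpha>)" "\<not> lng (w \<circ> reflection \<alpha>) < lng w"
  by (rule len_simple_cases[OF assms]) (use that in auto)

lemma hLi_eq: "hLi s h x = (if lng (s \<circ> x) < lng x then v_pow (-2) * h (s \<circ> x)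
    else h (s \<circ> x) + (v_pow (-2) - 1) * h x)"
  by (simp add: hecke_T_inv_def hecke_T_def algebra_simps v_pow_mult_left v_pow_mult)

lemma hRi_eq: "hRi \<alpha> h x = (if lng (x \<circ> reflection \<alpha>) < lng x then v_pow (-2) * h (x \<circ> reflection \<alpha>)
    else h (x \<circ> reflection \<alpha>) + (v_pow (-2) - 1) * h x)"
  by (simp add: hRi_def hR_def algebra_simps v_pow_mult_left v_pow_mult)

lemma hL_hLi:
  assumes "\<alpha> \<in> \<Delta>" "onW h"
  shows "hL (reflection \<alpha>) (hLi (reflection \<alpha>) h) = h" "hLi (reflection \<alpha>) (hL (reflection \<alpha>) h) = h"
proof -
  have "hL (reflection \<alpha>) (hLi (reflection \<alpha>) h) x = h x
      \<and> hLi (reflection \<alpha>) (hL (reflection \<alpha>) h) x = h x" for x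
  proof (cases "x \<in> W")
    case True
    show ?thesis
      by (rule len_left_cases[OF True assms(1)])
        (simp_all add: hecke_T_def hLi_eq, simp_all add: algebra_simps v_pow_mult_left v_pow_mult)
  next
    case False
    then show ?thesis using assms onW_hL onW_hLi by (metis onW_def)
  qed
  then show "hL (reflection \<alpha>) (hLi (reflection \<alpha>) h) = h" "hLi (reflection \<alpha>) (hL (reflection \<alpha>) h) = h"
    by auto
qed

lemma hR_hRi:
  assumes "\<alpha> \<in> \<Delta>" "onW h" shows "hR \<alpha> (hRi \<alpha> h) = h"
proof
  fix x show "hR \<alpha> (hRi \<alpha> h) x = h x"
  proof (cases "x \<in> W")
    case True
    show ?thesis
      by (rule len_right_cases[OF True assms(1)])
        (simp_all add: hR_def[of \<alpha> "hRi \<alpha> h"] hRi_eq, simp_all add: algebra_simps v_pow_mult_left v_pow_mult)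
  next
    case False
    then show ?thesis using assms onW_hR onW_hRi by (metis onW_def)
  qed
qed

lemma hL_hb:
  assumes "x \<in> W" "\<alpha> \<in> \<Delta>" "lng x < lng (reflection \<alpha> \<circ> x)"
  shows "hL (reflection \<alpha>) (hb x) = hb (reflection \<alpha> \<circ> x)"
proof
  fix u
  have "reflection \<alpha> \<circ> u = x \<longleftrightarrow> u = reflection \<alpha> \<circ> x" by auto
  then show "hL (reflection \<alpha>) (hb x) u = hb (reflection \<alpha> \<circ> x) u"
    using assms(3) by (auto simp: hecke_T_def hb_def)
qed

lemma hR_hb:
  assumes "x \<in> W" "\<alpha> \<in> \<Delta>" "lng x < lng (x \<circ> reflection \<alpha>)"
  shows "hR \<alpha> (hb x) = hb (x \<circ> reflection \<alpha>)"
proof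
  fix u
  have "u \<circ> reflection \<alpha> = x \<longleftrightarrow> u = x \<circ> reflection \<alpha>" by (metis reflection_comp_cancel)
  then show "hR \<alpha> (hb x) u = hb (x \<circ> reflection \<alpha>) u"
    using assms(3) by (auto simp: hR_def hb_def)
qed

lemma sign_change_simple:
  assumes "\<alpha> \<in> \<Delta>" "\<gamma> \<in> \<Phi>" "(\<gamma> \<in> pos) \<noteq> (reflection \<alpha> \<gamma> \<in> pos)"
  shows "\<gamma> = \<alpha> \<or> \<gamma> = - \<alpha>"
proof (cases "\<gamma> \<in> pos")
  case True
  then show ?thesis using assms simple_reflection_pos by blast
next
  case False
  then have n: "- \<gamma> \<in> pos" using pos_or_neg assms(2) by blast
  have "reflection \<alpha> (- \<gamma>) \<notin> pos"
    using False assms(3) not_pos_and_neg linear_neg[OF linear_reflection] by metis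
  then have "- \<gamma> = \<alpha>" using simple_reflection_pos[OF assms(1) n] by blast
  then show ?thesis by (simp add: minus_equation_iff)
qed

text \<open>A simple reflection changes the sign of a root only if that root is plus or minus its
  own simple root. Here this would mean that \<open>x \<beta>\<close> is plus or minus \<alpha>, the
  excluded case in which the two products coincide.\<close>

lemma len_left_right:
  assumes "x \<in> W" "\<alpha> \<in> \<Delta>" "\<beta> \<in> \<Delta>" "reflection \<alpha> \<circ> x \<noteq> x \<circ> reflection \<beta>"
  shows "lng (reflection \<alpha> \<circ> x \<circ> reflection \<beta>) < lng (x \<circ> reflection \<beta>) \<longleftrightarrow> lng (reflection \<alpha> \<circ> x) < lng x"
    and "lng (reflection \<alpha> \<circ> x \<circ> reflection \<beta>) < lng (reflection \<alpha> \<circ> x) \<longleftrightarrow> lng (x \<circ> reflection \<beta>) < lng x"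
proof -
  have xb: "x \<circ> reflection \<beta> \<in> W" and ax: "reflection \<alpha> \<circ> x \<in> W" and ix: "inv x \<in> W"
    using assms(1) weyl_group_comp_reflection_iff[OF assms(3)] reflection_comp_weyl_group_iff[OF assms(2)]
      weyl_group_inv by simp_all
  have ne: "x \<beta> \<noteq> \<alpha>" "x \<beta> \<noteq> - \<alpha>"
    using assms(4) comp_reflection_eq[OF assms(1), of \<beta>] reflection_uminus[of \<alpha>] by auto
  have ne': "inv x \<alpha> \<noteq> \<beta>" "inv x \<alpha> \<noteq> - \<beta>"
    using ne weyl_group_uminus[OF assms(1)] weyl_group_inv_apply(2)[OF assms(1), of \<alpha>] by force+
  have neg: "- \<gamma> \<in> pos \<longleftrightarrow> \<gamma> \<notin> pos" if "\<gamma> \<in> \<Phi>" for \<gamma>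
    using that pos_or_neg not_pos_and_neg by blast
  have "inv (x \<circ> reflection \<beta>) \<alpha> = reflection \<beta> (inv x \<alpha>)"
  proof -
    have "inv (x \<circ> reflection \<beta>) = reflection \<beta> \<circ> inv x"
      by (rule inv_unique_comp) (use assms(1) in \<open>auto simp: fun_eq_iff comp_apply id_apply\<close>)
    then show ?thesis by (simp add: comp_apply)
  qed
  then have "inv (x \<circ> reflection \<beta>) \<alpha> \<in> pos \<longleftrightarrow> inv x \<alpha> \<in> pos"
    using sign_change_simple[OF assms(3) weyl_group_root[OF ix simple_root[OF assms(2)]]] ne' by auto
  then show "lng (reflection \<alpha> \<circ> x \<circ> reflection \<beta>) < lng (x \<circ> reflection \<beta>) \<longleftrightarrow> lng (reflection \<alpha> \<circ> x) < lng x"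
    using len_left_iff(1)[OF xb assms(2)] len_left_iff(1)[OF assms(1,2)]
      neg[OF weyl_group_root[OF weyl_group_inv[OF xb] simple_root[OF assms(2)]]]
      neg[OF weyl_group_root[OF ix simple_root[OF assms(2)]]] by (simp add: comp_assoc)
  have "(reflection \<alpha> \<circ> x) \<beta> \<in> pos \<longleftrightarrow> x \<beta> \<in> pos"
    using sign_change_simple[OF assms(2) weyl_group_root[OF assms(1) simple_root[OF assms(3)]]] ne
    by (auto simp: comp_apply)
  then show "lng (reflection \<alpha> \<circ> x \<circ> reflection \<beta>) < lng (reflection \<alpha> \<circ> x) \<longleftrightarrow> lng (x \<circ> reflection \<beta>) < lng x"
    using len_simple_iff(1)[OF ax assms(3)] len_simple_iff(1)[OF assms(1,3)]
      neg[OF weyl_group_root[OF ax simple_root[OF assms(3)]]]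
      neg[OF weyl_group_root[OF assms(1) simple_root[OF assms(3)]]] by simp
qed

text \<open>If \<open>reflection \<alpha> \<circ> x = x \<circ> reflection \<beta>\<close>, both
  operators act alike on this pair of arguments; otherwise \<open>len_left_right\<close> makes the
  two length conditions independent of each other.\<close>

lemma hL_hR_commute:
  assumes "\<alpha> \<in> \<Delta>" "\<beta> \<in> \<Delta>" "onW h"
  shows "hL (reflection \<alpha>) (hR \<beta> h) = hR \<beta> (hL (reflection \<alpha>) h)"
proof
  fix x
  show "hL (reflection \<alpha>) (hR \<beta> h) x = hR \<beta> (hL (reflection \<alpha>) h) x"
  proof (cases "x \<in> W")
    case x: True
    show ?thesis
    proof (cases "reflection \<alpha> \<circ> x = x \<circ> reflection \<beta>")
      case True
      show ?thesis
        by (rule len_left_cases[OF x assms(1)])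
          (simp_all add: hecke_T_def hR_def True[symmetric], simp_all add: True)
    next
      case False
      show ?thesis
        unfolding hecke_T_def hR_def comp_assoc[symmetric] len_left_right[OF x assms(1,2) False]
        by (simp add: algebra_simps)
    qed
  next
    case False
    then show ?thesis using assms onW_hR onW_hL by (metis onW_def)
  qed
qed

subsection \<open>Independence of the reduced word\<close>

lemma foldr_Cons_apply: "foldr f (x # xs) a = f x (foldr f xs a)"
  by (simp add: comp_apply)

lemma foldr_Nil_apply: "foldr f [] a = a"
  by (simp add: id_apply)

declare foldr.simps [simp del] foldr_Cons_apply [simp] foldr_Nil_apply [simp]

definition hlin :: "('a hecke \<Rightarrow> 'a hecke) \<Rightarrow> bool" where
  "hlin A \<longleftrightarrow> (\<forall>(S :: ('a \<Rightarrow> 'a) set) c g.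
     A (\<lambda>u. \<Sum>x\<in>S. c x * g x u) = (\<lambda>u. \<Sum>x\<in>S. c x * A (g x) u))"

text \<open>Endomorphisms of the right regular module.\<close>

definition hendo :: "('a hecke \<Rightarrow> 'a hecke) \<Rightarrow> bool" where
  "hendo A \<longleftrightarrow> hlin A \<and> (\<forall>h. onW h \<longrightarrow> onW (A h)) \<and>
     (\<forall>h \<alpha>. onW h \<longrightarrow> \<alpha> \<in> \<Delta> \<longrightarrow> A (hR \<alpha> h) = hR \<alpha> (A h))"

lemma hlin_hL: "hlin (hL s)"
  unfolding hlin_def hecke_T_def
  by (auto simp: fun_eq_iff sum_distrib_left sum.distrib[symmetric] algebra_simps intro!: sum.cong)

lemma hlin_hLi: "hlin (hLi s)"
  unfolding hlin_def
  by (auto simp: fun_eq_iff hLi_eq sum_distrib_left sum.distrib[symmetric] algebra_simps intro!: sum.cong)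

lemma hlin_hR: "hlin (hR \<alpha>)"
  unfolding hlin_def hR_def
  by (auto simp: fun_eq_iff sum_distrib_left sum.distrib[symmetric] algebra_simps intro!: sum.cong)

lemma hlin_comp: "hlin A \<Longrightarrow> hlin B \<Longrightarrow> hlin (A \<circ> B)"
  unfolding hlin_def by (simp add: comp_apply)

lemma hendo_hL: "\<alpha> \<in> \<Delta> \<Longrightarrow> hendo (hL (reflection \<alpha>))"
  unfolding hendo_def using hlin_hL onW_hL hL_hR_commute by blast

lemma hendo_hLi: assumes "\<alpha> \<in> \<Delta>" shows "hendo (hLi (reflection \<alpha>))"
proof -
  let ?L = "hL (reflection \<alpha>)" and ?Li = "hLi (reflection \<alpha>)"
  have "?Li (hR \<beta> h) = hR \<beta> (?Li h)" if "onW h" "\<beta> \<in> \<Delta>" for h \<beta>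
  proof -
    have "?L (hR \<beta> (?Li h)) = hR \<beta> h"
      using hL_hR_commute[OF assms that(2) onW_hLi[OF assms that(1)]] hL_hLi(1)[OF assms that(1)] by simp
    then show ?thesis
      using hL_hLi(2)[OF assms onW_hR[OF that(2) onW_hLi[OF assms that(1)]]] by simp
  qed
  then show ?thesis unfolding hendo_def using hlin_hLi onW_hLi assms by blast
qed

lemma hendo_comp: "hendo A \<Longrightarrow> hendo B \<Longrightarrow> hendo (A \<circ> B)"
  unfolding hendo_def using hlin_comp by (auto simp: comp_apply)

lemma hendo_id: "hendo id" unfolding hendo_def hlin_def by (simp add: id_apply)

lemma hendo_foldr:
  "set ss \<subseteq> reflection ` \<Delta> \<Longrightarrow> hendo (foldr hL ss)"
  "set ss \<subseteq> reflection ` \<Delta> \<Longrightarrow> hendo (foldr hLi ss)"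
  by (induction ss) (auto simp: foldr.simps intro: hendo_comp hendo_id hendo_hL hendo_hLi)

text \<open>Right multiplications produce every \<open>hb x\<close> from \<open>hb id\<close>, and
  such maps commute with them; linearity does the rest.\<close>

lemma hendo_eqI:
  assumes "hendo A" "hendo B" "A (hb id) = B (hb id)" "onW h" shows "A h = B h"
proof -
  have "A (hb x) = B (hb x)" if "x \<in> W" for x
    using that
  proof (induction "lng x" arbitrary: x rule: less_induct)
    case less
    show ?case
    proof (cases "x = id")
      case False
      then obtain \<alpha> where a: "\<alpha> \<in> D x" using descent_ex less.prems by blast
      then have aD: "\<alpha> \<in> \<Delta>" and lt: "lng (x \<circ> reflection \<alpha>) < lng x" by (auto simp: right_descents_def)
      let ?y = "x \<circ> reflection \<alpha>"
      have y: "?y \<in> W" using weyl_group_comp_reflection_iff aD less.prems by blast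
      have "hb x = hR \<alpha> (hb ?y)" using hR_hb[OF y aD] lt by simp
      then show ?thesis using less.hyps[OF lt y] assms(1,2) onW_hb[OF y] aD unfolding hendo_def by metis
    qed (use assms in simp)
  qed
  moreover have h: "h = (\<lambda>u. \<Sum>x\<in>W. h x * hb x u)"
  proof
    fix u show "h u = (\<Sum>x\<in>W. h x * hb x u)"
      using assms(4) by (auto simp: hb_def onW_def if_distrib cong: if_cong)
  qed
  moreover have "C h = (\<lambda>u. \<Sum>x\<in>W. h x * C (hb x) u)" if "hendo C" for C
  proof -
    have "C (\<lambda>u. \<Sum>x\<in>W. h x * hb x u) = (\<lambda>u. \<Sum>x\<in>W. h x * C (hb x) u)"
      using that unfolding hendo_def hlin_def by blast
    then show ?thesis using h by simp
  qed
  ultimately show ?thesis using assms(1,2) by simp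
qed

lemma word_prod_in_W: "set ss \<subseteq> reflection ` \<Delta> \<Longrightarrow> word_prod ss \<in> W"
  unfolding weyl_group_def by blast

lemma foldr_hL_reduced:
  "set ss \<subseteq> reflection ` \<Delta> \<Longrightarrow> length ss = lng (word_prod ss) \<Longrightarrow> foldr hL ss (hb id) = hb (word_prod ss)"
proof (induction ss)
  case (Cons s ss)
  then obtain \<alpha> where a: "\<alpha> \<in> \<Delta>" "s = reflection \<alpha>" by auto
  have ss: "set ss \<subseteq> reflection ` \<Delta>" using Cons.prems by auto
  have v: "word_prod ss \<in> W" using word_prod_in_W ss .
  have sv: "reflection \<alpha> \<circ> word_prod ss \<in> W" using v a reflection_comp_weyl_group_iff by blast
  have "lng (reflection \<alpha> \<circ> word_prod ss) \<le> Suc (lng (word_prod ss))"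
    using len_comp_le[OF weyl_group_inv[OF v] a(1)] len_inv[OF v] len_inv[OF sv]
    by (simp add: inv_reflection_comp[OF v])
  then have l: "length ss = lng (word_prod ss)" "lng (word_prod ss) < lng (reflection \<alpha> \<circ> word_prod ss)"
    using Cons.prems(2) len_word_le[OF ss] a by auto
  then show ?case using Cons.IH[OF ss] hL_hb[OF v a(1)] a by simp
qed simp

lemma foldr_hL_hLi:
  assumes "set ss \<subseteq> reflection ` \<Delta>" "onW h"
  shows "foldr hL (rev ss) (foldr hLi ss h) = h" "foldr hLi ss (foldr hL (rev ss) h) = h"
proof -
  have *: "onW (foldr hLi ss h)" if "set ss \<subseteq> reflection ` \<Delta>" "onW h" for ss h
    using hendo_foldr(2)[OF that(1)] that(2) unfolding hendo_def by blast
  show "foldr hL (rev ss) (foldr hLi ss h) = h"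
    using assms by (induction ss) (auto simp: * hL_hLi)
  show "foldr hLi ss (foldr hL (rev ss) h) = h"
    using assms by (induction ss arbitrary: h) (auto simp: onW_hL hL_hLi)
qed

lemma word_prod_rev:
  assumes "set ss \<subseteq> reflection ` \<Delta>" shows "word_prod (rev ss) = inv (word_prod ss)"
proof -
  have "set ss \<subseteq> range reflection" "set (rev ss) \<subseteq> range reflection" using assms by auto
  from word_prod_rev_comp[OF this(1)] word_prod_rev_comp[OF this(2)]
  show ?thesis by (intro inv_unique_comp[symmetric]) simp_all
qed

text \<open>Left multiplication by \<open>T\<close> at the inverse of \<open>w\<close> is determined by its value at \<open>1\<close>, since it
  commutes with right multiplications; so is its inverse.\<close>

lemma foldr_hLi_reduced_eq:
  assumes "set ss \<subseteq> reflection ` \<Delta>" "length ss = lng w" "word_prod ss = w"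
    and "set ts \<subseteq> reflection ` \<Delta>" "length ts = lng w" "word_prod ts = w"
  shows "foldr hLi ss (hb id) = foldr hLi ts (hb id)"
proof -
  have w: "w \<in> W" using word_prod_in_W assms by blast
  have o: "onW (hb id)" by (simp add: onW_hb)
  have oX: "onW (foldr hLi ts (hb id))" using hendo_foldr(2)[OF assms(4)] o unfolding hendo_def by blast
  have r: "foldr hL (rev us) (hb id) = hb (inv w)"
    if "set us \<subseteq> reflection ` \<Delta>" "length us = lng w" "word_prod us = w" for us
    using foldr_hL_reduced[of "rev us"] word_prod_rev[OF that(1)] that len_inv[OF w] by simp
  have "foldr hL (rev ss) (foldr hLi ts (hb id)) = foldr hL (rev ts) (foldr hLi ts (hb id))"
    by (rule hendo_eqI[OF hendo_foldr(1) hendo_foldr(1) _ oX]) (use assms r in auto)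
  also have "\<dots> = hb id" by (rule foldr_hL_hLi(1)[OF assms(4) o])
  finally show ?thesis using foldr_hL_hLi(2)[OF assms(1) oX] by simp
qed

lemma reduced_word_props:
  "w \<in> W \<Longrightarrow> set (reduced_word \<Delta> w) \<subseteq> reflection ` \<Delta> \<and> length (reduced_word \<Delta> w) = lng w
    \<and> word_prod (reduced_word \<Delta> w) = w"
  unfolding reduced_word_def by (rule someI_ex[OF reduced_word_ex])

lemma bar_T_eq: "bar_T \<Delta> w = foldr hLi (reduced_word \<Delta> w) (hb id)"
  by (simp add: bar_T_def hb_def)

lemma bar_T_id: "bar_T \<Delta> id = hb id"
  using reduced_word_props[of id] by (simp add: bar_T_eq)

lemma onW_bar_T: "w \<in> W \<Longrightarrow> onW (bar_T \<Delta> w)"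
  unfolding bar_T_eq using hendo_foldr(2)[of "reduced_word \<Delta> w"] reduced_word_props onW_hb[of id]
  unfolding hendo_def by auto

text \<open>The definition builds \<open>bar_T\<close> from the left. At the unit, left and right
  multiplication by the inverse of \<open>T\<^sub>s\<close> agree, and the right one commutes with
  all left ones; so a letter appended to a reduced word comes out as a right multiplication.\<close>

lemma bar_T_comp:
  assumes "w \<in> W" "\<alpha> \<in> \<Delta>" "lng w < lng (w \<circ> reflection \<alpha>)"
  shows "bar_T \<Delta> (w \<circ> reflection \<alpha>) = hRi \<alpha> (bar_T \<Delta> w)"
proof -
  let ?ss = "reduced_word \<Delta> w"
  have wa: "w \<circ> reflection \<alpha> \<in> W" using assms weyl_group_comp_reflection_iff by blast
  have ss: "set ?ss \<subseteq> reflection ` \<Delta>" "length ?ss = lng w" "word_prod ?ss = w"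
    using reduced_word_props assms by auto
  have o: "onW (hb id)" by (simp add: onW_hb)
  have l: "lng (w \<circ> reflection \<alpha>) = lng w + 1" using len_simple_cases[OF assms(1,2)] assms(3) by auto
  have l1: "lng id < lng (reflection \<alpha> \<circ> id)" "lng id < lng (id \<circ> reflection \<alpha>)"
    using len_left_iff(2)[of id \<alpha>] len_simple_iff(2)[of id \<alpha>] assms(2) simple_pos by (simp_all add: id_apply)
  have "hLi (reflection \<alpha>) (hb id) = hRi \<alpha> (hb id)"
    using hL_hb[OF weyl_group_id assms(2) l1(1)] hR_hb[OF weyl_group_id assms(2) l1(2)]
    by (simp add: hecke_T_inv_def hRi_def)
  moreover have "foldr hLi ?ss (hRi \<alpha> (hb id)) = hRi \<alpha> (foldr hLi ?ss (hb id))"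
  proof -
    let ?A = "foldr hLi ?ss"
    have A: "hendo ?A" by (rule hendo_foldr(2)[OF ss(1)])
    have "hR \<alpha> (?A (hRi \<alpha> (hb id))) = ?A (hb id)"
      using A hR_hRi[OF assms(2) o] onW_hRi[OF assms(2) o] assms(2) unfolding hendo_def by metis
    moreover have "hRi \<alpha> (hR \<alpha> h) = h" if "onW h" for h
    proof
      fix x show "hRi \<alpha> (hR \<alpha> h) x = h x"
      proof (cases "x \<in> W")
        case True
        show ?thesis
          by (rule len_right_cases[OF True assms(2)])
            (simp_all add: hRi_eq, simp_all add: hR_def algebra_simps v_pow_mult_left v_pow_mult)
      next
        case False
        then show ?thesis using that assms(2) onW_hR onW_hRi by (metis onW_def)
      qed
    qed
    moreover have "onW (?A (hRi \<alpha> (hb id)))" using A onW_hRi[OF assms(2) o] unfolding hendo_def by blast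
    ultimately show ?thesis by metis
  qed
  moreover have "bar_T \<Delta> (w \<circ> reflection \<alpha>) = foldr hLi (?ss @ [reflection \<alpha>]) (hb id)"
    unfolding bar_T_eq
    by (rule foldr_hLi_reduced_eq[of _ "w \<circ> reflection \<alpha>"]) (use ss l assms reduced_word_props[OF wa] in auto)
  ultimately show ?thesis by (simp add: bar_T_eq)
qed

text \<open>Each letter contributes \<open>v\<^sup>-\<^sup>2\<close> at the new top element and
  nothing else of that length or above. Triangularity by length fits the choice of a longest support
  element in the uniqueness proof.\<close>

lemma bar_T_triangular:
  assumes "w \<in> W"
  shows "bar_T \<Delta> w w = v_pow (- 2 * int (lng w)) \<and> (\<forall>x. lng w \<le> lng x \<longrightarrow> x \<noteq> w \<longrightarrow> bar_T \<Delta> w x = 0)"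
  using assms
proof (induction "lng w" arbitrary: w rule: less_induct)
  case less
  show ?case
  proof (cases "w = id")
    case False
    then obtain \<alpha> where a: "\<alpha> \<in> D w" using descent_ex less.prems by blast
    then have aD: "\<alpha> \<in> \<Delta>" and lt: "lng (w \<circ> reflection \<alpha>) < lng w" by (auto simp: right_descents_def)
    let ?v = "w \<circ> reflection \<alpha>"
    have v: "?v \<in> W" using weyl_group_comp_reflection_iff aD less.prems by blast
    have l: "lng w = lng ?v + 1" using len_simple_cases[OF less.prems aD] lt by auto
    have e: "bar_T \<Delta> w = hRi \<alpha> (bar_T \<Delta> ?v)" using bar_T_comp[OF v aD] lt by simp
    note IH = less.hyps[OF lt v]
    have "bar_T \<Delta> w w = v_pow (- 2 * int (lng w))"
      unfolding e hRi_eq using IH lt by (simp add: v_pow_mult l algebra_simps)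
    moreover have "bar_T \<Delta> w x = 0" if x: "lng w \<le> lng x" "x \<noteq> w" for x
    proof (cases "x \<in> W")
      case True
      have ne: "x \<circ> reflection \<alpha> \<noteq> ?v" using x(2) by (metis reflection_comp_cancel)
      have "x \<noteq> ?v" using l x by auto
      have "bar_T \<Delta> ?v x = 0" using IH x l \<open>x \<noteq> ?v\<close> by auto
      moreover have "lng ?v \<le> lng (x \<circ> reflection \<alpha>)"
        using len_simple_cases[OF True aD] x l by fastforce
      ultimately show ?thesis unfolding e hRi_eq using IH ne by simp
    qed (use onW_bar_T[OF less.prems] in \<open>auto simp: onW_def\<close>)
    ultimately show ?thesis by blast
  qed (auto simp: bar_T_id hb_def)
qed

lemma sum_W_split:
  assumes "\<alpha> \<in> \<Delta>"
  shows "(\<Sum>w\<in>W. F w) = (\<Sum>w\<in>{w\<in>W. lng w < lng (w \<circ> reflection \<alpha>)}. F w + F (w \<circ> reflection \<alpha>))"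
proof -
  let ?U = "{w\<in>W. lng w < lng (w \<circ> reflection \<alpha>)}" and ?V = "{w\<in>W. lng (w \<circ> reflection \<alpha>) < lng w}"
  have "W = ?U \<union> ?V" using len_right_cases[OF _ assms] by blast
  then have "(\<Sum>w\<in>W. F w) = sum F ?U + sum F ?V"
    by (metis (no_types, lifting) sum.union_disjoint[of ?U ?V F] finite_Un finite_weyl_group
        disjoint_iff mem_Collect_eq order_less_asym)
  moreover have "bij_betw (\<lambda>w. w \<circ> reflection \<alpha>) ?U ?V"
    by (rule bij_betw_byWitness[where f' = "\<lambda>w. w \<circ> reflection \<alpha>"])
      (auto simp: weyl_group_comp_reflection_iff[OF assms])
  then have "sum F ?V = (\<Sum>w\<in>?U. F (w \<circ> reflection \<alpha>))" by (rule sum.reindex_bij_betw[symmetric])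
  ultimately show ?thesis by (simp add: sum.distrib)
qed

text \<open>Behind this is the bar invariance of \<open>v\<^sup>-\<^sup>1 (T\<^sub>s + 1)\<close>.
  The sums are compared on each pair \<open>w\<close>, \<open>ws\<close>, where \<open>bar_T\<close>
  at the longer element is a right multiple of \<open>bar_T\<close> at the shorter one.\<close>

lemma hecke_bar_hC:
  assumes "\<alpha> \<in> \<Delta>" "onW h" shows "hecke_bar \<Delta> (hC \<alpha> h) = hC \<alpha> (hecke_bar \<Delta> h)"
proof
  fix x
  let ?U = "{w\<in>W. lng w < lng (w \<circ> reflection \<alpha>)}" and ?r = "\<lambda>w. w \<circ> reflection \<alpha>"
  let ?T = "bar_T \<Delta>"
  have Tr: "?T (?r w) = hRi \<alpha> (?T w)" if "w \<in> ?U" for w using that bar_T_comp assms by auto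
  have hCT: "hC \<alpha> (?T w) x = v_pow 1 * (?T w x + ?T (?r w) x)"
    "hC \<alpha> (?T (?r w)) x = v_pow (-1) * (?T w x + ?T (?r w) x)" if "w \<in> ?U" for w
  proof -
    show "hC \<alpha> (?T w) x = v_pow 1 * (?T w x + ?T (?r w) x)"
      unfolding Tr[OF that] by (simp add: hC_def hRi_def algebra_simps v_pow_mult_left v_pow_mult)
    have "hR \<alpha> (hRi \<alpha> (?T w)) = ?T w" using hR_hRi assms(1) onW_bar_T that by auto
    then show "hC \<alpha> (?T (?r w)) x = v_pow (-1) * (?T w x + ?T (?r w) x)"
      unfolding Tr[OF that] by (simp add: hC_def)
  qed
  have hC_lin: "hC \<alpha> (\<lambda>u. \<Sum>w\<in>W. c w * g w u) x = (\<Sum>w\<in>W. c w * hC \<alpha> (g w) x)" for c g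
    using hlin_hR[of \<alpha>] unfolding hlin_def hC_def
    by (simp add: sum_distrib_left algebra_simps sum.distrib)
  have hCh: "hC \<alpha> h w = v_pow (-1) * h w + v_pow 1 * h (?r w)"
    "hC \<alpha> h (?r w) = v_pow (-1) * h w + v_pow 1 * h (?r w)" if "w \<in> ?U" for w
    using that by (auto simp: hC_def hR_def algebra_simps v_pow_mult_left)
  have "hecke_bar \<Delta> (hC \<alpha> h) x = (\<Sum>w\<in>W. bar (hC \<alpha> h w) * ?T w x)" by (simp add: hecke_bar_def)
  also have "\<dots> = (\<Sum>w\<in>?U. bar (hC \<alpha> h w) * ?T w x + bar (hC \<alpha> h (?r w)) * ?T (?r w) x)"
    by (rule sum_W_split[OF assms(1)])
  also have "\<dots> = (\<Sum>w\<in>?U. bar (h w) * hC \<alpha> (?T w) x + bar (h (?r w)) * hC \<alpha> (?T (?r w)) x)"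
  proof (rule sum.cong)
    fix w assume w: "w \<in> ?U"
    show "bar (hC \<alpha> h w) * ?T w x + bar (hC \<alpha> h (?r w)) * ?T (?r w) x
      = bar (h w) * hC \<alpha> (?T w) x + bar (h (?r w)) * hC \<alpha> (?T (?r w)) x"
      unfolding hCh[OF w] hCT[OF w] push_add bar_mult bar_v_pow by (simp add: algebra_simps)
  qed simp
  also have "\<dots> = (\<Sum>w\<in>W. bar (h w) * hC \<alpha> (?T w) x)" by (rule sum_W_split[OF assms(1), symmetric])
  also have "\<dots> = hC \<alpha> (hecke_bar \<Delta> h) x" unfolding hecke_bar_def by (rule hC_lin[symmetric])
  finally show "hecke_bar \<Delta> (hC \<alpha> h) x = hC \<alpha> (hecke_bar \<Delta> h) x" .
qed

end

section \<open>Kazhdan-Lusztig polynomials\<close>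

context based_root_system
begin

abbreviation kl where "kl w y \<equiv> kl_poly \<Delta> y w"
abbreviation ble where "ble \<equiv> bruhat_le \<Delta>"

definition klC :: "('a \<Rightarrow> 'a) \<Rightarrow> (('a \<Rightarrow> 'a) \<Rightarrow> int poly) \<Rightarrow> 'a hecke" where
  "klC w P = (\<lambda>y. v_pow (- int (lng w)) * poly_at_v2 (P y))"

lemma kl_family_iff:
  "kl_family \<Delta> w P \<longleftrightarrow> P w = 1 \<and> (\<forall>y. \<not> ble y w \<longrightarrow> P y = 0) \<and>
     (\<forall>y. ble y w \<and> y \<noteq> w \<longrightarrow> 2 * int (degree (P y)) \<le> int (lng w) - int (lng y) - 1) \<and>
     hecke_bar \<Delta> (klC w P) = klC w P"
  by (simp add: kl_family_def klC_def Let_def)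

lemma kl_family_coeff:
  assumes "kl_family \<Delta> w P" "coeff (P y) i \<noteq> 0" "y \<noteq> w"
  shows "ble y w" "2 * i + lng y + 1 \<le> lng w"
proof -
  show b: "ble y w" using assms unfolding kl_family_iff by (metis coeff_0)
  then have "2 * int (degree (P y)) \<le> int (lng w) - int (lng y) - 1"
    using assms unfolding kl_family_iff by blast
  then show "2 * i + lng y + 1 \<le> lng w" using le_degree[OF assms(2)] by linarith
qed

lemma lookup_klC: "lookup (klC w P y) k =
  (if even (k + int (lng w)) \<and> 0 \<le> k + int (lng w) then coeff (P y) (nat ((k + int (lng w)) div 2)) else 0)"
  by (simp add: klC_def lookup_v_pow_mult lookup_poly_at_v2)

text \<open>If \<open>y\<close> is of maximal length in the support of the difference \<open>d\<close>, bar invariance gives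
  \<open>d y = v\<^sup>-\<^sup>2\<^sup>l \<cdot> bar (d y)\<close> with \<open>l\<close> the length of \<open>y\<close>, whereas all exponents in \<open>d y\<close> are below \<open>-l\<close>.\<close>

lemma kl_family_unique:
  assumes w: "w \<in> W" and P: "kl_family \<Delta> w P" and Q: "kl_family \<Delta> w Q" shows "P = Q"
proof (rule ccontr)
  assume "P \<noteq> Q"
  define d where "d = (\<lambda>y. klC w P y - klC w Q y)"
  have supp: "P y = Q y" if "y \<notin> W" for y
    using P Q that unfolding kl_family_iff by (metis bruhat_le_in(1))
  define S where "S = {y\<in>W. P y \<noteq> Q y}"
  have "S \<noteq> {}" "finite S" using \<open>P \<noteq> Q\<close> supp unfolding S_def by auto
  then obtain y where y: "y \<in> S" and ymax: "\<And>z. z \<in> S \<Longrightarrow> lng z \<le> lng y"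
    using finite_max_ex[of S lng] by metis
  have dz: "d z = 0" if "z \<notin> S" for z
    using that supp unfolding d_def S_def klC_def by (cases "z \<in> W") auto
  have yW: "y \<in> W" and yw: "y \<noteq> w" using y P Q unfolding S_def kl_family_iff by auto
  have "hecke_bar \<Delta> d y = hecke_bar \<Delta> (klC w P) y - hecke_bar \<Delta> (klC w Q) y"
    unfolding hecke_bar_def d_def push_diff by (simp add: left_diff_distrib sum_subtractf)
  then have dbar: "d y = (\<Sum>z\<in>W. bar (d z) * bar_T \<Delta> z y)"
    using P Q unfolding kl_family_iff by (simp add: d_def hecke_bar_def[of _ "\<lambda>y. klC w P y - klC w Q y"])
  have "bar (d z) * bar_T \<Delta> z y = 0" if "z \<in> W" "z \<noteq> y" for z
  proof (cases "z \<in> S")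
    case True
    then show ?thesis using bar_T_triangular[OF that(1)] ymax that by auto
  qed (simp add: dz)
  then have "d y = (\<Sum>z\<in>W. if z = y then bar (d y) * bar_T \<Delta> y y else 0)"
    unfolding dbar by (intro sum.cong) (auto simp flip: dbar)
  then have dy: "d y = v_pow (- 2 * int (lng y)) * bar (d y)"
    using yW bar_T_triangular[OF yW] by (simp add: mult.commute)
  have low: "k < - int (lng y)" if "lookup (d y) k \<noteq> 0" for k
  proof -
    have "lookup (klC w P y) k \<noteq> 0 \<or> lookup (klC w Q y) k \<noteq> 0"
      using that unfolding d_def lookup_minus by auto
    then obtain R where R: "kl_family \<Delta> w R" "lookup (klC w R y) k \<noteq> 0" using P Q by blast
    then have "0 \<le> k + int (lng w)" "even (k + int (lng w))" "coeff (R y) (nat ((k + int (lng w)) div 2)) \<noteq> 0"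
      unfolding lookup_klC by (auto split: if_splits)
    moreover from this have "2 * int (nat ((k + int (lng w)) div 2)) = k + int (lng w)" by simp
    ultimately show ?thesis using kl_family_coeff(2)[OF R(1) _ yw, of "nat ((k + int (lng w)) div 2)"] by linarith
  qed
  have "lookup (d y) k = 0" for k
  proof (rule ccontr)
    assume k: "lookup (d y) k \<noteq> 0"
    have "lookup (d y) k = lookup (d y) (- k - 2 * int (lng y))"
      by (subst dy) (simp add: lookup_v_pow_mult lookup_bar)
    with k low[of k] low[of "- k - 2 * int (lng y)"] show False by simp
  qed
  then have dy0: "d y = 0" by (simp add: poly_mapping_eqI)
  have "coeff (P y) i = coeff (Q y) i" for i
  proof -
    have "lookup (klC w P y) (2 * int i - int (lng w)) = lookup (klC w Q y) (2 * int i - int (lng w))"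
      using dy0 unfolding d_def by simp
    then show ?thesis by (simp add: lookup_klC)
  qed
  then have "P y = Q y" by (simp add: poly_eq_iff)
  then show False using y unfolding S_def by simp
qed

lemma kl_eqI: "w \<in> W \<Longrightarrow> kl_family \<Delta> w P \<Longrightarrow> kl w y = P y"
  unfolding kl_poly_def using kl_family_unique by (metis the_equality)

lemma hecke_bar_diff_sum:
  "hecke_bar \<Delta> (\<lambda>y. f y - (\<Sum>z\<in>Z. of_int (c z) * g z y)) =
    (\<lambda>y. hecke_bar \<Delta> f y - (\<Sum>z\<in>Z. of_int (c z) * hecke_bar \<Delta> (g z) y))"
proof
  fix x
  have "bar (f y - (\<Sum>z\<in>Z. of_int (c z) * g z y)) = bar (f y) - (\<Sum>z\<in>Z. of_int (c z) * bar (g z y))" for y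
    by (simp add: push_diff push_sum push_of_int_mult)
  then have "hecke_bar \<Delta> (\<lambda>y. f y - (\<Sum>z\<in>Z. of_int (c z) * g z y)) x
    = hecke_bar \<Delta> f x - (\<Sum>w\<in>W. \<Sum>z\<in>Z. of_int (c z) * (bar (g z w) * bar_T \<Delta> w x))"
    by (simp add: hecke_bar_def left_diff_distrib sum_subtractf sum_distrib_right mult.assoc)
  also have "(\<Sum>w\<in>W. \<Sum>z\<in>Z. of_int (c z) * (bar (g z w) * bar_T \<Delta> w x))
    = (\<Sum>z\<in>Z. of_int (c z) * hecke_bar \<Delta> (g z) x)"
    unfolding hecke_bar_def by (subst sum.swap) (simp add: sum_distrib_left)
  finally show "hecke_bar \<Delta> (\<lambda>y. f y - (\<Sum>z\<in>Z. of_int (c z) * g z y)) x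
    = hecke_bar \<Delta> f x - (\<Sum>z\<in>Z. of_int (c z) * hecke_bar \<Delta> (g z) x)" .
qed

text \<open>The classical recursion: with \<open>s\<close> the reflection in the descent \<open>\<alpha>\<close> of \<open>w\<close>, subtract from the
  product of \<open>C'\<^bsub>ws\<^esub>\<close> and \<open>C'\<^sub>s\<close> those \<open>C'\<^sub>z\<close> with \<open>zs < z\<close> at which the degree bound fails.\<close>

lemma kl_step:
  assumes w: "w \<in> W" and a: "\<alpha> \<in> D w"
    and IH: "\<And>z. z \<in> W \<Longrightarrow> lng z < lng w \<Longrightarrow>
      kl_family \<Delta> z (kl z) \<and> (\<forall>\<beta>\<in>D z. \<forall>y. kl z (y \<circ> reflection \<beta>) = kl z y)"
  shows "\<exists>P. kl_family \<Delta> w P \<and> (\<forall>y. P (y \<circ> reflection \<alpha>) = P y)"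
proof -
  have aD: "\<alpha> \<in> \<Delta>" and lt: "lng (w \<circ> reflection \<alpha>) < lng w" using a by (auto simp: right_descents_def)
  define v where "v = w \<circ> reflection \<alpha>"
  have v: "v \<in> W" unfolding v_def using weyl_group_comp_reflection_iff aD w by blast
  have wv: "w = v \<circ> reflection \<alpha>" by (simp add: v_def)
  have lw: "lng w = lng v + 1" using len_simple_cases[OF w aD] lt unfolding v_def by auto
  have vw: "lng v < lng (v \<circ> reflection \<alpha>)" using lw wv by simp
  define Pv where "Pv = kl v"
  have Pv: "kl_family \<Delta> v Pv" using IH[OF v] lw unfolding Pv_def by auto
  \<comment> \<open>The coefficient polynomial at \<open>y\<close> of the product of the element for
    \<open>v\<close> with \<open>v\<^sup>-\<^sup>1 (T\<^sub>s + 1)\<close>, normalised by the length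
    of \<open>w\<close>.\<close>
  define T where "T y = (if lng (y \<circ> reflection \<alpha>) < lng y
    then Pv (y \<circ> reflection \<alpha>) + pCons 0 (Pv y) else pCons 0 (Pv (y \<circ> reflection \<alpha>)) + Pv y)" for y
  \<comment> \<open>The degree bound first fails at half the length difference, so \<mu>
    \<open>z\<close> is the coefficient to be removed. The truncated subtraction is exact on
    \<open>Z\<close>, where \<open>z\<close> is shorter than \<open>w\<close>.\<close>
  define h where "h z = (lng w - lng z) div 2" for z
  define Z where "Z = {z\<in>W. z \<noteq> w \<and> ble z w \<and> \<alpha> \<in> D z \<and> even (lng w - lng z)}"
  define \<mu> where "\<mu> z = coeff (T z) (h z)" for z
  define P where "P y = T y - (\<Sum>z\<in>Z. monom (\<mu> z) (h z) * kl z y)" for y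
  have finZ: "finite Z" unfolding Z_def by simp
  have Zl: "lng z < lng w" if "z \<in> Z" for z using that bruhat_le_len unfolding Z_def by blast
  have Zkl: "kl_family \<Delta> z (kl z)" "kl z (y \<circ> reflection \<alpha>) = kl z y" if "z \<in> Z" for z y
    using IH[of z] Zl[OF that] that unfolding Z_def by auto
  have Pv0: "Pv y = 0" if "\<not> ble y v" for y using Pv that unfolding kl_family_iff by blast
  have T_supp: "T y = 0" if "\<not> ble y w" for y
  proof -
    have "\<not> ble y v" using that bruhat_le_trans bruhat_le_comp_simple[OF v aD vw] wv by metis
    moreover have "\<not> ble (y \<circ> reflection \<alpha>) v"
      using that bruhat_lifting[OF _ aD vw, of "y \<circ> reflection \<alpha>"] wv by auto
    ultimately show ?thesis by (simp add: T_def Pv0)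
  qed
  have T_sym: "T (y \<circ> reflection \<alpha>) = T y" for y
  proof (cases "y \<in> W")
    case True
    show ?thesis by (rule len_right_cases[OF True aD]) (simp_all add: T_def add.commute)
  next
    case False
    then have "\<not> ble y w" "\<not> ble (y \<circ> reflection \<alpha>) w"
      using bruhat_le_in(1) weyl_group_comp_reflection_iff[OF aD] by blast+
    then show ?thesis using T_supp by simp
  qed
  have coeff_Pv: "2 * i + lng y \<le> lng v \<and> (y = v \<or> 2 * i + lng y + 1 \<le> lng v)" if "coeff (Pv y) i \<noteq> 0" for y i
  proof (cases "y = v")
    case True
    then show ?thesis using that Pv unfolding kl_family_iff by (auto split: if_splits)
  next
    case False
    then show ?thesis using kl_family_coeff(2)[OF Pv that] by auto
  qed
  \<comment> \<open>The bound is missed at most by one, namely by the equality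
    \<open>2 * i + lng y = lng w\<close>, and this only if \<alpha> is a descent of
    \<open>y\<close>.\<close>
  have T_coeff: "2 * i + lng y \<le> lng w \<and> (lng (y \<circ> reflection \<alpha>) < lng y \<or> 2 * i + lng y + 1 \<le> lng w)"
    if ti: "coeff (T y) i \<noteq> 0" and yW: "y \<in> W" for y i
  proof (cases "lng (y \<circ> reflection \<alpha>) < lng y")
    case True
    then have l: "lng y = lng (y \<circ> reflection \<alpha>) + 1" using len_simple_cases[OF yW aD] by auto
    have "y \<noteq> v" using True vw by auto
    consider "coeff (Pv (y \<circ> reflection \<alpha>)) i \<noteq> 0" | j where "i = Suc j" "coeff (Pv y) j \<noteq> 0"
      using ti True unfolding T_def by (cases i) (auto simp: coeff_pCons, metis add.right_neutral)
    then show ?thesis using True l lw coeff_Pv \<open>y \<noteq> v\<close> by cases fastforce+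
  next
    case False
    then have l: "lng (y \<circ> reflection \<alpha>) = lng y + 1" using len_simple_cases[OF yW aD] by auto
    have "y \<circ> reflection \<alpha> \<noteq> v" using l vw by auto
    consider "coeff (Pv y) i \<noteq> 0" | j where "i = Suc j" "coeff (Pv (y \<circ> reflection \<alpha>)) j \<noteq> 0"
      using ti False unfolding T_def by (cases i) (auto simp: coeff_pCons, metis add.right_neutral)
    then show ?thesis using l lw coeff_Pv \<open>y \<circ> reflection \<alpha> \<noteq> v\<close> by cases fastforce+
  qed
  have h2: "2 * h z + lng z = lng w" if "z \<in> Z" for z
    using Zl[OF that] that unfolding h_def Z_def by auto
  have P_coeff: "2 * i + lng y + 1 \<le> lng w" if c: "coeff (P y) i \<noteq> 0" and y: "y \<in> W" "ble y w" "y \<noteq> w" for y i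
  proof (rule ccontr)
    assume big: "\<not> 2 * i + lng y + 1 \<le> lng w"
    have ly: "lng y < lng w" using bruhat_le_len y by blast
    \<comment> \<open>Only the correction with \<open>z = y\<close> reaches the offending degree;
      the others obey their own degree bound, shifted by \<open>h z\<close>.\<close>
    have t: "coeff (monom (\<mu> z) (h z) * kl z y) i = (if z = y then coeff (T y) i else 0)" if z: "z \<in> Z" for z
    proof (cases "z = y")
      case True
      have one: "kl z y = 1" using Zkl(1)[OF z] True unfolding kl_family_iff by simp
      have i: "h y \<le> i" using h2[OF z] True big by simp
      show ?thesis
      proof (cases "i = h y")
        case True
        then show ?thesis using one \<open>z = y\<close> by (simp add: coeff_monom_mult \<mu>_def)
      next
        case False
        then have "coeff (T y) i = 0" using T_coeff[of y i] h2[OF z] \<open>z = y\<close> i y by fastforce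
        then show ?thesis using one \<open>z = y\<close> False i by (simp add: coeff_monom_mult)
      qed
    next
      case False
      have "coeff (kl z y) (i - h z) = 0" if "h z \<le> i"
        using kl_family_coeff(2)[OF Zkl(1)[OF z], of y "i - h z"] False h2[OF z] big that by force
      then show ?thesis using False by (simp add: coeff_monom_mult)
    qed
    have "coeff (P y) i = coeff (T y) i - (\<Sum>z\<in>Z. if z = y then coeff (T y) i else 0)"
      unfolding P_def by (simp add: coeff_sum t)
    also have "\<dots> = (if y \<in> Z then 0 else coeff (T y) i)" using finZ by simp
    finally have Ty: "y \<notin> Z" "coeff (T y) i \<noteq> 0" using c by (auto split: if_splits)
    then have "2 * i + lng y = lng w" "lng (y \<circ> reflection \<alpha>) < lng y" using T_coeff[OF _ y(1)] big by force+
    then have "lng w - lng y = 2 * i" "\<alpha> \<in> D y" using aD by (auto simp: right_descents_def)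
    then have "even (lng w - lng y)" "\<alpha> \<in> D y" by simp_all
    then show False using Ty y unfolding Z_def by blast
  qed
  have "P w = 1"
  proof -
    have "\<not> ble w v" using bruhat_le_len[of w v] lw by auto
    then have "T w = 1" using lt Pv Pv0[of w] unfolding T_def v_def[symmetric] kl_family_iff by simp
    moreover have "kl z w = 0" if "z \<in> Z" for z
      using Zkl(1)[OF that] Zl[OF that] bruhat_le_len[of w z] unfolding kl_family_iff by auto
    ultimately show ?thesis by (simp add: P_def)
  qed
  moreover have "P y = 0" if "\<not> ble y w" for y
  proof -
    have "kl z y = 0" if z: "z \<in> Z" for z
    proof -
      have "ble z w" using z unfolding Z_def by blast
      then have "\<not> ble y z" using \<open>\<not> ble y w\<close> bruhat_le_trans by blast
      then show ?thesis using Zkl(1)[OF z] unfolding kl_family_iff by blast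
    qed
    then show ?thesis using T_supp[OF that] by (simp add: P_def)
  qed
  moreover have "2 * int (degree (P y)) \<le> int (lng w) - int (lng y) - 1" if y: "ble y w" "y \<noteq> w" for y
  proof (cases "P y = 0")
    case True
    then show ?thesis using bruhat_le_len[OF y(1)] y(2) by auto
  next
    case False
    then show ?thesis using P_coeff[of y "degree (P y)"] bruhat_le_in(1)[OF y(1)] y by auto
  qed
  moreover have "hecke_bar \<Delta> (klC w P) = klC w P"
  proof -
    have "onW (klC v Pv)" unfolding onW_def klC_def using Pv0 bruhat_le_in(1) by fastforce
    then have 1: "hecke_bar \<Delta> (hC \<alpha> (klC v Pv)) = hC \<alpha> (klC v Pv)"
      using hecke_bar_hC[OF aD] Pv unfolding kl_family_iff by simp
    have 2: "klC w P = (\<lambda>y. hC \<alpha> (klC v Pv) y - (\<Sum>z\<in>Z. of_int (\<mu> z) * klC z (kl z) y))"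
    proof
      fix y
      have lvw: "v_pow (- int (lng w)) = v_pow (-1) * v_pow (- int (lng v))"
        by (simp add: v_pow_mult lw)
      have "hC \<alpha> (klC v Pv) y = v_pow (- int (lng w)) * poly_at_v2 (T y)"
        unfolding hC_def hR_def klC_def T_def lvw
        by (simp add: poly_at_v2_add poly_at_v2_pCons algebra_simps)
      moreover have "v_pow (- int (lng w)) * poly_at_v2 (monom (\<mu> z) (h z) * kl z y)
          = of_int (\<mu> z) * klC z (kl z) y" if "z \<in> Z" for z
      proof -
        have "- int (lng w) + 2 * int (h z) = - int (lng z)" using h2[OF that] by linarith
        then show ?thesis
          unfolding poly_at_v2_monom_mult klC_def by (metis (no_types, lifting) mult.assoc mult.left_commute v_pow_mult)
      qed
      ultimately show "klC w P y = hC \<alpha> (klC v Pv) y - (\<Sum>z\<in>Z. of_int (\<mu> z) * klC z (kl z) y)"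
        by (simp add: klC_def[of w] P_def poly_at_v2_diff poly_at_v2_sum right_diff_distrib sum_distrib_left)
    qed
    have "hecke_bar \<Delta> (klC z (kl z)) = klC z (kl z)" if "z \<in> Z" for z
      using Zkl(1)[OF that] unfolding kl_family_iff by blast
    then show ?thesis unfolding 2 hecke_bar_diff_sum 1 by simp
  qed
  ultimately have "kl_family \<Delta> w P" unfolding kl_family_iff by blast
  moreover have "P (y \<circ> reflection \<alpha>) = P y" for y by (simp add: P_def T_sym Zkl(2))
  ultimately show ?thesis by blast
qed

lemma kl_family_id: "kl_family \<Delta> id (\<lambda>y. if y = id then 1 else 0)"
proof -
  let ?P = "\<lambda>y :: 'a \<Rightarrow> 'a. if y = id then 1 else 0 :: int poly"
  have C: "klC id ?P = hb id" by (auto simp: klC_def hb_def)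
  have "hecke_bar \<Delta> (hb id) x = (\<Sum>w\<in>W. if w = id then hb id x else 0)" for x
    unfolding hecke_bar_def
    by (intro sum.cong) (auto simp: hb_def bar_T_id bar_v_pow[of 0, simplified])
  then have "hecke_bar \<Delta> (hb id) = hb id" by (intro ext) simp
  moreover have "y = id" if "ble y id" for y using bruhat_le_len[OF that] by simp
  ultimately show ?thesis unfolding kl_family_iff C by auto
qed

text \<open>The recursion at one descent yields a family invariant under that descent. By uniqueness
  all descents yield the same family, which is therefore invariant under each.\<close>

lemma kl_family_kl:
  assumes "w \<in> W"
  shows "kl_family \<Delta> w (kl w) \<and> (\<forall>\<alpha>\<in>D w. \<forall>y. kl w (y \<circ> reflection \<alpha>) = kl w y)"
  using assms
proof (induction "lng w" arbitrary: w rule: less_induct)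
  case less
  have IH: "\<And>z. z \<in> W \<Longrightarrow> lng z < lng w \<Longrightarrow>
      kl_family \<Delta> z (kl z) \<and> (\<forall>\<beta>\<in>D z. \<forall>y. kl z (y \<circ> reflection \<beta>) = kl z y)"
    using less.hyps by blast
  have "\<exists>P. kl_family \<Delta> w P"
  proof (cases "w = id")
    case True
    show ?thesis unfolding True by (rule exI[of _ "\<lambda>y. if y = id then 1 else 0"], rule kl_family_id)
  next
    case False
    then obtain \<alpha> where "\<alpha> \<in> D w" using descent_ex less.prems by blast
    from kl_step[OF less.prems this IH] show ?thesis by blast
  qed
  then obtain P where P: "kl_family \<Delta> w P" by blast
  then have "kl w = P" using kl_eqI[OF less.prems] by blast
  moreover have "kl w (y \<circ> reflection \<alpha>) = kl w y" if a: "\<alpha> \<in> D w" for \<alpha> y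
  proof -
    obtain Q where "kl_family \<Delta> w Q" "\<forall>y. Q (y \<circ> reflection \<alpha>) = Q y"
      using kl_step[OF less.prems a IH] by blast
    then show ?thesis using kl_eqI[OF less.prems] by metis
  qed
  ultimately show ?case using P by blast
qed

subsection \<open>Specialisation at \<open>q = 1\<close>\<close>

abbreviation C' where "C' \<equiv> kl_C' \<Delta>"

lemma C'_eq: "w \<in> W \<Longrightarrow> C' w y = poly (kl w y) 1"
  using kl_family_kl unfolding kl_C'_def kl_family_iff by auto

lemma C'_self: "w \<in> W \<Longrightarrow> C' w w = 1"
  using kl_family_kl by (simp add: C'_eq kl_family_iff)

lemma C'_supp: "C' w y \<noteq> 0 \<Longrightarrow> ble y w" by (auto simp: kl_C'_def split: if_splits)

lemma C'_right_invariant: "w \<in> W \<Longrightarrow> \<alpha> \<in> D w \<Longrightarrow> C' w (y \<circ> reflection \<alpha>) = C' w y"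
  using kl_family_kl by (simp add: C'_eq)

lemma C'_parabolic_invariant:
  assumes "w \<in> W" "u \<in> weyl_group (D w)" shows "C' w (y \<circ> u) = C' w y"
  using assms(2)
  by (induction rule: weyl_group_induct) (simp_all add: C'_right_invariant[OF assms(1)] flip: comp_assoc)

section \<open>Left cells and right descent sets\<close>

definition left_step :: "(('a \<Rightarrow> 'a) \<times> ('a \<Rightarrow> 'a)) set" where
  "left_step = {(x, y). x \<in> W \<and> y \<in> W \<and>
     (\<exists>\<alpha>\<in>\<Delta>. occurs_in \<Delta> x (weyl_ring_mult \<Delta> (C' (reflection \<alpha>)) (C' y)))}"

lemma left_preorder_eq: "left_preorder \<Delta> = left_step\<^sup>*"
  by (simp add: left_preorder_def left_step_def)

lemma left_step_in: "(x, y) \<in> left_step \<Longrightarrow> x \<in> W \<and> y \<in> W"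
  by (simp add: left_step_def)

lemma left_preorder_in: assumes "(x, y) \<in> left_preorder \<Delta>" "y \<in> W" shows "x \<in> W"
  using assms(1) unfolding left_preorder_eq
  by (rule converse_rtranclE) (use assms(2) left_step_in in auto)

lemma duflo_in_left_cell: assumes "w \<in> W" shows "duflo \<Delta> w \<in> left_cell \<Delta> w"
proof -
  have "left_cell \<Delta> w \<subseteq> W" unfolding left_cell_def using left_preorder_in assms by auto
  then have "finite (left_cell \<Delta> w)" by (rule finite_subset) simp
  moreover have "left_cell \<Delta> w \<noteq> {}" unfolding left_cell_def left_preorder_eq by auto
  ultimately show ?thesis unfolding duflo_def by (rule arg_min_if_finite(1))
qed

text \<open>The product of \<open>C'\<^sub>t\<close> and \<open>C'\<^sub>y\<close> is right invariant under the descents of \<open>y\<close>. Comparing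
  coefficients at \<open>zs\<close> for \<open>z\<close> of maximal length with \<open>zs > z\<close> shows that only those \<open>C'\<^sub>z\<close> occur in it
  that have the same invariance.\<close>

lemma occurs_in_descents:
  assumes y: "y \<in> W" and x: "x \<in> W" and occ: "occurs_in \<Delta> x (weyl_ring_mult \<Delta> a (C' y))"
  shows "D y \<subseteq> D x"
proof
  fix \<beta> assume b: "\<beta> \<in> D y"
  then have bD: "\<beta> \<in> \<Delta>" using descents_subset by blast
  let ?r = "reflection \<beta>"
  obtain c where c: "weyl_ring_mult \<Delta> a (C' y) = (\<lambda>u. \<Sum>z\<in>W. c z * C' z u)" "c x \<noteq> 0"
    using occ unfolding occurs_in_def by blast
  have inv: "weyl_ring_mult \<Delta> a (C' y) (u \<circ> ?r) = weyl_ring_mult \<Delta> a (C' y) u" for u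
  proof -
    have "(\<Sum>z\<in>W. if g \<circ> z = u \<circ> ?r then a g * C' y z else 0)
        = (\<Sum>z\<in>W. if g \<circ> z = u then a g * C' y z else 0)" for g
    proof -
      have "(\<Sum>z\<in>W. if g \<circ> z = u \<circ> ?r then a g * C' y z else 0)
        = (\<Sum>z\<in>W. if g \<circ> (z \<circ> ?r) = u \<circ> ?r then a g * C' y (z \<circ> ?r) else 0)"
        by (rule sum.reindex_bij_betw[OF bij_betw_comp_reflection[OF bD], symmetric])
      moreover have "g \<circ> (z \<circ> ?r) = u \<circ> ?r \<longleftrightarrow> g \<circ> z = u" for z
        by (metis comp_assoc reflection_comp_cancel)
      ultimately show ?thesis unfolding C'_right_invariant[OF y b] by simp
    qed
    then show ?thesis by (simp add: weyl_ring_mult_def)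
  qed
  show "\<beta> \<in> D x"
  proof (rule ccontr)
    assume bx: "\<beta> \<notin> D x"
    define S where "S = {z\<in>W. c z \<noteq> 0 \<and> \<beta> \<notin> D z}"
    have "S \<noteq> {}" "finite S" unfolding S_def using x c bx by auto
    then obtain z where z: "z \<in> S" and zmax: "\<And>z'. z' \<in> S \<Longrightarrow> lng z' \<le> lng z"
      using finite_max_ex[of S lng] by metis
    have zW: "z \<in> W" using z unfolding S_def by blast
    have up: "lng z < lng (z \<circ> ?r)"
      using z len_simple_iff(2)[OF zW bD] not_descent_iff[OF zW bD] unfolding S_def by blast
    have "0 = (\<Sum>z'\<in>W. c z' * (C' z' z - C' z' (z \<circ> ?r)))"
      using inv[of z] unfolding c(1) by (simp add: right_diff_distrib sum_subtractf)
    also have "\<dots> = (\<Sum>z'\<in>W. if z' = z then c z else 0)"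
    proof (rule sum.cong)
      fix z' assume z': "z' \<in> W"
      show "c z' * (C' z' z - C' z' (z \<circ> ?r)) = (if z' = z then c z else 0)"
      proof (cases "z' \<in> S")
        case True
        have "\<not> ble (z \<circ> ?r) z'" using bruhat_le_len[of "z \<circ> ?r" z'] zmax[OF True] up by auto
        moreover have "z' = z \<or> \<not> ble z z'" using bruhat_le_len[of z z'] zmax[OF True] by auto
        ultimately have "C' z' (z \<circ> ?r) = 0" "z' = z \<or> C' z' z = 0" using C'_supp by blast+
        then show ?thesis using C'_self[OF zW] by auto
      next
        case False
        then show ?thesis using z z' C'_right_invariant[OF z'] unfolding S_def by auto
      qed
    qed simp
    also have "\<dots> = c z" using zW by simp
    finally show False using z unfolding S_def by simp
  qed
qed

lemma left_preorder_descents: "(x, y) \<in> left_preorder \<Delta> \<Longrightarrow> D y \<subseteq> D x"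
  unfolding left_preorder_eq
proof (induction rule: rtrancl_induct)
  case (step y z)
  then have "D z \<subseteq> D y" unfolding left_step_def using occurs_in_descents by blast
  with step show ?case by blast
qed simp

lemma duflo_props:
  assumes "w \<in> W" shows "duflo \<Delta> w \<in> W" "D (duflo \<Delta> w) = D w"
proof -
  have d: "(duflo \<Delta> w, w) \<in> left_preorder \<Delta>" "(w, duflo \<Delta> w) \<in> left_preorder \<Delta>"
    using duflo_in_left_cell[OF assms] unfolding left_cell_def by auto
  then show "D (duflo \<Delta> w) = D w" using left_preorder_descents by blast
  show "duflo \<Delta> w \<in> W" using left_preorder_in[OF d(1) assms] .
qed

end

section \<open>Alternating sums and Weyl characters\<close>

lemma lookup_gexp_mult: "lookup (gexp a * f) k = lookup f (k - a)"
  for a :: "'a::euclidean_space"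
  unfolding gexp_def by (rule lookup_single_mult)

lemma push_gexp: "push g (gexp k) = gexp (g k)"
  by (simp add: gexp_def push_single)

lemma gexp_mult: "gexp a * gexp b = gexp (a + b)"
  by (simp add: gexp_def mult_single)

lemma gexp_0: "gexp 0 = 1" by (simp add: gexp_def)

lemma keys_gexp [simp]: "keys (gexp k) = {k}"
  by (simp add: gexp_def)

lemma gexp_expansion: "f = (\<Sum>k\<in>keys f. of_int (lookup f k) * gexp k)"
proof (rule poly_mapping_eqI)
  fix x
  have "lookup (\<Sum>k\<in>keys f. of_int (lookup f k) * gexp k) x
    = (\<Sum>k\<in>keys f. if k = x then lookup f x else 0)"
    unfolding lookup_sum
    by (intro sum.cong) (auto simp: lookup_of_int_mult gexp_def lookup_single when_def)
  then show "lookup f x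
    = lookup (\<Sum>k\<in>keys f. of_int (lookup f k) * gexp k) x"
    by (auto simp: in_keys_iff)
qed

lemma keys_of_int_mult:
  fixes f :: "'k::monoid_add \<Rightarrow>\<^sub>0 int"
  shows "keys (of_int c * f) \<subseteq> keys f"
  by (auto simp: in_keys_iff lookup_of_int_mult)

lemma of_int_mult_cancel:
  fixes f :: "'k::monoid_add \<Rightarrow>\<^sub>0 int"
  assumes "of_int c * f = of_int c * g" "c \<noteq> 0" shows "f = g"
proof (rule poly_mapping_eqI)
  fix k
  have "c * lookup f k = c * lookup g k"
    using assms(1) by (metis lookup_of_int_mult)
  with assms(2) show "lookup f k = lookup g k" by simp
qed

context based_root_system
begin

abbreviation \<delta> where "\<delta> \<equiv> weyl_denominator \<Delta>"
abbreviation J where "J \<equiv> antisymm \<Delta>"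
abbreviation P where "P \<equiv> weights \<Phi>"

definition winv :: "'a grp_ring \<Rightarrow> bool" where "winv f \<longleftrightarrow> (\<forall>y\<in>W. push y f = f)"

lemma ZT_iff: "f \<in> ZT \<Phi> \<longleftrightarrow> keys f \<subseteq> P" by (simp add: ZT_def)

lemma ZT_0 [simp]: "0 \<in> ZT \<Phi>" by (simp add: ZT_iff)

lemma ZT_gexp: "k \<in> P \<Longrightarrow> gexp k \<in> ZT \<Phi>" by (simp add: ZT_iff)

lemma ZT_add: "f \<in> ZT \<Phi> \<Longrightarrow> g \<in> ZT \<Phi> \<Longrightarrow> f + g \<in> ZT \<Phi>"
  unfolding ZT_iff using Poly_Mapping.keys_add[of f g] by blast

lemma ZT_diff: "f \<in> ZT \<Phi> \<Longrightarrow> g \<in> ZT \<Phi> \<Longrightarrow> f - g \<in> ZT \<Phi>"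
  unfolding ZT_iff using keys_diff[of f g] by blast

lemma ZT_sum: "(\<And>i. i \<in> A \<Longrightarrow> f i \<in> ZT \<Phi>) \<Longrightarrow> sum f A \<in> ZT \<Phi>"
  by (induction A rule: infinite_finite_induct) (auto intro: ZT_add)

lemma ZT_of_int_mult: "f \<in> ZT \<Phi> \<Longrightarrow> of_int c * f \<in> ZT \<Phi>"
  unfolding ZT_iff using keys_of_int_mult[of c f] by blast

lemma ZT_mult: "f \<in> ZT \<Phi> \<Longrightarrow> g \<in> ZT \<Phi> \<Longrightarrow> f * g \<in> ZT \<Phi>"
  unfolding ZT_iff using keys_mult[of f g] weights_add by blast

lemma weyl_add: "y \<in> W \<Longrightarrow> y (a + b) = y a + y b"
  by (simp add: linear_add[OF weyl_group_linear])

lemma weyl_0: "y \<in> W \<Longrightarrow> y 0 = 0"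
  by (simp add: linear_0[OF weyl_group_linear])

lemma push_weyl_mult: "y \<in> W \<Longrightarrow> push y (f * g) = push y f * push y g"
  by (rule push_mult) (rule weyl_add)

lemma push_weyl_of_int_mult: "y \<in> W \<Longrightarrow> push y (of_int c * f) = of_int c * push y f"
  by (rule push_of_int_mult) (rule weyl_add weyl_0; assumption)+

lemma winv_mult: "winv f \<Longrightarrow> winv g \<Longrightarrow> winv (f * g)"
  by (simp add: winv_def push_weyl_mult)

lemma winv_add: "winv f \<Longrightarrow> winv g \<Longrightarrow> winv (f + g)"
  by (simp add: winv_def push_add)

lemma winv_of_int: "winv (of_int c)"
  unfolding winv_def using push_of_int weyl_0 by blast

lemma J_diff: "J (f - g) = J f - J g"
  by (simp add: antisymm_def push_diff right_diff_distrib sum_subtractf)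

lemma J_sum: "J (sum f A) = (\<Sum>a\<in>A. J (f a))"
  unfolding antisymm_def by (simp add: push_sum sum_distrib_left sum.swap[of _ A])

lemma J_mult_winv: "winv r \<Longrightarrow> J (r * f) = r * J f"
  by (simp add: antisymm_def push_weyl_mult winv_def sum_distrib_left mult.left_commute)

lemma J_of_int_mult: "J (of_int c * f) = of_int c * J f"
  by (rule J_mult_winv[OF winv_of_int])

lemma J_push: assumes "x \<in> W" shows "J (push x f) = of_int (sg x) * J f"
proof -
  have "of_int (sg x) * J f = (\<Sum>y\<in>W. of_int (sg x) * (of_int (sg y) * push y f))"
    by (simp add: antisymm_def sum_distrib_left)
  also have "\<dots> = (\<Sum>y\<in>W. of_int (sg x) * (of_int (sg (y \<circ> x)) * push (y \<circ> x) f))"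
    by (rule sum.reindex_bij_betw[OF bij_betw_comp_right[OF assms], symmetric])
  also have "\<dots> = (\<Sum>y\<in>W. of_int (sg y) * push y (push x f))"
  proof (rule sum.cong)
    fix y assume "y \<in> W"
    then have "sg x * sg (y \<circ> x) = sg y"
      using sgn_comp assms by (simp add: mult.commute mult.left_commute)
    then have "of_int (sg x) * (of_int (sg (y \<circ> x)) :: 'a grp_ring) = of_int (sg y)"
      by (metis of_int_mult)
    then show "of_int (sg x) * (of_int (sg (y \<circ> x)) * push (y \<circ> x) f) = of_int (sg y) * push y (push x f)"
      by (simp add: push_comp flip: mult.assoc)
  qed simp
  finally show ?thesis by (simp add: antisymm_def)
qed

lemma push_J: assumes "x \<in> W" shows "push x (J f) = of_int (sg x) * J f"
proof -
  have "push x (J f) = (\<Sum>y\<in>W. of_int (sg y) * push (x \<circ> y) f)"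
    using assms by (simp add: antisymm_def push_sum push_weyl_of_int_mult push_comp)
  also have "\<dots> = (\<Sum>y\<in>W. of_int (sg x) * (of_int (sg (x \<circ> y)) * push (x \<circ> y) f))"
  proof (rule sum.cong)
    fix y assume "y \<in> W"
    then have "sg x * sg (x \<circ> y) = sg y"
      using sgn_comp assms by (simp flip: mult.assoc)
    then have "of_int (sg x) * (of_int (sg (x \<circ> y)) :: 'a grp_ring) = of_int (sg y)"
      by (metis of_int_mult)
    then show "of_int (sg y) * push (x \<circ> y) f = of_int (sg x) * (of_int (sg (x \<circ> y)) * push (x \<circ> y) f)"
      by (simp flip: mult.assoc)
  qed simp
  also have "\<dots> = (\<Sum>y\<in>W. of_int (sg x) * (of_int (sg y) * push y f))"
    by (rule sum.reindex_bij_betw[OF bij_betw_comp_left[OF assms]])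
  finally show ?thesis by (simp add: antisymm_def sum_distrib_left)
qed

text \<open>Compare leading terms for the pairing with \<rho>: at \<rho> plus a highest exponent of
  the difference only the term \<open>y = id\<close> of \<delta> contributes, every other
  \<open>y \<rho>\<close> being strictly lower. Quotients by \<delta> are thereby unique.\<close>

lemma denominator_cancel: assumes "\<delta> * f = \<delta> * g" shows "f = g"
proof (rule ccontr)
  assume "f \<noteq> g"
  define h where "h = f - g"
  have "h \<noteq> 0" "\<delta> * h = 0" using \<open>f \<noteq> g\<close> assms by (auto simp: h_def right_diff_distrib)
  then have "keys h \<noteq> {}" by simp
  then obtain k where k: "k \<in> keys h"
    and kmax: "\<And>j. j \<in> keys h \<Longrightarrow> \<rho> \<bullet> j \<le> \<rho> \<bullet> k"
    using finite_max_ex[OF finite_keys, of h "\<lambda>k. \<rho> \<bullet> k"] by metis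
  have "0 = lookup (\<delta> * h) (\<rho> + k)" using \<open>\<delta> * h = 0\<close> by simp
  also have "\<dots> = (\<Sum>y\<in>W. sg y * lookup h (\<rho> + k - y \<rho>))"
    by (simp add: weyl_denominator_def antisymm_def push_gexp sum_distrib_right lookup_sum mult.assoc
        lookup_of_int_mult lookup_gexp_mult)
  also have "\<dots> = (\<Sum>y\<in>W. if y = id then lookup h k else 0)"
  proof (rule sum.cong)
    fix y assume y: "y \<in> W"
    show "sg y * lookup h (\<rho> + k - y \<rho>) = (if y = id then lookup h k else 0)"
    proof (cases "y = id")
      case False
      have le: "dom_le (y \<rho>) \<rho>" using weyl_le_dominant[OF y dominant_varpi] by simp
      have "\<rho> \<bullet> y \<rho> \<noteq> \<rho> \<bullet> \<rho>" using dom_le_rho_inner_eq[OF le] weyl_rho_eq[OF y] False by auto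
      then have "\<rho> \<bullet> k < \<rho> \<bullet> (\<rho> + k - y \<rho>)" using dom_le_rho_inner[OF le] by (simp add: inner_simps)
      then have "\<rho> + k - y \<rho> \<notin> keys h" using kmax by fastforce
      then show ?thesis using False by (simp add: in_keys_iff)
    qed (simp add: id_apply)
  qed simp
  also have "\<dots> = lookup h k" by simp
  finally show False using k by (simp add: in_keys_iff)
qed

text \<open>Pairing with the sum of the positive coroots, twice the height on roots. It takes
  natural values on dominant weights, so inductions can run on it.\<close>

definition hgt :: "'a \<Rightarrow> real" where "hgt x = (\<Sum>\<gamma>\<in>pos. 2 * (x \<bullet> \<gamma>) / (\<gamma> \<bullet> \<gamma>))"

text \<open>The reflection in \<alpha> permutes the other positive coroots, so their sum is
  orthogonal to \<alpha> and only the coroot of \<alpha> contributes.\<close>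

lemma hgt_simple: assumes "\<alpha> \<in> \<Delta>" shows "hgt \<alpha> = 2"
proof -
  define s where "s = (\<Sum>\<gamma>\<in>pos - {\<alpha>}. (2 / (\<gamma> \<bullet> \<gamma>)) *\<^sub>R \<gamma>)"
  note bij_betw_reflection_pos[OF assms]
  then have "s = (\<Sum>\<gamma>\<in>pos - {\<alpha>}. (2 / (reflection \<alpha> \<gamma> \<bullet> reflection \<alpha> \<gamma>)) *\<^sub>R reflection \<alpha> \<gamma>)"
    unfolding s_def by (rule sum.reindex_bij_betw[symmetric])
  also have "\<dots> = reflection \<alpha> s"
    unfolding s_def linear_sum[OF linear_reflection] linear_cmul[OF linear_reflection] inner_reflection ..
  finally have "s \<bullet> \<alpha> = 0" using reflection_eq_self_iff simple_nonzero assms by metis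
  then have "\<alpha> \<bullet> s = 0" by (simp add: inner_commute)
  then have "(\<Sum>\<gamma>\<in>pos - {\<alpha>}. 2 * (\<alpha> \<bullet> \<gamma>) / (\<gamma> \<bullet> \<gamma>)) = 0" by (simp add: s_def inner_sum_right)
  moreover have "hgt \<alpha> = 2 * (\<alpha> \<bullet> \<alpha>) / (\<alpha> \<bullet> \<alpha>) + (\<Sum>\<gamma>\<in>pos - {\<alpha>}. 2 * (\<alpha> \<bullet> \<gamma>) / (\<gamma> \<bullet> \<gamma>))"
    unfolding hgt_def by (rule sum.remove) (use simple_pos assms in auto)
  ultimately show ?thesis using simple_inner_pos[OF assms] by simp
qed

lemma hgt_less: assumes "dom_le x y" "x \<noteq> y" shows "hgt x < hgt y"
proof -
  have lin: "linear hgt"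
    by (rule linearI) (simp_all add: hgt_def inner_simps distrib_left add_divide_distrib sum.distrib
        sum_distrib_left mult.left_commute)
  define c where "c \<alpha> = 2 * ((y - x) \<bullet> fw \<alpha>) / (\<alpha> \<bullet> \<alpha>)" for \<alpha>
  have "hgt (y - x) = hgt (\<Sum>\<alpha>\<in>\<Delta>. c \<alpha> *\<^sub>R \<alpha>)"
    unfolding c_def by (rule arg_cong[OF simple_expansion])
  then have e: "hgt y - hgt x = (\<Sum>\<alpha>\<in>\<Delta>. 2 * c \<alpha>)"
    by (simp add: linear_sum[OF lin] linear_cmul[OF lin] linear_diff[OF lin] hgt_simple mult.commute)
  have c0: "0 \<le> c \<alpha>" if "\<alpha> \<in> \<Delta>" for \<alpha>
    using assms(1) that by (simp add: c_def dom_le_def inner_diff_left)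
  have "\<exists>\<alpha>\<in>\<Delta>. c \<alpha> \<noteq> 0"
  proof (rule ccontr)
    assume "\<not> ?thesis"
    then have "x = y" using simple_inner_pos by (intro eqI_fw) (fastforce simp: c_def inner_diff_left)
    with assms(2) show False by simp
  qed
  then obtain \<alpha> where "\<alpha> \<in> \<Delta>" "c \<alpha> \<noteq> 0" by blast
  then have "(\<Sum>\<alpha>\<in>\<Delta>. 2 * c \<alpha>) > 0" using c0 by (intro sum_pos2[of \<Delta> \<alpha>]) (auto simp: less_le)
  with e show ?thesis by simp
qed

lemma hgt_nat: assumes "x \<in> P" "dominant x" shows "\<exists>n :: nat. hgt x = real n"
proof -
  have "hgt x \<in> \<int>" unfolding hgt_def using assms(1) pos_root by (intro Ints_sum) (auto simp: weights_def)
  moreover have "0 \<le> hgt x"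
    unfolding hgt_def using dominant_inner_pos[OF assms(2)] by (intro sum_nonneg divide_nonneg_nonneg) auto
  ultimately show ?thesis by (metis Ints_cases of_int_0_le_iff of_int_of_nat_eq nonneg_int_cases)
qed

lemma hgt_measure:
  assumes "x \<in> P" "dominant x" "y \<in> P" "dominant y" "dom_le x y" "x \<noteq> y"
  shows "nat \<lfloor>hgt x\<rfloor> < nat \<lfloor>hgt y\<rfloor>"
  using hgt_nat[OF assms(1,2)] hgt_nat[OF assms(3,4)] hgt_less[OF assms(5,6)] by auto

section \<open>Orbit sums and existence of Weyl characters\<close>

definition orb :: "'a \<Rightarrow> 'a set" where "orb x = (\<lambda>y. y x) ` W"

lemma finite_orb [simp]: "finite (orb x)" by (simp add: orb_def)

lemma self_in_orb: "x \<in> orb x" unfolding orb_def using weyl_group_id by (metis id_apply image_eqI)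

lemma weyl_in_orb: "y \<in> W \<Longrightarrow> y x \<in> orb x" by (simp add: orb_def)

lemma orb_weights: "x \<in> P \<Longrightarrow> orb x \<subseteq> P" unfolding orb_def using weights_weyl by blast

lemma orb_whull: "dominant x \<Longrightarrow> orb x \<subseteq> whull x"
  unfolding orb_def using whull_weyl dominant_in_whull by blast

lemma orb_dom_le: "dominant x \<Longrightarrow> z \<in> orb x \<Longrightarrow> y \<in> W \<Longrightarrow> dom_le (y z) x"
  using orb_whull by (fastforce simp: whull_def)

definition orbsum :: "'a \<Rightarrow> 'a grp_ring" where "orbsum x = (\<Sum>z\<in>orb x. gexp z)"

lemma winv_orbsum: "winv (orbsum x)"
  unfolding winv_def
proof
  fix y assume y: "y \<in> W"
  have im: "v z \<in> orb x" if "z \<in> orb x" "v \<in> W" for z v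
  proof -
    obtain u where "u \<in> W" "z = u x" using \<open>z \<in> orb x\<close> by (auto simp: orb_def)
    then show ?thesis using weyl_in_orb[OF weyl_group_comp[OF that(2)], of u x] by (simp add: comp_apply)
  qed
  have "bij_betw y (orb x) (orb x)"
    by (rule bij_betw_byWitness[where f' = "inv y"]) (use im y weyl_group_inv in auto)
  then show "push y (orbsum x) = orbsum x"
    unfolding orbsum_def push_sum push_gexp by (rule sum.reindex_bij_betw)
qed

lemma keys_orbsum: "keys (orbsum x) \<subseteq> orb x"
  unfolding orbsum_def using keys_sum[of gexp "orb x"] by auto

text \<open>An odd element fixes \<open>x\<close>, so the alternating sum is its own negative, and
  the group ring has no torsion.\<close>

lemma J_singular:
  assumes "\<alpha> \<in> \<Delta>" "x \<bullet> \<alpha> = 0" shows "J (gexp x) = 0"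
proof -
  have r: "reflection \<alpha> \<in> W" using reflection_in_weyl_group assms by blast
  have "reflection \<alpha> x = x" using assms simple_nonzero by (simp add: reflection_eq_self_iff)
  moreover have "sg (reflection \<alpha>) = - 1" using sgn_comp_simple[OF weyl_group_id assms(1)] by simp
  ultimately have "J (gexp x) = - J (gexp x)" using J_push[OF r, of "gexp x"] by (simp add: push_gexp)
  then have "of_int 2 * J (gexp x) = of_int 2 * 0" by (simp add: algebra_simps eq_neg_iff_add_eq_0)
  then show ?thesis by (rule of_int_mult_cancel) simp
qed

text \<open>The dominant conjugate of \<open>k\<close> either lies on a wall, where the sum
  vanishes, or has all simple coroot pairings at least 1, so that \<rho> can be subtracted.\<close>

lemma J_gexp_cases:
  assumes "k \<in> P"
  obtains "J (gexp k) = 0"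
  | y \<zeta> where "y \<in> W" "\<zeta> \<in> P" "dominant \<zeta>" "y k = \<zeta> + \<rho>"
      "J (gexp k) = of_int (sg y) * J (gexp (\<zeta> + \<rho>))"
proof -
  obtain y where y: "y \<in> W" "dominant (y k)" by (rule dominant_rep)
  have yP: "y k \<in> P" using weights_weyl assms y by blast
  have "of_int (sg y) * J (gexp (y k)) = of_int (sg y) * (of_int (sg y) * J (gexp k))"
    using J_push[OF y(1), of "gexp k"] by (simp add: push_gexp)
  also have "\<dots> = of_int (sg y * sg y) * J (gexp k)" by (simp only: of_int_mult mult.assoc)
  finally have e: "J (gexp k) = of_int (sg y) * J (gexp (y k))" by simp
  show thesis
  proof (cases "\<exists>\<alpha>\<in>\<Delta>. y k \<bullet> \<alpha> = 0")
    case True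
    then have "J (gexp k) = 0" using J_singular e by force
    then show thesis by (rule that(1))
  next
    case False
    have "dominant (y k - \<rho>)" using sub_varpi_dominant[OF yP y(2)] False by blast
    then show thesis using that(2)[of y "y k - \<rho>"] y yP e weights_diff rho_weight by simp
  qed
qed

text \<open>Induction on the height of \<open>\<zeta>\<close>: in \<open>orbsum \<zeta> * \<delta>\<close>, the alternating sum of \<open>\<zeta> + \<rho>\<close> occurs once
  and all others belong to weights \<open>\<zeta>' + \<rho>\<close> with \<open>\<zeta>' < \<zeta>\<close>.\<close>

lemma weyl_char_ex:
  assumes "\<zeta> \<in> P" "dominant \<zeta>"
  shows "\<exists>h. \<delta> * h = J (gexp (\<zeta> + \<rho>)) \<and> keys h \<subseteq> P \<inter> whull \<zeta>"
  using assms
proof (induction "nat \<lfloor>hgt \<zeta>\<rfloor>" arbitrary: \<zeta> rule: less_induct)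
  case (less \<zeta>)
  have "\<exists>h. \<delta> * h = J (gexp (x + \<rho>)) \<and> keys h \<subseteq> P \<inter> whull \<zeta>"
    if x: "x \<in> orb \<zeta> - {\<zeta>}" for x
  proof -
    have xP: "x + \<rho> \<in> P" using x orb_weights less.prems rho_weight weights_add by blast
    show ?thesis
    proof (rule J_gexp_cases[OF xP])
      assume "J (gexp (x + \<rho>)) = 0"
      then show ?thesis by (intro exI[of _ 0]) simp
    next
      fix y \<zeta>' assume y: "y \<in> W" "\<zeta>' \<in> P" "dominant \<zeta>'" "y (x + \<rho>) = \<zeta>' + \<rho>"
        "J (gexp (x + \<rho>)) = of_int (sg y) * J (gexp (\<zeta>' + \<rho>))"
      have yx: "dom_le (y x) \<zeta>" using orb_dom_le less.prems(2) x y(1) by blast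
      have yr: "dom_le (y \<rho>) \<rho>" using weyl_le_dominant[OF y(1) dominant_varpi] by simp
      have e: "y x + y \<rho> = \<zeta>' + \<rho>" using y(1,4) by (simp add: weyl_add)
      have "dom_le (\<zeta>' + \<rho>) (\<zeta> + \<rho>)" using dom_le_add[OF yx yr] e by simp
      then have le: "dom_le \<zeta>' \<zeta>" by (simp add: dom_le_diff_cancel)
      have "\<zeta>' \<noteq> \<zeta>"
      proof
        assume "\<zeta>' = \<zeta>"
        then have "\<rho> \<bullet> y x + \<rho> \<bullet> y \<rho> = \<rho> \<bullet> \<zeta> + \<rho> \<bullet> \<rho>" using e by (metis inner_add_right)
        then have "\<rho> \<bullet> y x = \<rho> \<bullet> \<zeta>" "\<rho> \<bullet> y \<rho> = \<rho> \<bullet> \<rho>"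
          using dom_le_rho_inner[OF yx] dom_le_rho_inner[OF yr] by auto
        then have "y x = \<zeta>" "y \<rho> = \<rho>" using dom_le_rho_inner_eq yx yr by blast+
        then show False using weyl_rho_eq[OF y(1)] x by (auto simp: id_apply)
      qed
      then have "nat \<lfloor>hgt \<zeta>'\<rfloor> < nat \<lfloor>hgt \<zeta>\<rfloor>" using hgt_measure y less.prems le by blast
      from less.hyps[OF this y(2,3)] obtain h where
        h: "\<delta> * h = J (gexp (\<zeta>' + \<rho>))" "keys h \<subseteq> P \<inter> whull \<zeta>'" by blast
      have "\<delta> * (of_int (sg y) * h) = J (gexp (x + \<rho>))" by (simp only: y(5) h(1)[symmetric] mult.left_commute[of \<delta>])
      moreover have "keys (of_int (sg y) * h) \<subseteq> P \<inter> whull \<zeta>"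
        using keys_of_int_mult[of "sg y" h] h(2) whull_mono[OF _ le] by blast
      ultimately show ?thesis by blast
    qed
  qed
  then obtain h where h: "\<And>x. x \<in> orb \<zeta> - {\<zeta>} \<Longrightarrow>
      \<delta> * h x = J (gexp (x + \<rho>)) \<and> keys (h x) \<subseteq> P \<inter> whull \<zeta>" by metis
  have "\<delta> * orbsum \<zeta> = J (orbsum \<zeta> * gexp \<rho>)"
    by (simp add: J_mult_winv[OF winv_orbsum] weyl_denominator_def mult.commute)
  also have "\<dots> = (\<Sum>x\<in>orb \<zeta>. J (gexp (x + \<rho>)))"
    by (simp add: orbsum_def sum_distrib_right gexp_mult J_sum)
  also have "\<dots> = J (gexp (\<zeta> + \<rho>)) + (\<Sum>x\<in>orb \<zeta> - {\<zeta>}. J (gexp (x + \<rho>)))"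
    by (rule sum.remove) (simp_all add: self_in_orb)
  also have "(\<Sum>x\<in>orb \<zeta> - {\<zeta>}. J (gexp (x + \<rho>))) = \<delta> * (\<Sum>x\<in>orb \<zeta> - {\<zeta>}. h x)"
    unfolding sum_distrib_left by (rule sum.cong) (use h in auto)
  finally have "\<delta> * (orbsum \<zeta> - (\<Sum>x\<in>orb \<zeta> - {\<zeta>}. h x)) = J (gexp (\<zeta> + \<rho>))"
    by (simp add: right_diff_distrib)
  moreover have "keys (orbsum \<zeta> - (\<Sum>x\<in>orb \<zeta> - {\<zeta>}. h x)) \<subseteq> P \<inter> whull \<zeta>"
  proof -
    have "keys (orbsum \<zeta>) \<subseteq> P \<inter> whull \<zeta>"
      using keys_orbsum orb_weights orb_whull less.prems by blast
    moreover have "keys (\<Sum>x\<in>orb \<zeta> - {\<zeta>}. h x) \<subseteq> P \<inter> whull \<zeta>"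
    proof
      fix k assume "k \<in> keys (\<Sum>x\<in>orb \<zeta> - {\<zeta>}. h x)"
      then obtain x where "x \<in> orb \<zeta> - {\<zeta>}" "k \<in> keys (h x)"
        using keys_sum[of h "orb \<zeta> - {\<zeta>}"] by auto
      then show "k \<in> P \<inter> whull \<zeta>" using h by auto
    qed
    ultimately show ?thesis using keys_diff[of "orbsum \<zeta>"] by blast
  qed
  ultimately show ?case by blast
qed

text \<open>The alternating sum divided by the Weyl denominator. The pairing and the Weyl characters
  are both values of \<open>E\<close>; on Z[T] the quotient exists by
  \<open>E_expansion\<close>.\<close>

definition E :: "'a grp_ring \<Rightarrow> 'a grp_ring" where "E F = (THE h. \<delta> * h = J F)"

lemma E_eqI: "\<delta> * h = J F \<Longrightarrow> E F = h"
  unfolding E_def using denominator_cancel by (metis (mono_tags, lifting) the_equality)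

lemma ZT_pairing_eq: "ZT_pairing \<Delta> f g = E (f * g)"
  by (simp add: ZT_pairing_def E_def)

lemma weyl_char_eq: "weyl_char \<Delta> \<nu> = E (gexp (\<nu> + \<rho>))"
  by (simp add: weyl_char_def E_def)

lemma E_gexp_cases:
  assumes "k \<in> P"
  obtains "\<delta> * E (gexp k) = J (gexp k)" "E (gexp k) = 0"
  | y \<zeta> where "\<delta> * E (gexp k) = J (gexp k)" "y \<in> W" "\<zeta> \<in> P" "dominant \<zeta>" "y k = \<zeta> + \<rho>"
      "E (gexp k) = of_int (sg y) * weyl_char \<Delta> \<zeta>" "keys (E (gexp k)) \<subseteq> P \<inter> whull \<zeta>"
proof (rule J_gexp_cases[OF assms])
  assume z: "J (gexp k) = 0"
  then have "E (gexp k) = 0" by (intro E_eqI) simp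
  then show thesis using that(1) z by simp
next
  fix y \<zeta> assume y: "y \<in> W" "\<zeta> \<in> P" "dominant \<zeta>" "y k = \<zeta> + \<rho>"
    "J (gexp k) = of_int (sg y) * J (gexp (\<zeta> + \<rho>))"
  from weyl_char_ex[OF y(2,3)] obtain h where
    h: "\<delta> * h = J (gexp (\<zeta> + \<rho>))" "keys h \<subseteq> P \<inter> whull \<zeta>" by blast
  have 1: "weyl_char \<Delta> \<zeta> = h" unfolding weyl_char_eq by (rule E_eqI[OF h(1)])
  have 2: "\<delta> * (of_int (sg y) * h) = J (gexp k)" by (simp only: y(5) h(1)[symmetric] mult.left_commute[of \<delta>])
  then have 3: "E (gexp k) = of_int (sg y) * h" by (rule E_eqI)
  have "keys (E (gexp k)) \<subseteq> P \<inter> whull \<zeta>"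
    unfolding 3 using keys_of_int_mult[of "sg y" h] h(2) by blast
  then show thesis using that(2)[OF _ y(1-4)] 1 2 3 by simp
qed

lemma E_expansion:
  assumes "F \<in> ZT \<Phi>"
  shows "\<delta> * E F = J F" "E F = (\<Sum>k\<in>keys F. of_int (lookup F k) * E (gexp k))"
proof -
  let ?h = "\<Sum>k\<in>keys F. of_int (lookup F k) * E (gexp k)"
  have "\<delta> * E (gexp k) = J (gexp k)" if "k \<in> keys F" for k
    using E_gexp_cases[of k] assms that unfolding ZT_iff by blast
  then have "\<delta> * ?h = (\<Sum>k\<in>keys F. of_int (lookup F k) * J (gexp k))"
    unfolding sum_distrib_left mult.left_commute[of \<delta>] by simp
  also have "\<dots> = J F"
    by (subst (3) gexp_expansion[of F]) (simp only: J_sum J_of_int_mult)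
  finally have "\<delta> * ?h = J F" .
  then show "E F = ?h" by (rule E_eqI)
  with \<open>\<delta> * ?h = J F\<close> show "\<delta> * E F = J F" by simp
qed

lemma E_winv: assumes "F \<in> ZT \<Phi>" shows "winv (E F)"
  unfolding winv_def
proof
  fix y assume y: "y \<in> W"
  have "of_int (sg y) * (\<delta> * push y (E F)) = push y \<delta> * push y (E F)"
    using push_J[OF y, of "gexp \<rho>"] by (simp add: weyl_denominator_def mult.assoc)
  also have "\<dots> = push y (J F)" using push_weyl_mult[OF y] E_expansion(1)[OF assms] by metis
  also have "\<dots> = of_int (sg y) * (\<delta> * E F)" using push_J[OF y] E_expansion(1)[OF assms] by simp
  finally have "\<delta> * push y (E F) = \<delta> * E F"
    by (rule of_int_mult_cancel) (simp add: weyl_sgn_def)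
  then show "push y (E F) = E F" by (rule denominator_cancel)
qed

lemma E_mult_winv: "F \<in> ZT \<Phi> \<Longrightarrow> winv r \<Longrightarrow> E (r * F) = r * E F"
  using E_expansion(1)[of F] by (intro E_eqI) (simp add: J_mult_winv mult.left_commute)

lemma E_of_int_mult: "F \<in> ZT \<Phi> \<Longrightarrow> E (of_int c * F) = of_int c * E F"
  by (rule E_mult_winv[OF _ winv_of_int])

lemma E_diff: "F \<in> ZT \<Phi> \<Longrightarrow> G \<in> ZT \<Phi> \<Longrightarrow> E (F - G) = E F - E G"
  using E_expansion(1)[of F] E_expansion(1)[of G] by (intro E_eqI) (simp add: J_diff right_diff_distrib)

lemma E_sum: "(\<And>a. a \<in> A \<Longrightarrow> F a \<in> ZT \<Phi>) \<Longrightarrow> E (sum F A) = (\<Sum>a\<in>A. E (F a))"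
  using E_expansion(1) by (intro E_eqI) (simp add: J_sum sum_distrib_left)

text \<open>A weight \<open>k\<close> contributes 0 or a signed character of highest weight \<zeta>
  with \<zeta> + \<rho> conjugate to \<open>k\<close>; hence \<zeta> lies below \<open>b\<close>,
  and being dominant it lies above 0. The lemma will be applied to differences
  \<open>b = wI v - wI w\<close>, which may fail to be dominant.\<close>

lemma E_keys:
  assumes "keys F \<subseteq> P \<inter> whull (b + \<rho>)"
  shows "keys (E F) \<subseteq> P \<inter> whull b" and "E F \<noteq> 0 \<Longrightarrow> dom_le 0 b"
proof -
  have F: "F \<in> ZT \<Phi>" using assms unfolding ZT_iff by blast
  have *: "E (gexp k) = 0 \<or> keys (E (gexp k)) \<subseteq> P \<inter> whull b \<and> dom_le 0 b"
    if k: "k \<in> keys F" for k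
  proof -
    have "k \<in> P" "k \<in> whull (b + \<rho>)" using k assms by auto
    show ?thesis
    proof (rule E_gexp_cases[OF \<open>k \<in> P\<close>])
      fix y \<zeta> assume y: "y \<in> W" "\<zeta> \<in> P" "dominant \<zeta>" "y k = \<zeta> + \<rho>"
        "keys (E (gexp k)) \<subseteq> P \<inter> whull \<zeta>"
      have "dom_le (\<zeta> + \<rho>) (b + \<rho>)" using \<open>k \<in> whull (b + \<rho>)\<close> y(1,4) unfolding whull_def by force
      then have le: "dom_le \<zeta> b" by (simp add: dom_le_diff_cancel)
      then show ?thesis using y(5) whull_mono[OF _ le] dom_le_trans[OF dominant_nonneg[OF y(3)] le] by blast
    qed auto
  qed
  let ?t = "\<lambda>k. of_int (lookup F k) * E (gexp k)"
  have "keys (?t k) \<subseteq> P \<inter> whull b" if "k \<in> keys F" for k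
    using *[OF that] keys_of_int_mult[of "lookup F k" "E (gexp k)"] by auto
  then show "keys (E F) \<subseteq> P \<inter> whull b"
    unfolding E_expansion(2)[OF F] using keys_sum[of ?t "keys F"] by blast
  assume "E F \<noteq> 0"
  then obtain k where "k \<in> keys F" "E (gexp k) \<noteq> 0"
    unfolding E_expansion(2)[OF F] by (metis (no_types, lifting) mult_zero_right sum.neutral)
  then show "dom_le 0 b" using * by blast
qed

end

section \<open>The Kazhdan-Lusztig-Steinberg basis and its dual\<close>

context based_root_system
begin

abbreviation wI where "wI v \<equiv> varpi \<Delta> (D v)"
abbreviation wC where "wC v \<equiv> varpi \<Delta> (\<Delta> - D v)"
abbreviation fs where "fs \<equiv> kl_steinberg \<Delta>"

lemma wI_wC: "wI v + wC v = \<rho>" by (rule varpi_add_compl[OF descents_subset])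

lemma dominant_wI: "dominant (wI v)" and dominant_wC: "dominant (wC v)"
  using dominant_varpi descents_subset by auto

lemma wI_P: "wI v \<in> P" and wC_P: "wC v \<in> P"
  using varpi_weight descents_subset by auto

lemma wC_fixes: "w \<in> W \<Longrightarrow> y \<in> W \<Longrightarrow> y (wC w) = wC w \<longleftrightarrow> y \<in> weyl_group (D w)"
  by (rule varpi_stabilizer[OF descents_subset])

lemma parabolic_sub: "y \<in> weyl_group (D w) \<Longrightarrow> y \<in> W"
  using weyl_group_mono[OF descents_subset] by blast

lemma card_parabolic_pos: "card (weyl_group (D w)) > 0"
  using finite_parabolic[OF descents_subset] weyl_group_id by (metis card_gt_0_iff empty_iff)

text \<open>The coefficient function of \<open>C'\<^sub>w\<close> is constant on the cosets of \<open>W\<^bsub>I(w)\<^esub>\<close>, which are the fibres of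
  the orbit map.\<close>

lemma kl_steinberg_props:
  assumes w: "w \<in> W"
  shows "of_nat (card (weyl_group (D w))) * fs w = (\<Sum>y\<in>W. of_int (C' w y) * gexp (y (wC w)))"
    and "keys (fs w) \<subseteq> orb (wC w)"
proof -
  let ?n = "card (weyl_group (D w))" and ?S = "\<Sum>y\<in>W. of_int (C' w y) * gexp (y (wC w)) :: 'a grp_ring"
  have "\<forall>\<nu>\<in>orb (wC w). \<exists>y\<in>W. y (wC w) = \<nu>" by (auto simp: orb_def)
  \<comment> \<open>A section of the orbit map, picking one element per coset; thus \<open>f\<close>
    below is an integral quotient of the full sum by the order of the parabolic subgroup.\<close>
  then obtain r where r: "r \<nu> \<in> W" "r \<nu> (wC w) = \<nu>" if "\<nu> \<in> orb (wC w)" for \<nu> by metis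
  define f where "f = (\<Sum>\<nu>\<in>orb (wC w). of_int (C' w (r \<nu>)) * gexp \<nu> :: 'a grp_ring)"
  have fibre: "(\<Sum>y\<in>{y\<in>W. y (wC w) = \<nu>}. of_int (C' w y) * gexp (y (wC w)))
      = of_nat ?n * (of_int (C' w (r \<nu>)) * gexp \<nu> :: 'a grp_ring)" if nu: "\<nu> \<in> orb (wC w)" for \<nu>
  proof -
    have "bij_betw (\<lambda>u. r \<nu> \<circ> u) (weyl_group (D w)) {y\<in>W. y (wC w) = \<nu>}"
    proof (rule bij_betw_byWitness[where f' = "\<lambda>y. inv (r \<nu>) \<circ> y"])
      show "(\<lambda>u. r \<nu> \<circ> u) ` weyl_group (D w) \<subseteq> {y\<in>W. y (wC w) = \<nu>}"
      proof clarify
        fix u assume u: "u \<in> weyl_group (D w)"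
        have "u (wC w) = wC w" using wC_fixes[OF w parabolic_sub[OF u]] u by blast
        then show "r \<nu> \<circ> u \<in> W \<and> (r \<nu> \<circ> u) (wC w) = \<nu>"
          using r[OF nu] weyl_group_comp[OF _ parabolic_sub[OF u]] by (simp add: comp_apply)
      qed
      show "(\<lambda>y. inv (r \<nu>) \<circ> y) ` {y\<in>W. y (wC w) = \<nu>} \<subseteq> weyl_group (D w)"
      proof clarify
        fix y assume y: "y \<in> W" "\<nu> = y (wC w)"
        have i: "inv (r \<nu>) \<circ> y \<in> W" using r(1)[OF nu] weyl_group_inv weyl_group_comp y(1) by blast
        have "(inv (r \<nu>) \<circ> y) (wC w) = inv (r \<nu>) (r \<nu> (wC w))"
          using r(2)[OF nu] y(2) by (simp add: comp_apply)
        then have "(inv (r \<nu>) \<circ> y) (wC w) = wC w" using r(1)[OF nu] by simp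
        then show "inv (r (y (wC w))) \<circ> y \<in> weyl_group (D w)" using wC_fixes[OF w i] y(2) by simp
      qed
    qed (use r(1)[OF nu] in \<open>simp_all flip: comp_assoc\<close>)
    then have "(\<Sum>y\<in>{y\<in>W. y (wC w) = \<nu>}. of_int (C' w y) * gexp (y (wC w)))
      = (\<Sum>u\<in>weyl_group (D w). of_int (C' w (r \<nu> \<circ> u)) * gexp ((r \<nu> \<circ> u) (wC w)) :: 'a grp_ring)"
      by (rule sum.reindex_bij_betw[symmetric])
    also have "\<dots> = (\<Sum>u\<in>weyl_group (D w). of_int (C' w (r \<nu>)) * gexp \<nu>)"
    proof (rule sum.cong)
      fix u assume u: "u \<in> weyl_group (D w)"
      have "u (wC w) = wC w" using wC_fixes[OF w parabolic_sub[OF u]] u by blast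
      then show "of_int (C' w (r \<nu> \<circ> u)) * gexp ((r \<nu> \<circ> u) (wC w)) = of_int (C' w (r \<nu>)) * gexp \<nu>"
        using r(2)[OF nu] C'_parabolic_invariant[OF w u] by (simp add: comp_apply)
    qed simp
    finally show ?thesis by simp
  qed
  have "?S = (\<Sum>\<nu>\<in>orb (wC w). \<Sum>y\<in>{y\<in>W. y (wC w) = \<nu>}. of_int (C' w y) * gexp (y (wC w)))"
    unfolding orb_def by (rule sum.image_gen) simp
  also have "\<dots> = of_nat ?n * f" unfolding f_def sum_distrib_left by (rule sum.cong) (use fibre in auto)
  finally have nf: "of_nat ?n * f = ?S" by simp
  have "fs w = f"
    unfolding kl_steinberg_def weyl_ring_act_def push_gexp
  proof (rule the_equality)
    show "of_nat ?n * f = ?S" by (rule nf)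
    fix g assume "of_nat ?n * g = ?S"
    then have "of_int (int ?n) * g = of_int (int ?n) * f" using nf by simp
    then show "g = f" using card_parabolic_pos[of w] of_int_mult_cancel[of "int ?n" g f] by simp
  qed
  moreover have "keys f \<subseteq> orb (wC w)"
  proof
    fix k assume "k \<in> keys f"
    then obtain \<nu> where "\<nu> \<in> orb (wC w)" "k \<in> keys (of_int (C' w (r \<nu>)) * gexp \<nu>)"
      unfolding f_def using keys_sum[of "\<lambda>\<nu>. of_int (C' w (r \<nu>)) * gexp \<nu>" "orb (wC w)"] by blast
    then show "k \<in> orb (wC w)" using keys_of_int_mult[of "C' w (r \<nu>)" "gexp \<nu>"] by auto
  qed
  ultimately show "of_nat ?n * fs w = ?S" "keys (fs w) \<subseteq> orb (wC w)" using nf by auto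
qed

lemma fs_ZT: "w \<in> W \<Longrightarrow> fs w \<in> ZT \<Phi>"
  unfolding ZT_iff using kl_steinberg_props(2) orb_weights[OF wC_P] by blast

text \<open>The elements \<open>exp (v \<varpi>\<^bsub>I(v)\<^esub>)\<close> are a first approximation to the dual basis: their Gram matrix
  \<open>N\<close> with the \<open>f\<^sub>w\<close> is triangular with diagonal entries \<open>sgn v\<close>.\<close>

abbreviation gs where "gs v \<equiv> gexp (v (wI v)) :: 'a grp_ring"

definition N :: "('a \<Rightarrow> 'a) \<Rightarrow> ('a \<Rightarrow> 'a) \<Rightarrow> 'a grp_ring" where "N w v = E (fs w * gs v)"

lemma gs_ZT: "v \<in> W \<Longrightarrow> gs v \<in> ZT \<Phi>"
  using ZT_gexp weights_weyl wI_P by blast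

text \<open>As \<open>wI w + wC w = \<rho>\<close>, the product has its weights in the hull of
  \<open>wC w + wI v = (wI v - wI w) + \<rho>\<close>, the shape that \<open>E_keys\<close>
  expects.\<close>

lemma N_keys:
  assumes "w \<in> W" "v \<in> W"
  shows "keys (N w v) \<subseteq> P \<inter> whull (wI v - wI w)"
    and "N w v \<noteq> 0 \<Longrightarrow> dom_le (wI w) (wI v)"
proof -
  have b: "wC w + wI v = (wI v - wI w) + \<rho>" using wI_wC[of w] by (simp add: algebra_simps)
  have "keys (fs w * gs v) \<subseteq> P \<inter> whull ((wI v - wI w) + \<rho>)"
  proof
    fix k assume "k \<in> keys (fs w * gs v)"
    then obtain a where a: "a \<in> orb (wC w)" "k = a + v (wI v)"
      using keys_mult[of "fs w" "gs v"] kl_steinberg_props(2)[OF assms(1)] by auto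
    have "a \<in> P" "a \<in> whull (wC w)" using a(1) orb_weights[OF wC_P] orb_whull[OF dominant_wC] by auto
    moreover have "v (wI v) \<in> P" "v (wI v) \<in> whull (wI v)"
      using weights_weyl[OF assms(2) wI_P] whull_weyl[OF dominant_in_whull[OF dominant_wI] assms(2)] by auto
    ultimately show "k \<in> P \<inter> whull ((wI v - wI w) + \<rho>)"
      unfolding a(2) b[symmetric] using weights_add whull_add by blast
  qed
  from E_keys[OF this] show "keys (N w v) \<subseteq> P \<inter> whull (wI v - wI w)"
    and "N w v \<noteq> 0 \<Longrightarrow> dom_le (wI w) (wI v)"
    unfolding N_def by (auto simp: dom_le_def inner_diff_left)
qed

lemma N_ZT: "w \<in> W \<Longrightarrow> v \<in> W \<Longrightarrow> N w v \<in> ZT \<Phi>"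
  unfolding ZT_iff using N_keys(1) by blast

lemma N_winv: "w \<in> W \<Longrightarrow> v \<in> W \<Longrightarrow> winv (N w v)"
  unfolding N_def by (intro E_winv ZT_mult fs_ZT gs_ZT)

lemma E_rho_orbit: "u \<in> W \<Longrightarrow> E (gexp (u \<rho>)) = of_int (sg u)"
  by (rule E_eqI) (metis J_push mult.commute push_gexp weyl_denominator_def)

text \<open>The two bounds add up to exactly \<rho>, so a nonzero value forces the weight to be
  conjugate to \<rho>, by some \<open>z\<close> that makes both summands extreme at once:
  \<open>z \<circ> y\<close> fixes \<open>wC w\<close> and \<open>z \<circ> v\<close> fixes
  \<open>wI v\<close>. Then \<open>u = inv z\<close>.\<close>

lemma E_complementary:
  assumes w: "w \<in> W" and v: "v \<in> W" and D: "D w = D v" and y: "y \<in> W"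
    and ne: "E (gexp (y (wC w) + v (wI v))) \<noteq> 0"
  obtains u x where "u = v \<circ> x" "x \<in> weyl_group (\<Delta> - D v)" "inv u \<circ> y \<in> weyl_group (D w)" "u \<in> W"
    "E (gexp (y (wC w) + v (wI v))) = of_int (sg u)"
proof -
  let ?k = "y (wC w) + v (wI v)"
  have wr: "wC w + wI v = \<rho>" using wI_wC[of v] D by (simp add: add.commute)
  have kP: "?k \<in> P" by (rule weights_add[OF weights_weyl[OF y wC_P] weights_weyl[OF v wI_P]])
  show thesis
  proof (rule E_gexp_cases[OF kP])
    assume "E (gexp ?k) = 0" with ne show thesis by simp
  next
    fix z \<zeta> assume z: "z \<in> W" "dominant \<zeta>" "z ?k = \<zeta> + \<rho>"
    have e: "z (y (wC w)) + z (v (wI v)) = \<zeta> + \<rho>" using z by (simp add: weyl_add)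
    have l1: "dom_le (z (y (wC w))) (wC w)" and l2: "dom_le (z (v (wI v))) (wI v)"
      using weyl_le_dominant[OF weyl_group_comp[OF z(1) y] dominant_wC]
        weyl_le_dominant[OF weyl_group_comp[OF z(1) v] dominant_wI] by (simp_all add: comp_apply)
    have "dom_le (\<zeta> + \<rho>) (0 + \<rho>)" using dom_le_add[OF l1 l2] e wr by simp
    then have "dom_le \<zeta> 0" unfolding dom_le_diff_cancel .
    then have z0: "\<zeta> = 0" using dominant_nonneg[OF z(2)] dom_le_antisym by blast
    have "\<rho> \<bullet> z (y (wC w)) + \<rho> \<bullet> z (v (wI v)) = \<rho> \<bullet> wC w + \<rho> \<bullet> wI v"
      using e wr z0 by (simp flip: inner_add_right)
    then have "\<rho> \<bullet> z (y (wC w)) = \<rho> \<bullet> wC w" "\<rho> \<bullet> z (v (wI v)) = \<rho> \<bullet> wI v"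
      using dom_le_rho_inner[OF l1] dom_le_rho_inner[OF l2] by auto
    then have "(z \<circ> y) (wC w) = wC w" "(z \<circ> v) (wI v) = wI v"
      using dom_le_rho_inner_eq[OF l1] dom_le_rho_inner_eq[OF l2] by (simp_all add: comp_apply)
    then have zy: "z \<circ> y \<in> weyl_group (D w)" and "z \<circ> v \<in> weyl_group (\<Delta> - D v)"
      using wC_fixes[OF w weyl_group_comp[OF z(1) y]]
        varpi_stabilizer[of "\<Delta> - D v" "z \<circ> v"] weyl_group_comp[OF z(1) v] descents_subset[of v]
      by (simp_all add: double_diff)
    then have x: "inv (z \<circ> v) \<in> weyl_group (\<Delta> - D v)" using weyl_group_inv by blast
    have iz: "inv z \<in> W" and izz: "inv (inv z) = z"
      by (rule weyl_group_inv[OF z(1)], rule inv_inv_eq[OF weyl_group_bij[OF z(1)]])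
    have "v \<circ> inv (z \<circ> v) = inv z"
      using weyl_group_bij[OF z(1)] weyl_group_bij[OF v] v by (simp add: o_inv_distrib flip: comp_assoc)
    moreover have "?k = inv z \<rho>" using z(1,3) z0 by (metis add_0 weyl_group_inv_apply(1))
    then have "E (gexp ?k) = of_int (sg (inv z))" using E_rho_orbit[OF iz] by simp
    ultimately show thesis using that[of "inv z" "inv (z \<circ> v)"] x zy iz izz by simp
  qed
qed

lemma card_N:
  assumes "w \<in> W" "v \<in> W"
  shows "of_int (int (card (weyl_group (D w)))) * N w v
    = (\<Sum>y\<in>W. of_int (C' w y) * E (gexp (y (wC w) + v (wI v))))"
proof -
  have g: "gexp (y (wC w) + v (wI v)) \<in> ZT \<Phi>" if "y \<in> W" for y
    by (rule ZT_gexp[OF weights_add[OF weights_weyl[OF that wC_P] weights_weyl[OF assms(2) wI_P]]])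
  have "of_int (int (card (weyl_group (D w)))) * N w v
      = E ((of_nat (card (weyl_group (D w))) * fs w) * gs v)"
    unfolding N_def using E_of_int_mult[OF ZT_mult[OF fs_ZT[OF assms(1)] gs_ZT[OF assms(2)]],
        of "int (card (weyl_group (D w)))"] by (simp add: mult.assoc)
  also have "\<dots> = E (\<Sum>y\<in>W. of_int (C' w y) * gexp (y (wC w) + v (wI v)))"
    unfolding kl_steinberg_props(1)[OF assms(1)] by (simp add: sum_distrib_right mult.assoc gexp_mult)
  also have "\<dots> = (\<Sum>y\<in>W. E (of_int (C' w y) * gexp (y (wC w) + v (wI v))))"
    by (rule E_sum) (intro ZT_of_int_mult g)
  also have "\<dots> = (\<Sum>y\<in>W. of_int (C' w y) * E (gexp (y (wC w) + v (wI v))))"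
    by (intro sum.cong refl E_of_int_mult g)
  finally show ?thesis .
qed

text \<open>The element \<open>u\<close> lies in the coset of \<open>y\<close>, on which
  \<open>C' w\<close> is constant, so it is \<open>w\<close> or shorter than \<open>w\<close>. It
  also lies in the coset of \<open>v\<close> modulo the parabolic subgroup of
  \<open>\<Delta> - D v\<close>, where \<open>v\<close> is the unique shortest element.\<close>

lemma coset_term_props:
  assumes w: "w \<in> W" and v: "v \<in> W" and D: "D w = D v" and y: "y \<in> W"
    and ne: "C' w y \<noteq> 0" "E (gexp (y (wC w) + v (wI v))) \<noteq> 0"
  shows "lng v < lng w \<or> v = w" and "v = w \<Longrightarrow> inv w \<circ> y \<in> weyl_group (D w)"
proof -
  obtain u x where u: "u = v \<circ> x" "x \<in> weyl_group (\<Delta> - D v)" "inv u \<circ> y \<in> weyl_group (D w)" "u \<in> W"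
    using E_complementary[OF w v D y ne(2)] by metis
  have "u \<circ> (inv u \<circ> y) = y" using u(4) by (simp flip: comp_assoc)
  then have "C' w u = C' w y" using C'_parabolic_invariant[OF w u(3), of u] by simp
  then have uw: "u = w \<or> lng u < lng w" using ne(1) C'_supp bruhat_le_len by metis
  have xv: "x = id \<or> lng v < lng u"
    using minimal_coset_less[of "\<Delta> - D v" v x] v u(1,2) by blast
  show "lng v < lng w \<or> v = w" using uw xv u(1) by auto
  show "inv w \<circ> y \<in> weyl_group (D w)" if "v = w" using uw xv u(1,3) that by auto
qed

text \<open>Length enters reversed: for equal descent sets a nonzero \<open>N w v\<close> with
  \<open>w\<close> different from \<open>v\<close> makes \<open>v\<close> the shorter one, so longer
  elements have to come first.\<close>

definition prec :: "('a \<Rightarrow> 'a) \<Rightarrow> ('a \<Rightarrow> 'a) \<Rightarrow> bool" where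
  "prec u v \<longleftrightarrow> \<rho> \<bullet> wI u < \<rho> \<bullet> wI v \<or> \<rho> \<bullet> wI u = \<rho> \<bullet> wI v \<and> lng v < lng u"

lemma N_triangular:
  assumes w: "w \<in> W" and v: "v \<in> W" and ne: "N w v \<noteq> 0" shows "w = v \<or> prec w v"
proof -
  have le: "dom_le (wI w) (wI v)" by (rule N_keys(2)[OF w v ne])
  show ?thesis
  proof (cases "\<rho> \<bullet> wI w = \<rho> \<bullet> wI v")
    case False
    then show ?thesis using dom_le_rho_inner[OF le] by (simp add: prec_def)
  next
    case True
    then have "wI w = wI v" using dom_le_rho_inner_eq[OF le] by blast
    then have D: "D w = D v" using varpi_inj descents_subset by blast
    have "of_int (int (card (weyl_group (D w)))) * N w v \<noteq> 0"
      using of_int_mult_cancel[of "int (card (weyl_group (D w)))" "N w v" 0] ne card_parabolic_pos[of w] by auto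
    then obtain y where y: "y \<in> W" "of_int (C' w y) * E (gexp (y (wC w) + v (wI v))) \<noteq> 0"
      unfolding card_N[OF w v] by (metis (no_types, lifting) sum.neutral)
    then have "C' w y \<noteq> 0" "E (gexp (y (wC w) + v (wI v))) \<noteq> 0" by auto
    from coset_term_props(1)[OF w v D y(1) this] show ?thesis using True by (auto simp: prec_def)
  qed
qed

text \<open>The surviving terms form the coset of \<open>w\<close> modulo the parabolic subgroup of
  its descents. There \<open>C' w\<close> is 1 and every weight is \<open>w \<rho>\<close>, so the
  order of the subgroup factors out.\<close>

lemma N_diagonal: assumes w: "w \<in> W" shows "N w w = of_int (sg w)"
proof -
  let ?n = "int (card (weyl_group (D w)))"
  let ?t = "\<lambda>y. of_int (C' w y) * E (gexp (y (wC w) + w (wI w)))"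
  have "of_int ?n * N w w = (\<Sum>y\<in>W. ?t y)" by (rule card_N[OF w w])
  also have "\<dots> = (\<Sum>y\<in>(\<lambda>u. w \<circ> u) ` weyl_group (D w). ?t y)"
  proof (rule sum.mono_neutral_right)
    show "(\<lambda>u. w \<circ> u) ` weyl_group (D w) \<subseteq> W" using w parabolic_sub weyl_group_comp by blast
    show "\<forall>y\<in>W - (\<lambda>u. w \<circ> u) ` weyl_group (D w). ?t y = 0"
    proof (rule ballI, rule ccontr)
      fix y assume y: "y \<in> W - (\<lambda>u. w \<circ> u) ` weyl_group (D w)" and ne: "?t y \<noteq> 0"
      then have "C' w y \<noteq> 0" "E (gexp (y (wC w) + w (wI w))) \<noteq> 0" by auto
      from coset_term_props(2)[OF w w refl _ this refl] y have "inv w \<circ> y \<in> weyl_group (D w)" by blast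
      moreover have "y = w \<circ> (inv w \<circ> y)" using w by (simp flip: comp_assoc)
      ultimately show False using y by blast
    qed
  qed simp
  also have "\<dots> = (\<Sum>u\<in>weyl_group (D w). ?t (w \<circ> u))"
  proof (rule sum.reindex_cong)
    show "inj_on (\<lambda>u. w \<circ> u) (weyl_group (D w))"
      using bij_betw_comp_left[OF w] parabolic_sub by (meson bij_betw_def inj_on_subset subsetI)
  qed simp_all
  also have "\<dots> = (\<Sum>u\<in>weyl_group (D w). of_int (sg w))"
  proof (rule sum.cong)
    fix u assume u: "u \<in> weyl_group (D w)"
    have "w (wC w) + w (wI w) = w \<rho>" using wI_wC[of w] weyl_add[OF w] by (metis add.commute)
    moreover have "u (wC w) = wC w" using wC_fixes[OF w parabolic_sub[OF u]] u by blast
    ultimately have "E (gexp ((w \<circ> u) (wC w) + w (wI w))) = of_int (sg w)"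
      using E_rho_orbit[OF w] by (simp add: comp_apply)
    moreover have "C' w (w \<circ> u) = 1" using C'_parabolic_invariant[OF w u, of w] C'_self[OF w] by simp
    ultimately show "?t (w \<circ> u) = of_int (sg w)" by simp
  qed simp
  also have "\<dots> = of_int ?n * of_int (sg w)" by simp
  finally show ?thesis by (rule of_int_mult_cancel) (use card_parabolic_pos[of w] in simp)
qed

subsection \<open>The dual basis\<close>

text \<open>Back substitution in the triangular Gram matrix; the diagonal entry \<open>sg v\<close>
  is its own inverse. The recursion ends since fewer elements precede \<open>u\<close> than precede
  \<open>v\<close>.\<close>

function Gd :: "('a \<Rightarrow> 'a) \<Rightarrow> 'a grp_ring" where
  "Gd v = of_int (sg v) * (gs v - (\<Sum>u\<in>{u\<in>W. prec u v}. N u v * Gd u))"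
  by pat_completeness auto
termination
proof (relation "Wellfounded.measure (\<lambda>v. card {u\<in>W. prec u v})")
  fix v u assume "u \<in> {u\<in>W. prec u v}"
  then have "{z\<in>W. prec z u} \<subset> {z\<in>W. prec z v}" by (auto simp: prec_def)
  then show "(u, v) \<in> Wellfounded.measure (\<lambda>v. card {u\<in>W. prec u v})" by (simp add: psubset_card_mono)
qed simp

declare Gd.simps [simp del]

lemma sgn_mult_self: "of_int (sg v) * (of_int (sg v) * f) = (f :: 'a grp_ring)"
  using sgn_square[of v] by (metis mult.assoc mult_1 of_int_1 of_int_mult)

text \<open>Being invariant, \<open>N u v\<close> can be taken out of the pairing, so the subtracted
  sum cancels exactly the entries \<open>N w v\<close> with \<open>w\<close> preceding
  \<open>v\<close>. For other \<open>w\<close> distinct from \<open>v\<close> the entry is already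
  zero.\<close>

lemma Gd_props:
  assumes "v \<in> W"
  shows "keys (Gd v) \<subseteq> P \<inter> whull (wI v)
    \<and> (\<forall>w\<in>W. E (fs w * Gd v) = (if w = v then 1 else 0))"
  using assms
proof (induction v rule: Gd.induct)
  case (1 v)
  let ?U = "{u\<in>W. prec u v}"
  note v = 1(2)
  have IH: "keys (Gd u) \<subseteq> P \<inter> whull (wI u)"
    "\<And>w. w \<in> W \<Longrightarrow> E (fs w * Gd u) = (if w = u then 1 else 0)" if "u \<in> ?U" for u
    using 1(1)[OF that] that by auto
  have GZ: "Gd u \<in> ZT \<Phi>" if "u \<in> ?U" for u using IH(1)[OF that] unfolding ZT_iff by blast
  have "keys (N u v * Gd u) \<subseteq> P \<inter> whull (wI v)" if u: "u \<in> ?U" for u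
  proof
    fix k assume "k \<in> keys (N u v * Gd u)"
    then obtain a b where ab: "a \<in> keys (N u v)" "b \<in> keys (Gd u)" "k = a + b"
      using keys_mult[of "N u v" "Gd u"] by auto
    then have "a \<in> P \<inter> whull (wI v - wI u)" "b \<in> P \<inter> whull (wI u)"
      using N_keys(1)[of u v] u v IH(1)[OF u] by auto
    then show "k \<in> P \<inter> whull (wI v)" using weights_add whull_add[of a "wI v - wI u" b "wI u"] ab(3) by simp
  qed
  then have "keys (\<Sum>u\<in>?U. N u v * Gd u) \<subseteq> P \<inter> whull (wI v)"
    using keys_sum[of "\<lambda>u. N u v * Gd u" ?U] by (meson UN_least subset_trans)
  moreover have "keys (gs v) \<subseteq> P \<inter> whull (wI v)"
    using weights_weyl[OF v wI_P] whull_weyl[OF dominant_in_whull[OF dominant_wI] v] by simp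
  ultimately have "keys (gs v - (\<Sum>u\<in>?U. N u v * Gd u)) \<subseteq> P \<inter> whull (wI v)"
    using keys_diff[of "gs v"] by blast
  then have "keys (Gd v) \<subseteq> P \<inter> whull (wI v)"
    unfolding Gd.simps[of v] using keys_of_int_mult[of "sg v"] by blast
  moreover have "E (fs w * Gd v) = (if w = v then 1 else 0)" if w: "w \<in> W" for w
  proof -
    have z: "fs w * (N u v * Gd u) \<in> ZT \<Phi>" if "u \<in> ?U" for u
      using ZT_mult fs_ZT[OF w] N_ZT GZ that v by blast
    have g: "fs w * gs v \<in> ZT \<Phi>" using ZT_mult[OF fs_ZT[OF w] gs_ZT[OF v]] .
    have s: "(\<Sum>u\<in>?U. fs w * (N u v * Gd u)) \<in> ZT \<Phi>" by (rule ZT_sum) (rule z)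
    have "fs w * Gd v = of_int (sg v) * (fs w * gs v - (\<Sum>u\<in>?U. fs w * (N u v * Gd u)))"
      unfolding Gd.simps[of v] by (simp add: right_diff_distrib sum_distrib_left mult.left_commute)
    then have "E (fs w * Gd v) = of_int (sg v) * E (fs w * gs v - (\<Sum>u\<in>?U. fs w * (N u v * Gd u)))"
      using E_of_int_mult[OF ZT_diff[OF g s], of "sg v"] by simp
    also have "E (fs w * gs v - (\<Sum>u\<in>?U. fs w * (N u v * Gd u))) = N w v - E (\<Sum>u\<in>?U. fs w * (N u v * Gd u))"
      unfolding E_diff[OF g s] by (simp add: N_def[of w v])
    also have "E (\<Sum>u\<in>?U. fs w * (N u v * Gd u)) = (\<Sum>u\<in>?U. E (fs w * (N u v * Gd u)))"
      by (rule E_sum) (rule z)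
    also have "(\<Sum>u\<in>?U. E (fs w * (N u v * Gd u))) = (\<Sum>u\<in>?U. if w = u then N w v else 0)"
    proof (rule sum.cong)
      fix u assume u: "u \<in> ?U"
      have "E (fs w * (N u v * Gd u)) = N u v * E (fs w * Gd u)"
        using E_mult_winv[OF ZT_mult[OF fs_ZT[OF w] GZ[OF u]] N_winv[of u v]] u v
        by (simp add: mult.left_commute)
      then show "E (fs w * (N u v * Gd u)) = (if w = u then N w v else 0)" using IH(2)[OF u w] by simp
    qed simp
    also have "\<dots> = (if prec w v then N w v else 0)" using w by simp
    finally have e: "E (fs w * Gd v) = of_int (sg v) * (N w v - (if prec w v then N w v else 0))" .
    show ?thesis
    proof (cases "w = v")
      case True
      then have "\<not> prec w v" by (simp add: prec_def)
      then show ?thesis using True e N_diagonal[OF v] sgn_mult_self[of v 1] by simp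
    next
      case False
      then show ?thesis using e N_triangular[OF w v] by (cases "N w v = 0") auto
    qed
  qed
  ultimately show ?case by blast
qed

section \<open>Generation of Z[T] over the invariants and uniqueness of the dual basis\<close>

lemma Gd_ZT: "v \<in> W \<Longrightarrow> Gd v \<in> ZT \<Phi>"
  using Gd_props unfolding ZT_iff by blast

definition Gspan :: "'a grp_ring \<Rightarrow> bool" where
  "Gspan x \<longleftrightarrow> (\<exists>c. (\<forall>u\<in>W. c u \<in> ZT \<Phi> \<and> winv (c u)) \<and> x = (\<Sum>u\<in>W. c u * Gd u))"

lemma Gspan_add: assumes "Gspan x" "Gspan y" shows "Gspan (x + y)"
proof -
  obtain c d where "\<forall>u\<in>W. c u \<in> ZT \<Phi> \<and> winv (c u)" "x = (\<Sum>u\<in>W. c u * Gd u)"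
    "\<forall>u\<in>W. d u \<in> ZT \<Phi> \<and> winv (d u)" "y = (\<Sum>u\<in>W. d u * Gd u)"
    using assms unfolding Gspan_def by blast
  then show ?thesis unfolding Gspan_def
    by (intro exI[of _ "\<lambda>u. c u + d u"]) (auto simp: ZT_add winv_add distrib_right sum.distrib)
qed

lemma Gspan_mult: assumes "Gspan x" "r \<in> ZT \<Phi>" "winv r" shows "Gspan (r * x)"
proof -
  obtain c where "\<forall>u\<in>W. c u \<in> ZT \<Phi> \<and> winv (c u)" "x = (\<Sum>u\<in>W. c u * Gd u)"
    using assms(1) unfolding Gspan_def by blast
  then show ?thesis unfolding Gspan_def using assms(2,3)
    by (intro exI[of _ "\<lambda>u. r * c u"]) (auto simp: ZT_mult winv_mult sum_distrib_left mult.assoc)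
qed

lemma ZT_of_int: "of_int c \<in> ZT \<Phi>"
  using ZT_of_int_mult[OF ZT_gexp[of 0], of c] by (simp add: gexp_0 weights_def)

lemma Gspan_of_int_mult: "Gspan x \<Longrightarrow> Gspan (of_int c * x)"
  by (rule Gspan_mult[OF _ ZT_of_int winv_of_int])

lemma Gspan_diff: "Gspan x \<Longrightarrow> Gspan y \<Longrightarrow> Gspan (x - y)"
  using Gspan_add[of x "of_int (-1) * y"] Gspan_of_int_mult[of y "-1"] by simp

lemma Gspan_0: "Gspan 0"
  unfolding Gspan_def by (intro exI[of _ "\<lambda>_. 0"]) (use winv_of_int[of 0] in simp)

lemma Gspan_sum: "(\<And>a. a \<in> A \<Longrightarrow> Gspan (f a)) \<Longrightarrow> Gspan (sum f A)"
  by (induction A rule: infinite_finite_induct) (auto simp: Gspan_0 Gspan_add)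

lemma Gspan_Gd: assumes "v \<in> W" shows "Gspan (Gd v)"
  unfolding Gspan_def
proof (intro exI[of _ "\<lambda>u. of_int (if u = v then 1 else 0)"] conjI ballI)
  show "Gd v = (\<Sum>u\<in>W. of_int (if u = v then 1 else 0) * Gd u)"
    using assms by (simp add: if_distrib[of of_int] if_distrib[of "\<lambda>x. x * _"] cong: if_cong)
qed (simp_all only: ZT_of_int winv_of_int)

lemma Gspan_gs: assumes "v \<in> W" shows "Gspan (gs v)"
proof -
  have "gs v = of_int (sg v) * Gd v + (\<Sum>u\<in>{u\<in>W. prec u v}. N u v * Gd u)"
    by (subst Gd.simps) (simp add: sgn_mult_self)
  moreover have "Gspan (\<Sum>u\<in>{u\<in>W. prec u v}. N u v * Gd u)"
    by (rule Gspan_sum) (use Gspan_mult Gspan_Gd N_ZT N_winv assms in auto)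
  ultimately show ?thesis using Gspan_add Gspan_of_int_mult Gspan_Gd[OF assms] by simp
qed

text \<open>A shortest element with the given image of \<open>d\<close> has no descent orthogonal to
  \<open>d\<close>. For a dominant weight \<open>d\<close> this makes \<open>d - wI v\<close>
  dominant, as Steinberg's expansion requires.\<close>

lemma minimal_rep:
  assumes "y \<in> W"
  obtains v where "v \<in> W" "v d = y d" "D v \<inter> {\<alpha>\<in>\<Delta>. d \<bullet> \<alpha> = 0} = {}"
proof -
  define S where "S = {v\<in>W. v d = y d}"
  have S: "finite S" "S \<noteq> {}" using assms unfolding S_def by auto
  define v where "v = arg_min_on lng S"
  have vS: "v \<in> S" unfolding v_def by (rule arg_min_if_finite(1)[OF S])
  have "\<alpha> \<notin> D v" if a: "\<alpha> \<in> \<Delta>" "d \<bullet> \<alpha> = 0" for \<alpha>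
  proof
    assume "\<alpha> \<in> D v"
    then have lt: "lng (v \<circ> reflection \<alpha>) < lng v" by (simp add: right_descents_def)
    have "reflection \<alpha> d = d" using a simple_nonzero by (simp add: reflection_eq_self_iff)
    then have "v \<circ> reflection \<alpha> \<in> S"
      using vS weyl_group_comp_reflection_iff[OF a(1)] unfolding S_def by (simp add: comp_apply)
    from arg_min_least[OF S this, of lng] lt show False unfolding v_def by simp
  qed
  then show thesis using that[of v] vS unfolding S_def by blast
qed

text \<open>Steinberg's argument: with \<open>I = I(v)\<close>, expand the product of the orbit sum of \<open>d - \<varpi>\<^sub>I\<close> with
  \<open>exp (v \<varpi>\<^sub>I)\<close>. Besides \<open>exp (v d)\<close> it contains only terms of smaller height, or terms
  \<open>exp (v' d)\<close> with \<open>v'\<close> longer than \<open>v\<close>.\<close>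

lemma Gspan_gexp_aux:
  assumes "d \<in> P" "dominant d" "v \<in> W" "D v \<inter> {\<alpha>\<in>\<Delta>. d \<bullet> \<alpha> = 0} = {}"
  shows "Gspan (gexp (v d))"
  using assms
proof (induction "nat \<lfloor>hgt d\<rfloor>" arbitrary: d v rule: less_induct)
  case (less d)
  note outer = less.hyps and d = less.prems(1,2)
  from less.prems(3,4) show ?case
  proof (induction "lng w0 - lng v" arbitrary: v rule: less_induct)
    case (less v)
    note v = less.prems(1) and Dv = less.prems(2)
    define \<zeta> where "\<zeta> = d - wI v"
    have \<zeta>: "dominant \<zeta>" "\<zeta> \<in> P"
      unfolding \<zeta>_def
      using sub_varpi_dominant[OF d descents_subset, of v] Dv descents_subset[of v] weights_diff[OF d(1) wI_P] by blast+
    have tm: "Gspan (gexp (\<eta> + v (wI v)))" if eta: "\<eta> \<in> orb \<zeta> - {v \<zeta>}" for \<eta>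
    proof -
      let ?l = "\<eta> + v (wI v)"
      have "\<eta> \<in> P" using eta orb_weights[OF \<zeta>(2)] by blast
      then have lP: "?l \<in> P" using weights_add weights_weyl[OF v wI_P] by blast
      obtain z where z: "z \<in> W" "dominant (z ?l)" by (rule dominant_rep)
      have zP: "z ?l \<in> P" using weights_weyl[OF z(1) lP] .
      have iz: "inv z \<in> W" using weyl_group_inv[OF z(1)] .
      have izl: "inv z (z ?l) = ?l" using z(1) by simp
      obtain v' where v': "v' \<in> W" "v' (z ?l) = ?l" "D v' \<inter> {\<alpha>\<in>\<Delta>. z ?l \<bullet> \<alpha> = 0} = {}"
        by (rule minimal_rep[OF iz, of "z ?l"]) (simp only: izl)
      have l1: "dom_le (z \<eta>) \<zeta>" using orb_dom_le[OF \<zeta>(1) _ z(1)] eta by blast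
      have l2: "dom_le (z (v (wI v))) (wI v)"
        using weyl_le_dominant[OF weyl_group_comp[OF z(1) v] dominant_wI] by (simp add: comp_apply)
      have zl: "z ?l = z \<eta> + z (v (wI v))" by (rule weyl_add[OF z(1)])
      have le: "dom_le (z ?l) d" using dom_le_add[OF l1 l2] zl by (simp add: \<zeta>_def)
      show ?thesis
      proof (cases "z ?l = d")
        case False
        from outer[OF hgt_measure[OF zP z(2) d le False] zP z(2) v'(1,3)] v'(2) show ?thesis by simp
      next
        case True
        then have "\<rho> \<bullet> z \<eta> + \<rho> \<bullet> z (v (wI v)) = \<rho> \<bullet> \<zeta> + \<rho> \<bullet> wI v"
          using zl by (metis \<zeta>_def diff_add_cancel inner_add_right)
        then have "\<rho> \<bullet> z (v (wI v)) = \<rho> \<bullet> wI v" using dom_le_rho_inner[OF l1] dom_le_rho_inner[OF l2] by auto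
        then have "(z \<circ> v) (wI v) = wI v" using dom_le_rho_inner_eq[OF l2] by (simp add: comp_apply)
        then have zv: "z \<circ> v \<in> weyl_group (\<Delta> - D v)"
          using varpi_stabilizer[of "\<Delta> - D v" "z \<circ> v"] weyl_group_comp[OF z(1) v] descents_subset[of v]
          by (simp add: double_diff)
        have "(z \<circ> v') d = d" using v'(2) True by (simp add: comp_apply)
        then have "z \<circ> v' \<in> weyl_group {\<alpha>\<in>\<Delta>. d \<bullet> \<alpha> = 0}"
          using stabilizer_dominant[OF d(2) weyl_group_comp[OF z(1) v'(1)]] by blast
        moreover have "{\<alpha>\<in>\<Delta>. d \<bullet> \<alpha> = 0} \<subseteq> \<Delta> - D v" using Dv by blast
        ultimately have zv': "z \<circ> v' \<in> weyl_group (\<Delta> - D v)" using weyl_group_mono by blast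
        \<comment> \<open>Both \<open>z \<circ> v\<close> and \<open>z \<circ> v'\<close> lie in the
          parabolic subgroup of \<open>\<Delta> - D v\<close>, so \<open>v'\<close> is in the coset
          where \<open>v\<close> is the unique shortest element.\<close>
        define x where "x = inv (z \<circ> v) \<circ> (z \<circ> v')"
        have x: "x \<in> weyl_group (\<Delta> - D v)" unfolding x_def using weyl_group_comp weyl_group_inv zv zv' by blast
        have "v \<circ> x = v'"
        proof -
          have "(z \<circ> v) \<circ> x = z \<circ> v'" unfolding x_def using zv by (simp flip: comp_assoc)
          then have "inv z \<circ> (z \<circ> (v \<circ> x)) = inv z \<circ> (z \<circ> v')" by (simp add: comp_assoc)
          then show ?thesis using z(1) by (simp flip: comp_assoc)
        qed
        moreover have "v' \<noteq> v"
        proof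
          assume "v' = v"
          then have "?l = v \<zeta> + v (wI v)" using v'(2) True weyl_add[OF v, of \<zeta> "wI v"] by (simp add: \<zeta>_def)
          then show False using eta by simp
        qed
        ultimately have "lng v < lng v'"
          using minimal_coset_less[of "\<Delta> - D v" v x] v x by (cases "x = id") auto
        moreover have "lng v' \<le> lng w0" by (rule len_le_longest[OF v'(1)])
        ultimately have "lng w0 - lng v' < lng w0 - lng v" by simp
        from less.hyps[OF this v'(1)] v'(2,3) True show ?thesis by simp
      qed
    qed
    have "orbsum \<zeta> * gs v = (\<Sum>\<eta>\<in>orb \<zeta>. gexp (\<eta> + v (wI v)))"
      by (simp add: orbsum_def sum_distrib_right gexp_mult)
    also have "\<dots> = gexp (v \<zeta> + v (wI v)) + (\<Sum>\<eta>\<in>orb \<zeta> - {v \<zeta>}. gexp (\<eta> + v (wI v)))"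
      by (rule sum.remove) (simp_all add: weyl_in_orb v)
    also have "v \<zeta> + v (wI v) = v d" using weyl_add[OF v, of \<zeta> "wI v"] by (simp add: \<zeta>_def)
    finally have "gexp (v d) = orbsum \<zeta> * gs v - (\<Sum>\<eta>\<in>orb \<zeta> - {v \<zeta>}. gexp (\<eta> + v (wI v)))" by simp
    moreover have "orbsum \<zeta> \<in> ZT \<Phi>" unfolding ZT_iff using keys_orbsum orb_weights[OF \<zeta>(2)] by blast
    then have "Gspan (orbsum \<zeta> * gs v)" by (rule Gspan_mult[OF Gspan_gs[OF v] _ winv_orbsum])
    moreover have "Gspan (\<Sum>\<eta>\<in>orb \<zeta> - {v \<zeta>}. gexp (\<eta> + v (wI v)))" by (rule Gspan_sum) (rule tm)
    ultimately show ?case using Gspan_diff by simp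
  qed
qed

lemma Gspan_ZT: assumes "g \<in> ZT \<Phi>" shows "Gspan g"
proof (subst gexp_expansion[of g], rule Gspan_sum, rule Gspan_of_int_mult)
  fix k assume "k \<in> keys g"
  then have kP: "k \<in> P" using assms unfolding ZT_iff by blast
  obtain y where y: "y \<in> W" "dominant (y k)" by (rule dominant_rep)
  obtain v where v: "v \<in> W" "v (y k) = inv y (y k)" "D v \<inter> {\<alpha>\<in>\<Delta>. y k \<bullet> \<alpha> = 0} = {}"
    by (rule minimal_rep[OF weyl_group_inv[OF y(1)], of "y k"])
  from Gspan_gexp_aux[OF weights_weyl[OF y(1) kP] y(2) v(1,3)] show "Gspan (gexp k)"
    using v(2) y(1) by simp
qed

text \<open>Pairing with \<open>fs w\<close> reads off the coefficient at \<open>Gd w\<close>, and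
  every element of Z[T] is a combination of the \<open>Gd u\<close>.\<close>

lemma pairing_nondegenerate:
  assumes "g \<in> ZT \<Phi>" "\<And>w. w \<in> W \<Longrightarrow> E (fs w * g) = 0" shows "g = 0"
proof -
  obtain c where c: "\<And>u. u \<in> W \<Longrightarrow> c u \<in> ZT \<Phi> \<and> winv (c u)" "g = (\<Sum>u\<in>W. c u * Gd u)"
    using Gspan_ZT[OF assms(1)] unfolding Gspan_def by blast
  have "c w = 0" if w: "w \<in> W" for w
  proof -
    have "E (fs w * g) = E (\<Sum>u\<in>W. c u * (fs w * Gd u))"
      unfolding c(2) by (simp add: sum_distrib_left mult.left_commute)
    also have "\<dots> = (\<Sum>u\<in>W. E (c u * (fs w * Gd u)))"
      by (rule E_sum) (use c(1) ZT_mult fs_ZT[OF w] Gd_ZT in blast)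
    also have "\<dots> = (\<Sum>u\<in>W. if w = u then c w else 0)"
      using c(1) Gd_props w by (intro sum.cong) (auto simp: E_mult_winv ZT_mult fs_ZT Gd_ZT)
    finally show ?thesis using assms(2)[OF w] w by simp
  qed
  then show ?thesis unfolding c(2) by simp
qed

lemma kl_steinberg_dual_eq: assumes "v \<in> W" shows "kl_steinberg_dual \<Phi> \<Delta> v = Gd v"
  unfolding kl_steinberg_dual_def ZT_pairing_eq
proof (rule the_equality)
  show "Gd v \<in> ZT \<Phi> \<and> (\<forall>w\<in>W. E (fs w * Gd v) = (if w = v then 1 else 0))"
    using Gd_ZT Gd_props assms by blast
next
  fix g assume g: "g \<in> ZT \<Phi> \<and> (\<forall>w\<in>W. E (fs w * g) = (if w = v then 1 else 0))"
  have "g - Gd v = 0"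
  proof (rule pairing_nondegenerate)
    show "g - Gd v \<in> ZT \<Phi>" using g Gd_ZT[OF assms] ZT_diff by blast
    fix w assume w: "w \<in> W"
    then show "E (fs w * (g - Gd v)) = 0"
      using g Gd_props[OF assms] E_diff[OF ZT_mult[OF fs_ZT[OF w]] ZT_mult[OF fs_ZT[OF w] Gd_ZT[OF assms]], of g]
      by (simp add: right_diff_distrib)
  qed
  then show "g = Gd v" by simp
qed

section \<open>The proposition\<close>

text \<open>Making \<open>a + x\<close> dominant by simple reflections, the difference to \<open>a\<close> moves at each step along the
  segment from \<open>z (a + x) - a\<close> to its mirror image, so it stays in every \<open>W\<close>-stable convex set.\<close>

lemma dominant_rep_perturbation:
  assumes a: "dominant a" and x: "x \<in> whull b"
  obtains z where "z \<in> W" "dominant (z (a + x))" "z (a + x) - a \<in> whull b"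
proof -
  \<comment> \<open>Only conjugates that already satisfy the bound compete; the one with the largest
    pairing with \<rho> turns out to be dominant.\<close>
  define Z where "Z = {z\<in>W. z (a + x) - a \<in> whull b}"
  have "id (a + x) - a \<in> whull b" using x by (simp add: id_apply)
  then have "id \<in> Z" by (simp only: Z_def mem_Collect_eq weyl_group_id simp_thms)
  then have "Z \<noteq> {}" by blast
  moreover have "finite Z" unfolding Z_def by simp
  ultimately obtain z where z: "z \<in> Z" and zmax: "\<And>y. y \<in> Z \<Longrightarrow> \<rho> \<bullet> y (a + x) \<le> \<rho> \<bullet> z (a + x)"
    using finite_max_ex[of Z "\<lambda>z. \<rho> \<bullet> z (a + x)"] by metis
  define s where "s = z (a + x)"
  have "dominant s" unfolding dominant_def
  proof (rule ballI, rule ccontr)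
    fix \<alpha> assume al: "\<alpha> \<in> \<Delta>" "\<not> 0 \<le> s \<bullet> \<alpha>"
    define \<mu> where "\<mu> = s - a"
    define e where "e y = 2 * (y \<bullet> \<alpha>) / (\<alpha> \<bullet> \<alpha>)" for y :: 'a
    have es: "e s < 0" using al simple_inner_pos[OF al(1)] by (simp add: e_def divide_neg_pos)
    have "e a \<ge> 0" using a al(1) by (simp add: e_def dominant_def)
    moreover have "e \<mu> = e s - e a" by (simp add: e_def \<mu>_def inner_diff_left diff_divide_distrib right_diff_distrib)
    ultimately have em: "e \<mu> \<le> e s" "e \<mu> < 0" using es by auto
    \<comment> \<open>The point of the segment at parameter \<open>t\<close> is \<mu> minus
      \<open>t * e \<mu>\<close> times \<alpha>; the choice makes it
      \<open>reflection \<alpha> s - a\<close>. Dominance of \<open>a\<close> gives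
      \<open>e \<mu> \<le> e s < 0\<close>, hence \<open>t \<le> 1\<close>.\<close>
    define t where "t = e s / e \<mu>"
    have t: "0 \<le> t" "t \<le> 1" "t * e \<mu> = e s" using em es unfolding t_def by (auto simp: divide_simps)
    have m: "\<mu> \<in> whull b" using z unfolding Z_def \<mu>_def s_def by simp
    have "(1 - t) *\<^sub>R \<mu> + t *\<^sub>R reflection \<alpha> \<mu> = \<mu> - (t * e \<mu>) *\<^sub>R \<alpha>"
      by (simp add: reflection_def e_def algebra_simps)
    also have "\<dots> = reflection \<alpha> s - a" unfolding t(3) by (simp add: reflection_def e_def \<mu>_def)
    finally have "reflection \<alpha> s - a \<in> whull b"
      using whull_segment[OF m whull_weyl[OF m reflection_in_weyl_group[OF al(1)]] t(1,2)] by simp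
    then have "reflection \<alpha> \<circ> z \<in> Z"
      using z reflection_comp_weyl_group_iff[OF al(1)] unfolding Z_def s_def by (simp add: comp_apply)
    from zmax[OF this] have "\<rho> \<bullet> reflection \<alpha> s \<le> \<rho> \<bullet> s" by (simp add: comp_apply s_def)
    then have "0 \<le> e s * (\<rho> \<bullet> \<alpha>)" by (simp add: reflection_def e_def inner_diff_right)
    then show False using es rho_inner_pos[OF simple_pos[OF al(1)]] by (simp add: zero_le_mult_iff)
  qed
  then show thesis using that[of z] z unfolding Z_def s_def by blast
qed

definition charcomb :: "'a set \<Rightarrow> 'a grp_ring \<Rightarrow> bool" where
  "charcomb S x \<longleftrightarrow> (\<exists>\<Lambda> (c :: 'a \<Rightarrow> int). finite \<Lambda> \<and> \<Lambda> \<subseteq> S \<and> x = (\<Sum>\<nu>\<in>\<Lambda>. of_int (c \<nu>) * weyl_char \<Delta> \<nu>))"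

lemma charcomb_0: "charcomb S 0"
  unfolding charcomb_def by (intro exI[of _ "{}"]) simp

lemma charcomb_single: "\<nu> \<in> S \<Longrightarrow> charcomb S (of_int n * weyl_char \<Delta> \<nu>)"
  unfolding charcomb_def by (intro exI[of _ "{\<nu>}"] exI[of _ "\<lambda>_. n"]) simp

lemma charcomb_add: assumes "charcomb S x" "charcomb S y" shows "charcomb S (x + y)"
proof -
  obtain A c B d where A: "finite A" "A \<subseteq> S" "x = (\<Sum>\<nu>\<in>A. of_int (c \<nu>) * weyl_char \<Delta> \<nu>)"
    and B: "finite B" "B \<subseteq> S" "y = (\<Sum>\<nu>\<in>B. of_int (d \<nu>) * weyl_char \<Delta> \<nu>)"
    using assms unfolding charcomb_def by blast
  define c' d' where "c' \<nu> = (if \<nu> \<in> A then c \<nu> else 0)" and "d' \<nu> = (if \<nu> \<in> B then d \<nu> else 0)" for \<nu>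
  have "x = (\<Sum>\<nu>\<in>A \<union> B. of_int (c' \<nu>) * weyl_char \<Delta> \<nu>)"
    unfolding A(3) by (rule sum.mono_neutral_cong_left) (use A B in \<open>auto simp: c'_def\<close>)
  moreover have "y = (\<Sum>\<nu>\<in>A \<union> B. of_int (d' \<nu>) * weyl_char \<Delta> \<nu>)"
    unfolding B(3) by (rule sum.mono_neutral_cong_left) (use A B in \<open>auto simp: d'_def\<close>)
  ultimately have "x + y = (\<Sum>\<nu>\<in>A \<union> B. of_int (c' \<nu> + d' \<nu>) * weyl_char \<Delta> \<nu>)"
    by (simp add: sum.distrib distrib_right)
  then show ?thesis unfolding charcomb_def using A B
    by (intro exI[of _ "A \<union> B"] exI[of _ "\<lambda>\<nu>. c' \<nu> + d' \<nu>"]) auto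
qed

lemma charcomb_sum: "(\<And>a. a \<in> A \<Longrightarrow> charcomb S (f a)) \<Longrightarrow> charcomb S (sum f A)"
  by (induction A rule: infinite_finite_induct) (auto simp: charcomb_0 charcomb_add)

lemma h_val_nonneg: assumes "\<Phi> \<noteq> {}" shows "0 \<le> h_val \<Phi> \<Delta> w"
proof -
  have "Min ((\<lambda>\<alpha>. \<alpha> \<bullet> \<alpha>) ` \<Phi>) \<in> (\<lambda>\<alpha>. \<alpha> \<bullet> \<alpha>) ` \<Phi>" using assms by (intro Min_in) auto
  then have "0 \<le> Min ((\<lambda>\<alpha>. \<alpha> \<bullet> \<alpha>) ` \<Phi>)" by auto
  then show ?thesis unfolding h_val_def std_pairing_def
    using rho_varpi_nonneg[OF descents_subset] by (intro divide_nonneg_nonneg) auto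
qed

lemma M_elem_charcomb:
  assumes w: "w \<in> W" and q: "q \<ge> 1" and ne: "\<Phi> \<noteq> {}"
  shows "charcomb {\<nu> \<in> dominant_weights \<Phi> \<Delta>. \<exists>\<mu>. \<nu> = (real q - 1) *\<^sub>R wC w + \<mu> \<and>
      (\<exists>\<gamma>\<in>dominant_weights \<Phi> \<Delta>. weight_le \<Phi> \<Delta> 0 \<gamma> \<and>
        weight_le \<Phi> \<Delta> \<gamma> ((2 * (h_val \<Phi> \<Delta> w + 1)) *\<^sub>R \<rho>) \<and> (\<exists>y\<in>W. \<mu> = y \<gamma>))}
    (M_elem \<Phi> \<Delta> q (w0 \<circ> w))" (is "charcomb ?S _")
proof -
  have w0w: "w0 \<circ> w \<in> W" using longest_in w weyl_group_comp by blast
  have ww: "w0 \<circ> (w0 \<circ> w) = w" using longest_comp_self by (simp flip: comp_assoc)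
  define u where "u = w0 \<circ> duflo \<Delta> (w0 \<circ> w)"
  have u: "u \<in> W" unfolding u_def using duflo_props(1)[OF w0w] longest_in weyl_group_comp by blast
  \<comment> \<open>The Duflo involution shares the descents of \<open>w0 \<circ> w\<close>, the
    complement of those of \<open>w\<close>; multiplication by \<open>w0\<close> complements
    again.\<close>
  have "D u = \<Delta> - (\<Delta> - D w)"
    unfolding u_def using duflo_props[OF w0w] descents_longest_comp w by simp
  then have Du: "D u = D w" using descents_subset[of w] by (simp add: double_diff)
  define F where "F = frob q (fs u) * Gd w"
  have M: "M_elem \<Phi> \<Delta> q (w0 \<circ> w) = E F"
    unfolding M_elem_def ZT_pairing_eq F_def ww kl_steinberg_dual_eq[OF w] u_def ..
  have keys: "\<exists>y\<in>W. \<exists>x. k = y (real q *\<^sub>R wC w) + x \<and> x \<in> P \<inter> whull (wI w)"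
    if k: "k \<in> keys F" for k
  proof -
    obtain a x where ax: "a \<in> keys (frob q (fs u))" "x \<in> keys (Gd w)" "k = a + x"
      using k keys_mult[of "frob q (fs u)" "Gd w"] unfolding F_def by auto
    obtain b where b: "b \<in> keys (fs u)" "a = real q *\<^sub>R b"
      using ax(1) keys_push[of "\<lambda>\<nu>. real q *\<^sub>R \<nu>" "fs u"] unfolding frob_def by auto
    obtain y where y: "y \<in> W" "b = y (wC w)"
      using b(1) kl_steinberg_props(2)[OF u] Du unfolding orb_def by auto
    have "a = y (real q *\<^sub>R wC w)" using b y by (simp add: linear_cmul[OF weyl_group_linear])
    then show ?thesis using y(1) ax(2,3) Gd_props[OF w] by blast
  qed
  have qP: "real q *\<^sub>R wC w \<in> P" by (rule weights_scale[OF wC_P])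
  have FZ: "F \<in> ZT \<Phi>"
    unfolding ZT_iff using keys weights_add weights_weyl[OF _ qP] by blast
  show ?thesis
    unfolding M E_expansion(2)[OF FZ]
  proof (rule charcomb_sum)
    fix k assume "k \<in> keys F"
    from keys[OF this] obtain y x where y: "y \<in> W" "k = y (real q *\<^sub>R wC w) + x" and x: "x \<in> P" "x \<in> whull (wI w)"
      by blast
    have kP: "k \<in> P" unfolding y(2) using weights_add weights_weyl[OF y(1) qP] x(1) by blast
    show "charcomb ?S (of_int (lookup F k) * E (gexp k))"
    proof (rule E_gexp_cases[OF kP])
      assume "E (gexp k) = 0"
      then show ?thesis by (simp add: charcomb_0)
    next
      fix z \<zeta> assume z: "z \<in> W" "\<zeta> \<in> P" "dominant \<zeta>" "z k = \<zeta> + \<rho>"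
        "E (gexp k) = of_int (sg z) * weyl_char \<Delta> \<zeta>"
      let ?a = "real q *\<^sub>R wC w"
      have iy: "inv y \<in> W" using weyl_group_inv[OF y(1)] .
      have x': "inv y x \<in> whull (wI w)" by (rule whull_weyl[OF x(2) iy])
      have domr: "dominant (\<zeta> + \<rho>)" using dominant_add z(3) dominant_varpi[of \<Delta>] by blast
      obtain z' where z': "z' \<in> W" "dominant (z' (?a + inv y x))" "z' (?a + inv y x) - ?a \<in> whull (wI w)"
        using dominant_rep_perturbation[OF dominant_scaleR[OF dominant_wC, of "real q" w] x'] by auto
      have "?a + inv y x = inv y k" using y weyl_add[OF iy] by simp
      then have "?a + inv y x = inv y (inv z (\<zeta> + \<rho>))" using z(1,4) by (metis weyl_group_inv_apply(1))
      then have "z' (?a + inv y x) = (z' \<circ> (inv y \<circ> inv z)) (\<zeta> + \<rho>)" by (simp add: comp_apply)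
      \<comment> \<open>Dominant conjugates are unique, so the one found by perturbation is \<zeta>
        + \<rho>.\<close>
      then have "z' (?a + inv y x) = \<zeta> + \<rho>"
        using dominant_orbit_unique[OF domr, of "z' \<circ> (inv y \<circ> inv z)"] z'(1,2) iy z(1) weyl_group_inv weyl_group_comp
        by (metis (no_types, lifting))
      then have h1: "\<zeta> + \<rho> - ?a \<in> whull (wI w)" using z'(3) by simp
      define \<mu> where "\<mu> = \<zeta> - (real q - 1) *\<^sub>R wC w"
      \<comment> \<open>Writing \<rho> as \<open>wI w + wC w\<close> turns the multiple
        \<open>q\<close> of \<open>wC w\<close> into \<open>q - 1\<close> and leaves
        \<open>- wI w\<close>.\<close>
      have "\<mu> = (\<zeta> + \<rho> - ?a) + - wI w"
        unfolding \<mu>_def using wI_wC[of w] by (simp add: algebra_simps)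
      moreover have "- wI w \<in> whull (\<rho> + wC w)" by (rule minus_varpi_in_whull[OF descents_subset])
      ultimately have "\<mu> \<in> whull (wI w + (\<rho> + wC w))" by (simp only: whull_add[OF h1])
      moreover have "wI w + (\<rho> + wC w) = 2 *\<^sub>R \<rho>" using wI_wC[of w] by (simp add: scaleR_2 algebra_simps)
      ultimately have mu: "\<mu> \<in> whull (2 *\<^sub>R \<rho>)" by simp
      have "real q - 1 = real (q - 1)" using q by simp
      then have muP: "\<mu> \<in> P" unfolding \<mu>_def using weights_diff[OF z(2) weights_scale[OF wC_P]] by metis
      obtain v where v: "v \<in> W" "dominant (v \<mu>)" by (rule dominant_rep)
      have g: "v \<mu> \<in> dominant_weights \<Phi> \<Delta>" using dominant_weights_iff weights_weyl v muP by blast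
      have "dom_le (v \<mu>) (2 *\<^sub>R \<rho>)" using mu v(1) unfolding whull_def by blast
      \<comment> \<open>The stated bound exceeds 2\<rho> by a nonnegative multiple of \<rho>,
        because h(w) is nonnegative.\<close>
      moreover have "dom_le (2 *\<^sub>R \<rho>) ((2 * (h_val \<Phi> \<Delta> w + 1)) *\<^sub>R \<rho>)"
        unfolding dom_le_def
      proof
        fix \<alpha> assume "\<alpha> \<in> \<Delta>"
        then have "0 \<le> \<rho> \<bullet> fw \<alpha>" using dominant_nonneg[OF dominant_varpi[of \<Delta>]] by (simp add: dom_le_def)
        then have "0 \<le> h_val \<Phi> \<Delta> w * (\<rho> \<bullet> fw \<alpha>)" using h_val_nonneg[OF ne] by (intro mult_nonneg_nonneg)
        then show "2 *\<^sub>R \<rho> \<bullet> fw \<alpha> \<le> (2 * (h_val \<Phi> \<Delta> w + 1)) *\<^sub>R \<rho> \<bullet> fw \<alpha>" by (simp add: algebra_simps)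
      qed
      ultimately have "weight_le \<Phi> \<Delta> (v \<mu>) ((2 * (h_val \<Phi> \<Delta> w + 1)) *\<^sub>R \<rho>)"
        unfolding weight_le_iff by (rule dom_le_trans)
      moreover have "weight_le \<Phi> \<Delta> 0 (v \<mu>)" unfolding weight_le_iff by (rule dominant_nonneg[OF v(2)])
      moreover have "\<mu> = inv v (v \<mu>)" "inv v \<in> W" using v(1) weyl_group_inv by auto
      moreover have "\<zeta> = (real q - 1) *\<^sub>R wC w + \<mu>" by (simp add: \<mu>_def)
      moreover have "\<zeta> \<in> dominant_weights \<Phi> \<Delta>" using dominant_weights_iff z by blast
      ultimately have "\<zeta> \<in> ?S" using g by blast
      from charcomb_single[OF this, of "lookup F k * sg z"] show ?thesis
        unfolding z(5) by (simp add: mult.assoc)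
    qed
  qed
qed

end

theorem proposition5p2:
  fixes \<Phi> \<Delta> :: "'a::euclidean_space set" and p q k :: nat and w :: "'a \<Rightarrow> 'a"
  assumes "root_system \<Phi>" and "irreducible_roots \<Phi>" and "root_base \<Phi> \<Delta>"
    and "good_prime \<Phi> \<Delta> p" and "k \<ge> 1" and "q = p ^ k"
    and "w \<in> weyl_group \<Delta>"
  shows "\<exists>(\<Lambda> :: 'a set) (c :: 'a \<Rightarrow> int).
    finite \<Lambda> \<and>
    (\<forall>\<nu>\<in>\<Lambda>. \<nu> \<in> dominant_weights \<Phi> \<Delta> \<and>
      (\<exists>\<mu>. \<nu> = (real q - 1) *\<^sub>R varpi \<Delta> (\<Delta> - right_descents \<Delta> w) + \<mu> \<and>
        (\<exists>\<gamma>\<in>dominant_weights \<Phi> \<Delta>.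
          weight_le \<Phi> \<Delta> 0 \<gamma> \<and>
          weight_le \<Phi> \<Delta> \<gamma> ((2 * (h_val \<Phi> \<Delta> w + 1)) *\<^sub>R rho \<Delta>) \<and>
          (\<exists>y\<in>weyl_group \<Delta>. \<mu> = y \<gamma>)))) \<and>
    M_elem \<Phi> \<Delta> q (longest \<Delta> \<circ> w) = (\<Sum>\<nu>\<in>\<Lambda>. of_int (c \<nu>) * weyl_char \<Delta> \<nu>)"
proof -
  interpret based_root_system \<Phi> \<Delta> by unfold_locales (use assms in auto)
  have "p > 0" using assms(4) by (simp add: good_prime_def prime_gt_0_nat)
  then have "q \<ge> 1" using assms(6) by simp
  moreover have "\<Phi> \<noteq> {}" using assms(2) by (simp add: irreducible_roots_def)
  ultimately show ?thesis
    using M_elem_charcomb[OF assms(7)] unfolding charcomb_def subset_iff mem_Collect_eq by meson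
qed

end
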